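(* A propositional container $A\triangleleft P$ is exponentiable in $\mathbf{PCont}$ (i.e. for every propositional container $B\triangleleft Q$ an exponential of $A\triangleleft P$ and $B\triangleleft Q$ exists in $\mathbf{PCont}$) if and only if it is decidable, i.e. $\forall a:A.\,P\,a\lor\lnot P\,a$.
   Context: Work in extensional type theory with a universe $\mathbf{Prop}$ of propositions supporting intuitionistic logic, proof irrelevance and propositional extensionality. A propositional container $A\triangleleft P$ is a type $A$ with $P:A\to\mathbf{Prop}$; $\mathbf{PCont}$ is the category of propositional containers whose morphisms $A\triangleleft P\to B\triangleleft Q$ are maps $f:A\to B$ with $\forall a:A.\,Q(f\,a)\Rightarrow P\,a$. Its binary product is $(A\triangleleft P)\times(B\triangleleft Q)=(A\times B)\triangleleft(\lambda(a,b).\,P\,a\lor Q\,b)$ and its terminal object is $\mathbb{1}\triangleleft(\lambda\_.\,\bot)$; exponentials are with respect to these products. *)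

theory Defs
  imports Main
begin

text \<open>
  HOL is classical, so a container \<open>A \<triangleleft> P\<close> with \<open>A :: 'a set\<close> and \<open>P :: 'a \<Rightarrow> bool\<close>
  would always be decidable.  The type theory is therefore an object language: an extensional
  dependent type theory in the style of Martin-Loef (equality reflection, Russell universes), with
  a universe \<open>Prop\<close> of propositions that is proof irrelevant and propositionally extensional.
  Falsity, disjunction, existential quantification and identity are propositions, and the first
  three are eliminated into propositions only.  There is no rule of excluded middle, choice or
  unique choice.

  Terms use de Bruijn indices.  Propositions are types, as in Coq and Lean: \<open>Pi\<close> into \<open>Prop\<close> is
  implication and universal quantification, \<open>Sig\<close> of propositions is conjunction, and \<open>Unit\<close>
  is both the true proposition and the one-element type.
\<close>

datatype tm =
    Var nat
  | Univ nat | Prop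
  | Pi tm tm | Lam tm | App tm tm
  | Sig tm tm | Pair tm tm | Fst tm | Snd tm
  | Unit | Star
  | Ident tm tm tm | Refl
  | Bot | Abort tm
  | Disj tm tm | Inl tm | Inr tm | DisjE tm tm tm
  | Exist tm tm | ExI tm tm | ExE tm tm

text \<open>
  \<open>Pi\<close>, \<open>Sig\<close> and \<open>Exist\<close> bind one variable in their second argument, \<open>Lam\<close> in its only one,
  \<open>DisjE\<close> in the second and third each; \<open>ExE\<close> binds two in its second (index 1 is the witness,
  index 0 its proof).
\<close>

definition up_ren :: "(nat \<Rightarrow> nat) \<Rightarrow> nat \<Rightarrow> nat" where
  "up_ren r = (\<lambda>n. case n of 0 \<Rightarrow> 0 | Suc m \<Rightarrow> Suc (r m))"

primrec ren :: "(nat \<Rightarrow> nat) \<Rightarrow> tm \<Rightarrow> tm" where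
  "ren r (Var n) = Var (r n)"
| "ren r (Univ i) = Univ i"
| "ren r Prop = Prop"
| "ren r (Pi A B) = Pi (ren r A) (ren (up_ren r) B)"
| "ren r (Lam b) = Lam (ren (up_ren r) b)"
| "ren r (App f a) = App (ren r f) (ren r a)"
| "ren r (Sig A B) = Sig (ren r A) (ren (up_ren r) B)"
| "ren r (Pair a b) = Pair (ren r a) (ren r b)"
| "ren r (Fst p) = Fst (ren r p)"
| "ren r (Snd p) = Snd (ren r p)"
| "ren r Unit = Unit"
| "ren r Star = Star"
| "ren r (Ident A a b) = Ident (ren r A) (ren r a) (ren r b)"
| "ren r Refl = Refl"
| "ren r Bot = Bot"
| "ren r (Abort p) = Abort (ren r p)"
| "ren r (Disj p q) = Disj (ren r p) (ren r q)"
| "ren r (Inl p) = Inl (ren r p)"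
| "ren r (Inr p) = Inr (ren r p)"
| "ren r (DisjE p q s) = DisjE (ren r p) (ren (up_ren r) q) (ren (up_ren r) s)"
| "ren r (Exist A p) = Exist (ren r A) (ren (up_ren r) p)"
| "ren r (ExI a p) = ExI (ren r a) (ren r p)"
| "ren r (ExE p q) = ExE (ren r p) (ren (up_ren (up_ren r)) q)"

abbreviation wk :: "tm \<Rightarrow> tm" where
  "wk \<equiv> ren Suc"

definition up :: "(nat \<Rightarrow> tm) \<Rightarrow> nat \<Rightarrow> tm" where
  "up s = (\<lambda>n. case n of 0 \<Rightarrow> Var 0 | Suc m \<Rightarrow> wk (s m))"

primrec subst :: "(nat \<Rightarrow> tm) \<Rightarrow> tm \<Rightarrow> tm" where
  "subst s (Var n) = s n"
| "subst s (Univ i) = Univ i"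
| "subst s Prop = Prop"
| "subst s (Pi A B) = Pi (subst s A) (subst (up s) B)"
| "subst s (Lam b) = Lam (subst (up s) b)"
| "subst s (App f a) = App (subst s f) (subst s a)"
| "subst s (Sig A B) = Sig (subst s A) (subst (up s) B)"
| "subst s (Pair a b) = Pair (subst s a) (subst s b)"
| "subst s (Fst p) = Fst (subst s p)"
| "subst s (Snd p) = Snd (subst s p)"
| "subst s Unit = Unit"
| "subst s Star = Star"
| "subst s (Ident A a b) = Ident (subst s A) (subst s a) (subst s b)"
| "subst s Refl = Refl"
| "subst s Bot = Bot"
| "subst s (Abort p) = Abort (subst s p)"
| "subst s (Disj p q) = Disj (subst s p) (subst s q)"
| "subst s (Inl p) = Inl (subst s p)"
| "subst s (Inr p) = Inr (subst s p)"
| "subst s (DisjE p q t) = DisjE (subst s p) (subst (up s) q) (subst (up s) t)"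
| "subst s (Exist A p) = Exist (subst s A) (subst (up s) p)"
| "subst s (ExI a p) = ExI (subst s a) (subst s p)"
| "subst s (ExE p q) = ExE (subst s p) (subst (up (up s)) q)"

definition inst :: "tm \<Rightarrow> tm \<Rightarrow> tm" where
  "inst b a = subst (\<lambda>n. case n of 0 \<Rightarrow> a | Suc m \<Rightarrow> Var m) b"

text \<open>Non-dependent functions and pairs; on propositions these are implication and conjunction.\<close>

definition Arr :: "tm \<Rightarrow> tm \<Rightarrow> tm" where
  "Arr A B = Pi A (wk B)"

definition Prod :: "tm \<Rightarrow> tm \<Rightarrow> tm" where
  "Prod A B = Sig A (wk B)"

definition Neg :: "tm \<Rightarrow> tm" where
  "Neg p = Arr p Bot"

definition Iff :: "tm \<Rightarrow> tm \<Rightarrow> tm" where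
  "Iff p q = Prod (Arr p q) (Arr q p)"


text \<open>
  Contexts list the types of the variables, most recent first.  In \<open>typing\<close> and \<open>equal\<close>, a
  type is a term in some \<open>Univ i\<close>.
\<close>

inductive wf_ctx :: "tm list \<Rightarrow> bool"
  and typing :: "tm list \<Rightarrow> tm \<Rightarrow> tm \<Rightarrow> bool" ("(_ \<turnstile> _ \<Colon> _)" [50, 50, 50] 50)
  and equal :: "tm list \<Rightarrow> tm \<Rightarrow> tm \<Rightarrow> tm \<Rightarrow> bool" ("(_ \<turnstile> _ \<approx> _ \<Colon> _)" [50, 50, 50, 50] 50)
where
  wf_nil: "wf_ctx []"
| wf_cons: "wf_ctx G \<Longrightarrow> G \<turnstile> A \<Colon> Univ i \<Longrightarrow> wf_ctx (A # G)"

| t_var: "wf_ctx G \<Longrightarrow> n < length G \<Longrightarrow> G \<turnstile> Var n \<Colon> ren (\<lambda>m. m + Suc n) (G ! n)"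
| t_conv: "G \<turnstile> a \<Colon> A \<Longrightarrow> G \<turnstile> A \<approx> B \<Colon> Univ i \<Longrightarrow> G \<turnstile> a \<Colon> B"

| t_univ: "wf_ctx G \<Longrightarrow> G \<turnstile> Univ i \<Colon> Univ (Suc i)"
| t_prop: "wf_ctx G \<Longrightarrow> G \<turnstile> Prop \<Colon> Univ 0"
| t_cum: "G \<turnstile> A \<Colon> Univ i \<Longrightarrow> G \<turnstile> A \<Colon> Univ (Suc i)"
| t_prf: "G \<turnstile> p \<Colon> Prop \<Longrightarrow> G \<turnstile> p \<Colon> Univ 0"

| t_pi: "G \<turnstile> A \<Colon> Univ i \<Longrightarrow> A # G \<turnstile> B \<Colon> Univ i \<Longrightarrow> G \<turnstile> Pi A B \<Colon> Univ i"
| t_all: "G \<turnstile> A \<Colon> Univ i \<Longrightarrow> A # G \<turnstile> p \<Colon> Prop \<Longrightarrow> G \<turnstile> Pi A p \<Colon> Prop"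
| t_lam: "G \<turnstile> A \<Colon> Univ i \<Longrightarrow> A # G \<turnstile> b \<Colon> B \<Longrightarrow> G \<turnstile> Lam b \<Colon> Pi A B"
| t_app: "G \<turnstile> f \<Colon> Pi A B \<Longrightarrow> G \<turnstile> a \<Colon> A \<Longrightarrow> G \<turnstile> App f a \<Colon> inst B a"

| t_sig: "G \<turnstile> A \<Colon> Univ i \<Longrightarrow> A # G \<turnstile> B \<Colon> Univ i \<Longrightarrow> G \<turnstile> Sig A B \<Colon> Univ i"
| t_and: "G \<turnstile> p \<Colon> Prop \<Longrightarrow> p # G \<turnstile> q \<Colon> Prop \<Longrightarrow> G \<turnstile> Sig p q \<Colon> Prop"
| t_pair: "G \<turnstile> A \<Colon> Univ i \<Longrightarrow> A # G \<turnstile> B \<Colon> Univ i \<Longrightarrow> G \<turnstile> a \<Colon> A \<Longrightarrow> G \<turnstile> b \<Colon> inst B a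
    \<Longrightarrow> G \<turnstile> Pair a b \<Colon> Sig A B"
| t_fst: "G \<turnstile> p \<Colon> Sig A B \<Longrightarrow> G \<turnstile> Fst p \<Colon> A"
| t_snd: "G \<turnstile> p \<Colon> Sig A B \<Longrightarrow> G \<turnstile> Snd p \<Colon> inst B (Fst p)"

| t_unit: "wf_ctx G \<Longrightarrow> G \<turnstile> Unit \<Colon> Prop"
| t_star: "wf_ctx G \<Longrightarrow> G \<turnstile> Star \<Colon> Unit"

| t_ident: "G \<turnstile> A \<Colon> Univ i \<Longrightarrow> G \<turnstile> a \<Colon> A \<Longrightarrow> G \<turnstile> b \<Colon> A \<Longrightarrow> G \<turnstile> Ident A a b \<Colon> Prop"
| t_refl: "G \<turnstile> a \<Colon> A \<Longrightarrow> G \<turnstile> Refl \<Colon> Ident A a a"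

| t_bot: "wf_ctx G \<Longrightarrow> G \<turnstile> Bot \<Colon> Prop"
| t_abort: "G \<turnstile> r \<Colon> Prop \<Longrightarrow> G \<turnstile> a \<Colon> Bot \<Longrightarrow> G \<turnstile> Abort a \<Colon> r"

| t_disj: "G \<turnstile> p \<Colon> Prop \<Longrightarrow> G \<turnstile> q \<Colon> Prop \<Longrightarrow> G \<turnstile> Disj p q \<Colon> Prop"
| t_inl: "G \<turnstile> q \<Colon> Prop \<Longrightarrow> G \<turnstile> a \<Colon> p \<Longrightarrow> G \<turnstile> p \<Colon> Prop \<Longrightarrow> G \<turnstile> Inl a \<Colon> Disj p q"
| t_inr: "G \<turnstile> p \<Colon> Prop \<Longrightarrow> G \<turnstile> a \<Colon> q \<Longrightarrow> G \<turnstile> q \<Colon> Prop \<Longrightarrow> G \<turnstile> Inr a \<Colon> Disj p q"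
| t_disjE: "G \<turnstile> r \<Colon> Prop \<Longrightarrow> G \<turnstile> p \<Colon> Prop \<Longrightarrow> G \<turnstile> q \<Colon> Prop \<Longrightarrow> G \<turnstile> a \<Colon> Disj p q
    \<Longrightarrow> p # G \<turnstile> b \<Colon> wk r \<Longrightarrow> q # G \<turnstile> c \<Colon> wk r
    \<Longrightarrow> G \<turnstile> DisjE a b c \<Colon> r"

| t_exist: "G \<turnstile> A \<Colon> Univ i \<Longrightarrow> A # G \<turnstile> p \<Colon> Prop \<Longrightarrow> G \<turnstile> Exist A p \<Colon> Prop"
| t_exI: "G \<turnstile> A \<Colon> Univ i \<Longrightarrow> A # G \<turnstile> p \<Colon> Prop \<Longrightarrow> G \<turnstile> a \<Colon> A \<Longrightarrow> G \<turnstile> b \<Colon> inst p a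
    \<Longrightarrow> G \<turnstile> ExI a b \<Colon> Exist A p"
| t_exE: "G \<turnstile> r \<Colon> Prop \<Longrightarrow> G \<turnstile> A \<Colon> Univ i \<Longrightarrow> A # G \<turnstile> p \<Colon> Prop \<Longrightarrow> G \<turnstile> a \<Colon> Exist A p
    \<Longrightarrow> p # A # G \<turnstile> b \<Colon> wk (wk r) \<Longrightarrow> G \<turnstile> ExE a b \<Colon> r"

| e_refl: "G \<turnstile> a \<Colon> A \<Longrightarrow> G \<turnstile> a \<approx> a \<Colon> A"
| e_sym: "G \<turnstile> a \<approx> b \<Colon> A \<Longrightarrow> G \<turnstile> b \<approx> a \<Colon> A"
| e_trans: "G \<turnstile> a \<approx> b \<Colon> A \<Longrightarrow> G \<turnstile> b \<approx> c \<Colon> A \<Longrightarrow> G \<turnstile> a \<approx> c \<Colon> A"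
| e_conv: "G \<turnstile> a \<approx> b \<Colon> A \<Longrightarrow> G \<turnstile> A \<approx> B \<Colon> Univ i \<Longrightarrow> G \<turnstile> a \<approx> b \<Colon> B"

| e_reflection: "G \<turnstile> p \<Colon> Ident A a b \<Longrightarrow> G \<turnstile> a \<approx> b \<Colon> A"
| e_irrelevance: "G \<turnstile> p \<Colon> Prop \<Longrightarrow> G \<turnstile> a \<Colon> p \<Longrightarrow> G \<turnstile> b \<Colon> p \<Longrightarrow> G \<turnstile> a \<approx> b \<Colon> p"
| e_propext: "G \<turnstile> p \<Colon> Prop \<Longrightarrow> G \<turnstile> q \<Colon> Prop \<Longrightarrow> G \<turnstile> a \<Colon> Iff p q \<Longrightarrow> G \<turnstile> p \<approx> q \<Colon> Prop"

| e_pi_beta: "G \<turnstile> A \<Colon> Univ i \<Longrightarrow> A # G \<turnstile> b \<Colon> B \<Longrightarrow> G \<turnstile> a \<Colon> A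
    \<Longrightarrow> G \<turnstile> App (Lam b) a \<approx> inst b a \<Colon> inst B a"
| e_pi_eta: "G \<turnstile> f \<Colon> Pi A B \<Longrightarrow> G \<turnstile> f \<approx> Lam (App (wk f) (Var 0)) \<Colon> Pi A B"
| e_fst_beta: "G \<turnstile> A \<Colon> Univ i \<Longrightarrow> A # G \<turnstile> B \<Colon> Univ i \<Longrightarrow> G \<turnstile> a \<Colon> A \<Longrightarrow> G \<turnstile> b \<Colon> inst B a
    \<Longrightarrow> G \<turnstile> Fst (Pair a b) \<approx> a \<Colon> A"
| e_snd_beta: "G \<turnstile> A \<Colon> Univ i \<Longrightarrow> A # G \<turnstile> B \<Colon> Univ i \<Longrightarrow> G \<turnstile> a \<Colon> A \<Longrightarrow> G \<turnstile> b \<Colon> inst B a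
    \<Longrightarrow> G \<turnstile> Snd (Pair a b) \<approx> b \<Colon> inst B a"
| e_sig_eta: "G \<turnstile> p \<Colon> Sig A B \<Longrightarrow> G \<turnstile> p \<approx> Pair (Fst p) (Snd p) \<Colon> Sig A B"

\<comment> \<open>Congruence; for the proof constructors it is an instance of proof irrelevance.\<close>
| e_cum: "G \<turnstile> A \<approx> B \<Colon> Univ i \<Longrightarrow> G \<turnstile> A \<approx> B \<Colon> Univ (Suc i)"
| e_prf: "G \<turnstile> p \<approx> q \<Colon> Prop \<Longrightarrow> G \<turnstile> p \<approx> q \<Colon> Univ 0"
| e_pi: "G \<turnstile> A \<Colon> Univ i \<Longrightarrow> G \<turnstile> A \<approx> A' \<Colon> Univ i \<Longrightarrow> A # G \<turnstile> B \<approx> B' \<Colon> Univ i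
    \<Longrightarrow> G \<turnstile> Pi A B \<approx> Pi A' B' \<Colon> Univ i"
| e_all: "G \<turnstile> A \<Colon> Univ i \<Longrightarrow> G \<turnstile> A \<approx> A' \<Colon> Univ i \<Longrightarrow> A # G \<turnstile> p \<approx> p' \<Colon> Prop
    \<Longrightarrow> G \<turnstile> Pi A p \<approx> Pi A' p' \<Colon> Prop"
| e_lam: "G \<turnstile> A \<Colon> Univ i \<Longrightarrow> A # G \<turnstile> b \<approx> b' \<Colon> B \<Longrightarrow> G \<turnstile> Lam b \<approx> Lam b' \<Colon> Pi A B"
| e_app: "G \<turnstile> f \<approx> f' \<Colon> Pi A B \<Longrightarrow> G \<turnstile> a \<approx> a' \<Colon> A \<Longrightarrow> G \<turnstile> App f a \<approx> App f' a' \<Colon> inst B a"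
| e_sig: "G \<turnstile> A \<Colon> Univ i \<Longrightarrow> G \<turnstile> A \<approx> A' \<Colon> Univ i \<Longrightarrow> A # G \<turnstile> B \<approx> B' \<Colon> Univ i
    \<Longrightarrow> G \<turnstile> Sig A B \<approx> Sig A' B' \<Colon> Univ i"
| e_and: "G \<turnstile> p \<Colon> Prop \<Longrightarrow> G \<turnstile> p \<approx> p' \<Colon> Prop \<Longrightarrow> p # G \<turnstile> q \<approx> q' \<Colon> Prop
    \<Longrightarrow> G \<turnstile> Sig p q \<approx> Sig p' q' \<Colon> Prop"
| e_pair: "G \<turnstile> A \<Colon> Univ i \<Longrightarrow> A # G \<turnstile> B \<Colon> Univ i \<Longrightarrow> G \<turnstile> a \<approx> a' \<Colon> A \<Longrightarrow> G \<turnstile> b \<approx> b' \<Colon> inst B a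
    \<Longrightarrow> G \<turnstile> Pair a b \<approx> Pair a' b' \<Colon> Sig A B"
| e_fst: "G \<turnstile> p \<approx> p' \<Colon> Sig A B \<Longrightarrow> G \<turnstile> Fst p \<approx> Fst p' \<Colon> A"
| e_snd: "G \<turnstile> p \<approx> p' \<Colon> Sig A B \<Longrightarrow> G \<turnstile> Snd p \<approx> Snd p' \<Colon> inst B (Fst p)"
| e_ident: "G \<turnstile> A \<approx> A' \<Colon> Univ i \<Longrightarrow> G \<turnstile> a \<approx> a' \<Colon> A \<Longrightarrow> G \<turnstile> b \<approx> b' \<Colon> A
    \<Longrightarrow> G \<turnstile> Ident A a b \<approx> Ident A' a' b' \<Colon> Prop"
| e_disj: "G \<turnstile> p \<approx> p' \<Colon> Prop \<Longrightarrow> G \<turnstile> q \<approx> q' \<Colon> Prop \<Longrightarrow> G \<turnstile> Disj p q \<approx> Disj p' q' \<Colon> Prop"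
| e_exist: "G \<turnstile> A \<Colon> Univ i \<Longrightarrow> G \<turnstile> A \<approx> A' \<Colon> Univ i \<Longrightarrow> A # G \<turnstile> p \<approx> p' \<Colon> Prop
    \<Longrightarrow> G \<turnstile> Exist A p \<approx> Exist A' p' \<Colon> Prop"


text \<open>
  \<open>PCont\<close> over the types of \<open>Univ i\<close>, as notions of the type theory.  Arguments are terms over a
  common context, hence the weakenings under binders.  The comments give the named versions.
\<close>

definition PCont :: "nat \<Rightarrow> tm" where
  "PCont i = Sig (Univ i) (Arr (Var 0) Prop)"  \<comment> \<open>\<open>\<Sigma>A : Univ i. A \<rightarrow> Prop\<close>\<close>

abbreviation (input) cont :: "tm \<Rightarrow> tm \<Rightarrow> tm" (infix "\<triangleleft>" 60) where
  "A \<triangleleft> P \<equiv> Pair A P"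

definition Sh :: "tm \<Rightarrow> tm" where
  "Sh X = Fst X"

definition Pos :: "tm \<Rightarrow> tm \<Rightarrow> tm" where
  "Pos X a = App (Snd X) a"

definition Hom :: "tm \<Rightarrow> tm \<Rightarrow> tm" where  \<comment> \<open>\<open>\<Sigma>f : Sh X \<rightarrow> Sh Y. \<forall>a : Sh X. Pos Y (f a) \<Rightarrow> Pos X a\<close>\<close>
  "Hom X Y = Sig (Arr (Sh X) (Sh Y))
     (Pi (Sh (wk X)) (Arr (Pos (wk (wk Y)) (App (Var 1) (Var 0))) (Pos (wk (wk X)) (Var 0))))"

definition idm :: tm where
  "idm = Pair (Lam (Var 0)) (Lam (Lam (Var 0)))"

definition comp :: "tm \<Rightarrow> tm \<Rightarrow> tm" where  \<comment> \<open>\<open>(\<lambda>a. g (f a), \<lambda>a q. f\<^sub>2 a (g\<^sub>2 (f a) q))\<close>\<close>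
  "comp g f = Pair
     (Lam (App (Fst (wk g)) (App (Fst (wk f)) (Var 0))))
     (Lam (Lam (App (App (Snd (wk (wk f))) (Var 1))
        (App (App (Snd (wk (wk g))) (App (Fst (wk (wk f))) (Var 1))) (Var 0)))))"

definition PProd :: "tm \<Rightarrow> tm \<Rightarrow> tm" where  \<comment> \<open>\<open>(Sh X \<times> Sh Y) \<triangleleft> (\<lambda>z. Pos X (fst z) \<or> Pos Y (snd z))\<close>\<close>
  "PProd X Y = Prod (Sh X) (Sh Y) \<triangleleft>
     Lam (Disj (Pos (wk X) (Fst (Var 0))) (Pos (wk Y) (Snd (Var 0))))"

definition prj1 :: tm where
  "prj1 = Pair (Lam (Fst (Var 0))) (Lam (Lam (Inl (Var 0))))"

definition prj2 :: tm where
  "prj2 = Pair (Lam (Snd (Var 0))) (Lam (Lam (Inr (Var 0))))"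

definition mpair :: "tm \<Rightarrow> tm \<Rightarrow> tm" where
    \<comment> \<open>\<open>(\<lambda>a. (f a, g a), \<lambda>a q. case q of inl p \<Rightarrow> f\<^sub>2 a p | inr p \<Rightarrow> g\<^sub>2 a p)\<close>\<close>
  "mpair f g = Pair
     (Lam (Pair (App (Fst (wk f)) (Var 0)) (App (Fst (wk g)) (Var 0))))
     (Lam (Lam (DisjE (Var 0)
        (App (App (Snd (wk (wk (wk f)))) (Var 2)) (Var 0))
        (App (App (Snd (wk (wk (wk g)))) (Var 2)) (Var 0)))))"

definition mtimes :: "tm \<Rightarrow> tm \<Rightarrow> tm" where
  "mtimes f g = mpair (comp f prj1) (comp g prj2)"

definition Ex1 :: "tm \<Rightarrow> tm \<Rightarrow> tm" where
    \<comment> \<open>\<open>\<exists>x : A. p x \<and> (\<forall>y : A. p y \<Rightarrow> y = x)\<close>\<close>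
  "Ex1 A p = Exist A (Prod p
     (Pi (wk A) (Arr (ren (up_ren Suc) p) (Ident (wk (wk A)) (Var 0) (Var 1)))))"

definition is_exponential :: "nat \<Rightarrow> tm \<Rightarrow> tm \<Rightarrow> tm \<Rightarrow> tm \<Rightarrow> tm" where
    \<comment> \<open>\<open>\<forall>Z : PCont. \<forall>f : Hom (Z \<times> X) Y. \<exists>!g : Hom Z E. ev \<circ> (g \<times> id) = f\<close>\<close>
  "is_exponential i X Y E ev =
     Pi (PCont i)
      (Pi (Hom (PProd (Var 0) (wk X)) (wk Y))
        (Ex1 (Hom (Var 1) (wk (wk E)))
          (Ident (Hom (PProd (Var 2) (wk (wk (wk X)))) (wk (wk (wk Y))))
             (comp (wk (wk (wk ev))) (mtimes (Var 0) idm))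
             (Var 1))))"

definition exponentiable :: "nat \<Rightarrow> tm \<Rightarrow> tm" where
    \<comment> \<open>\<open>\<forall>Y : PCont. \<exists>E : PCont. \<exists>ev : Hom (E \<times> X) Y. is_exponential X Y E ev\<close>\<close>
  "exponentiable i X =
     Pi (PCont i)
      (Exist (PCont i)
        (Exist (Hom (PProd (Var 0) (wk (wk X))) (Var 1))
          (is_exponential i (wk (wk (wk X))) (Var 2) (Var 1) (Var 0))))"

definition decidable :: "tm \<Rightarrow> tm" where
  "decidable X = Pi (Sh X) (Disj (Pos (wk X) (Var 0)) (Neg (Pos (wk X) (Var 0))))"

end

theory Submission
  imports Defs
begin

text \<open>
  If \<open>X = A \<triangleleft> P\<close> is decidable, the exponential of \<open>X\<close> and \<open>Y = B \<triangleleft> Q\<close> is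
  \<open>(A \<rightarrow> B) \<triangleleft> (\<lambda>f. \<exists>a. \<not> P a \<and> Q (f a))\<close>: for decidable \<open>P a\<close> the condition
  \<open>Q (f z a) \<Rightarrow> R z \<or> P a\<close> on a morphism out of \<open>Z \<times> X\<close> is equivalent to
  \<open>\<not> P a \<and> Q (f z a) \<Rightarrow> R z\<close>.

  Conversely let \<open>a : A\<close> and let \<open>C \<triangleleft> S\<close> be an exponential of \<open>X\<close> and \<open>A \<triangleleft> (\<lambda>b. b = a)\<close>.
  The second projection is a morphism out of \<open>(1 \<triangleleft> \<top>) \<times> X\<close>; transposing it gives \<open>c : C\<close>
  with \<open>ev (c, a) = a\<close>, hence \<open>S c \<or> P a\<close>.  In the case \<open>S c\<close> we have \<open>\<not> P a\<close>: under the hypothesis \<open>P a\<close>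
  the second projection is also a morphism out of \<open>(1 \<triangleleft> \<bottom>) \<times> X\<close>, its transpose picks a shape without
  positions, and that shape is \<open>c\<close> by uniqueness.

  Both arguments are carried out for arbitrary contexts and terms, so that passing under a binder
  only needs the weakening of the hypotheses.  Two morphisms with equal shape maps are equal by proof
  irrelevance, therefore all equations between morphisms are checked on shapes.
\<close>

section \<open>Renaming and substitution\<close>

text \<open>Exponentiability is a proposition: object, evaluation and factorisations merely exist,
  and existence may be opened only towards a proposition. The necessity proof respects this because
  its goals, a disjunction and, in the case of a position at c, \<open>Bot\<close>, are
  propositions; no exponential is ever chosen.

  The two points separate what is known from what is assumed. A true position makes the probe a
  morphism unconditionally, so c is produced before anything is known about P a; a false one makes
  it a morphism only under P a, and then forbids positions at the chosen shape. The two
  factorisations have different hom types. They become comparable because a morphism out of the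
  point without positions, with its shape map kept, is also a morphism out of the other point, where
  uniqueness applies.

  In the converse direction the decision of P a is a disjunction and cannot define a shape by cases.
  The formula for the exponential avoids this: evaluation is ordinary application, and the decision
  is consulted inside the proof that evaluation acts on positions.\<close>

lemma up_ren_simps [simp]: "up_ren r 0 = 0" "up_ren r (Suc n) = Suc (r n)"
  by (simp_all add: up_ren_def)

lemma up_simps [simp]: "up s 0 = Var 0" "up s (Suc n) = wk (s n)"
  by (simp_all add: up_def)

lemma up_Suc: "up_ren r \<circ> Suc = Suc \<circ> r" "up s \<circ> Suc = wk \<circ> s"
  by (rule ext, simp)+

lemma up_ren_comp: "up_ren r \<circ> up_ren s = up_ren (r \<circ> s)"
  by (rule ext) (simp add: up_ren_def split: nat.split)

lemma ren_ren: "ren r (ren s t) = ren (r \<circ> s) t"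
  by (induction t arbitrary: r s) (simp_all add: up_ren_comp)

lemma up_comp_up_ren: "up s \<circ> up_ren r = up (s \<circ> r)"
  by (rule ext) (simp add: up_ren_def up_def split: nat.split)

lemma subst_ren: "subst s (ren r t) = subst (s \<circ> r) t"
  by (induction t arbitrary: r s) (simp_all add: up_comp_up_ren)

lemma ren_wk: "ren (up_ren r) (wk t) = wk (ren r t)"
  by (simp add: ren_ren up_Suc)

lemma ren_comp_up: "ren (up_ren r) \<circ> up s = up (ren r \<circ> s)"
  by (rule ext) (simp add: up_def ren_wk split: nat.split)

lemma ren_subst: "ren r (subst s t) = subst (ren r \<circ> s) t"
  by (induction t arbitrary: r s) (simp_all add: ren_comp_up)

lemma subst_wk: "subst (up s) (wk t) = wk (subst s t)"
  by (simp add: subst_ren ren_subst up_Suc)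

lemma up_comp_up: "subst (up s) \<circ> up r = up (subst s \<circ> r)"
proof
  show "(subst (up s) \<circ> up r) n = up (subst s \<circ> r) n" for n
    by (cases n) (simp_all add: subst_wk)
qed

lemma subst_subst: "subst s (subst r t) = subst (subst s \<circ> r) t"
  by (induction t arbitrary: r s) (simp_all add: up_comp_up)

lemma up_Var: "up Var = Var"
  by (rule ext) (simp add: up_def split: nat.split)

lemma subst_Var [simp]: "subst Var t = t"
  by (induction t) (simp_all add: up_Var)

text \<open>A name for the substitution inside \<open>inst\<close>, so that the simplifier evaluates
  it pointwise instead of meeting a raw case expression.\<close>

definition scons :: "tm \<Rightarrow> nat \<Rightarrow> tm" where
  "scons a = (\<lambda>n. case n of 0 \<Rightarrow> a | Suc m \<Rightarrow> Var m)"

lemma scons_simps [simp]: "scons a 0 = a" "scons a (Suc n) = Var n"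
  by (simp_all add: scons_def)

lemma inst_eq: "inst b a = subst (scons a) b"
  by (simp add: inst_def scons_def)

lemma subst_scons_wk [simp]: "subst (scons a) (wk t) = t"
proof -
  have "scons a \<circ> Suc = Var" by (rule ext) simp
  then show ?thesis by (simp add: subst_ren)
qed

lemma ren_inst: "ren r (inst b a) = inst (ren (up_ren r) b) (ren r a)"
proof -
  have "ren r \<circ> scons a = scons (ren r a) \<circ> up_ren r"
    by (rule ext) (simp add: scons_def up_ren_def split: nat.split)
  then show ?thesis by (simp add: inst_eq ren_subst subst_ren)
qed

lemma subst_inst: "subst s (inst b a) = inst (subst (up s) b) (subst s a)"
proof -
  have "subst s \<circ> scons a = subst (scons (subst s a)) \<circ> up s"
    by (rule ext) (simp add: scons_def up_def split: nat.split flip: scons_def)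
  then show ?thesis by (simp add: inst_eq subst_subst)
qed

section \<open>Preservation of the judgments under renaming and substitution\<close>

definition ren_ok :: "(nat \<Rightarrow> nat) \<Rightarrow> tm list \<Rightarrow> tm list \<Rightarrow> bool" where
  "ren_ok r G D \<longleftrightarrow> wf_ctx D \<and> (\<forall>n < length G. r n < length D \<and>
     ren (\<lambda>m. m + Suc (r n)) (D ! r n) = ren r (ren (\<lambda>m. m + Suc n) (G ! n)))"

lemma ren_ok_wf: "ren_ok r G D \<Longrightarrow> wf_ctx D"
  by (simp add: ren_ok_def)

text \<open>The typing of the renamed \<open>A\<close> is a premise because in
  \<open>renaming_aux\<close> it comes from an induction hypothesis: every binding rule lists the
  type of its bound variable among its premises.\<close>

lemma ren_ok_up:
  assumes "ren_ok r G D" "D \<turnstile> ren r A \<Colon> Univ i"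
  shows "ren_ok (up_ren r) (A # G) (ren r A # D)"
proof -
  have "ren (\<lambda>m. m + Suc (up_ren r n)) ((ren r A # D) ! up_ren r n) =
      ren (up_ren r) (ren (\<lambda>m. m + Suc n) ((A # G) ! n))" if "n < Suc (length G)" for n
  proof (cases n)
    case 0
    then show ?thesis by (simp add: ren_wk)
  next
    case (Suc k)
    then have k: "k < length G" using that by simp
    have "ren (\<lambda>m. m + Suc (Suc (r k))) (D ! r k) = wk (ren (\<lambda>m. m + Suc (r k)) (D ! r k))"
      by (simp only: ren_ren o_def add_Suc_right)
    also have "\<dots> = wk (ren r (ren (\<lambda>m. m + Suc k) (G ! k)))"
      using assms(1) k by (simp add: ren_ok_def)
    also have "\<dots> = ren (up_ren r) (wk (ren (\<lambda>m. m + Suc k) (G ! k)))"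
      by (simp add: ren_wk)
    finally show ?thesis using Suc by (simp add: ren_ren[of Suc] o_def)
  qed
  moreover have "up_ren r n < Suc (length D)" if "n < Suc (length G)" for n
    using that assms(1) by (cases n) (auto simp: ren_ok_def)
  ultimately show ?thesis
    using assms by (auto simp: ren_ok_def intro: wf_cons)
qed

lemma ren_Arr: "ren r (Arr A B) = Arr (ren r A) (ren r B)"
  by (simp add: Arr_def ren_wk)
lemma ren_Prod: "ren r (Prod A B) = Prod (ren r A) (ren r B)"
  by (simp add: Prod_def ren_wk)
lemma ren_Iff: "ren r (Iff A B) = Iff (ren r A) (ren r B)"
  by (simp add: Iff_def ren_Arr ren_Prod)

text \<open>Syntax-directed rules come first, since every typing or equality goal matches a conversion rule.\<close>

lemmas typing_rules = wf_ctx_typing_equal.intros(5,6,9-30,38-42,45-56,7,8,43,44,35-37,31,4,34,32,33)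

text \<open>\<open>D\<close> and \<open>r\<close> stay universally quantified so that the induction
  hypotheses can be used under binders with lifted renamings. Well-formed contexts get the trivial
  conclusion: the well-formedness of \<open>D\<close>, which the variable rule and the axioms ask
  for, is part of \<open>ren_ok\<close>.\<close>

lemma renaming_aux:
  "wf_ctx G \<Longrightarrow> True"
  "G \<turnstile> a \<Colon> A \<Longrightarrow> \<forall>D r. ren_ok r G D \<longrightarrow> D \<turnstile> ren r a \<Colon> ren r A"
  "G \<turnstile> a \<approx> b \<Colon> A \<Longrightarrow> \<forall>D r. ren_ok r G D \<longrightarrow> D \<turnstile> ren r a \<approx> ren r b \<Colon> ren r A"
proof (induction rule: wf_ctx_typing_equal.inducts)
  case (t_var G n)
  show ?case
  proof (intro allI impI)
    fix D r assume "ren_ok r G D"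
    then show "D \<turnstile> ren r (Var n) \<Colon> ren r (ren (\<lambda>m. m + Suc n) (G ! n))"
      using wf_ctx_typing_equal.t_var[of D "r n"] t_var by (simp add: ren_ok_def)
  qed
next
  case (t_disjE G r p q a b c)
  show ?case
  proof (intro allI impI)
    fix D x assume ok: "ren_ok x G D"
    have "D \<turnstile> ren x r \<Colon> Prop" "D \<turnstile> ren x p \<Colon> Prop" "D \<turnstile> ren x q \<Colon> Prop"
        "D \<turnstile> ren x a \<Colon> Disj (ren x p) (ren x q)"
      using t_disjE.IH ok by auto
    moreover from this ok t_disjE.IH(5,6)
    have "ren x p # D \<turnstile> ren (up_ren x) b \<Colon> ren (up_ren x) (wk r)"
        "ren x q # D \<turnstile> ren (up_ren x) c \<Colon> ren (up_ren x) (wk r)"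
      by (blast intro: ren_ok_up[OF _ t_prf])+
    ultimately show "D \<turnstile> ren x (DisjE a b c) \<Colon> ren x r"
      by (simp add: ren_wk wf_ctx_typing_equal.t_disjE)
  qed
next
  case (t_exE G r A i p a b)
  show ?case
  proof (intro allI impI)
    fix D x assume ok: "ren_ok x G D"
    have "D \<turnstile> ren x r \<Colon> Prop" and A: "D \<turnstile> ren x A \<Colon> Univ i"
        and "D \<turnstile> ren x a \<Colon> Exist (ren x A) (ren (up_ren x) p)"
      using t_exE.IH ok by auto
    moreover have p: "ren x A # D \<turnstile> ren (up_ren x) p \<Colon> Prop"
      using t_exE.IH(3) ren_ok_up[OF ok A] by auto
    moreover have "ren (up_ren x) p # ren x A # D \<turnstile> ren (up_ren (up_ren x)) b \<Colon> ren (up_ren (up_ren x)) (wk (wk r))"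
      using t_exE.IH(5) ren_ok_up[OF ren_ok_up[OF ok A] t_prf[OF p]] by blast
    ultimately show "D \<turnstile> ren x (ExE a b) \<Colon> ren x r"
      by (simp add: ren_wk) (rule wf_ctx_typing_equal.t_exE)
  qed
qed (simp_all add: ren_inst ren_wk ren_Iff,
    (intro allI impI, rule typing_rules; blast intro: ren_ok_up ren_ok_up[OF _ t_prf] dest: ren_ok_wf)+)

definition subst_ok :: "(nat \<Rightarrow> tm) \<Rightarrow> tm list \<Rightarrow> tm list \<Rightarrow> bool" where
  "subst_ok s G D \<longleftrightarrow> wf_ctx D \<and>
     (\<forall>n < length G. D \<turnstile> s n \<Colon> subst s (ren (\<lambda>m. m + Suc n) (G ! n)))"

lemma subst_ok_wf: "subst_ok s G D \<Longrightarrow> wf_ctx D"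
  by (simp add: subst_ok_def)

text \<open>Weakening is renaming by \<open>Suc\<close>. It precedes the substitution lemma because
  pushing a substitution under a binder weakens all its old components
  (\<open>subst_ok_up\<close>).\<close>

lemma typing_wk:
  assumes "G \<turnstile> a \<Colon> A" "wf_ctx (B # G)"
  shows "B # G \<turnstile> wk a \<Colon> wk A"
proof -
  have "ren_ok Suc G (B # G)"
    using assms(2) by (simp add: ren_ok_def ren_ren o_def)
  then show ?thesis using assms(1) renaming_aux(2) by blast
qed

lemma typing_wk_up:
  assumes "A # G \<turnstile> b \<Colon> B" "G \<turnstile> A \<Colon> Univ i" "wf_ctx (C # G)"
  shows "wk A # C # G \<turnstile> ren (up_ren Suc) b \<Colon> ren (up_ren Suc) B"
proof -
  have "C # G \<turnstile> wk A \<Colon> Univ i" using typing_wk[OF assms(2,3)] by simp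
  then have "ren_ok (up_ren Suc) (A # G) (wk A # C # G)"
    by (intro ren_ok_up) (use assms(3) in \<open>auto simp: ren_ok_def ren_ren o_def\<close>)
  then show ?thesis using renaming_aux(2)[OF assms(1)] by blast
qed

lemma equal_wk:
  assumes "G \<turnstile> a \<approx> b \<Colon> A" "wf_ctx (B # G)"
  shows "B # G \<turnstile> wk a \<approx> wk b \<Colon> wk A"
proof -
  have "ren_ok Suc G (B # G)"
    using assms(2) by (simp add: ren_ok_def ren_ren o_def)
  then show ?thesis using assms(1) renaming_aux(3) by blast
qed

lemma subst_ok_up:
  assumes "subst_ok s G D" "D \<turnstile> subst s A \<Colon> Univ i"
  shows "subst_ok (up s) (A # G) (subst s A # D)"
proof -
  have wf: "wf_ctx (subst s A # D)"
    using assms by (auto simp: subst_ok_def intro: wf_cons)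
  have "subst s A # D \<turnstile> up s n \<Colon> subst (up s) (ren (\<lambda>m. m + Suc n) ((A # G) ! n))"
    if "n < Suc (length G)" for n
  proof (cases n)
    case 0
    then show ?thesis
      using t_var[OF wf, of 0] by (simp add: subst_wk)
  next
    case (Suc k)
    then have "D \<turnstile> s k \<Colon> subst s (ren (\<lambda>m. m + Suc k) (G ! k))"
      using that assms(1) by (simp add: subst_ok_def)
    from typing_wk[OF this wf]
    have "subst s A # D \<turnstile> wk (s k) \<Colon> subst (up s) (wk (ren (\<lambda>m. m + Suc k) (G ! k)))"
      by (simp add: subst_wk)
    then show ?thesis using Suc by (simp add: ren_ren[of Suc] o_def)
  qed
  then show ?thesis using wf by (simp add: subst_ok_def)
qed

lemma subst_Iff: "subst s (Iff A B) = Iff (subst s A) (subst s B)"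
  by (simp add: Iff_def Arr_def Prod_def subst_wk ren_wk)

lemma substitution_aux:
  "wf_ctx G \<Longrightarrow> True"
  "G \<turnstile> a \<Colon> A \<Longrightarrow> \<forall>D s. subst_ok s G D \<longrightarrow> D \<turnstile> subst s a \<Colon> subst s A"
  "G \<turnstile> a \<approx> b \<Colon> A \<Longrightarrow> \<forall>D s. subst_ok s G D \<longrightarrow> D \<turnstile> subst s a \<approx> subst s b \<Colon> subst s A"
proof (induction rule: wf_ctx_typing_equal.inducts)
  case (t_var G n)
  then show ?case by (simp add: subst_ok_def)
next
  case (t_disjE G r p q a b c)
  show ?case
  proof (intro allI impI)
    fix D x assume ok: "subst_ok x G D"
    have "D \<turnstile> subst x r \<Colon> Prop" "D \<turnstile> subst x p \<Colon> Prop" "D \<turnstile> subst x q \<Colon> Prop"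
        "D \<turnstile> subst x a \<Colon> Disj (subst x p) (subst x q)"
      using t_disjE.IH ok by auto
    moreover from this ok t_disjE.IH(5,6)
    have "subst x p # D \<turnstile> subst (up x) b \<Colon> subst (up x) (wk r)"
        "subst x q # D \<turnstile> subst (up x) c \<Colon> subst (up x) (wk r)"
      by (blast intro: subst_ok_up[OF _ t_prf])+
    ultimately show "D \<turnstile> subst x (DisjE a b c) \<Colon> subst x r"
      by (simp add: subst_wk wf_ctx_typing_equal.t_disjE)
  qed
next
  case (t_exE G r A i p a b)
  show ?case
  proof (intro allI impI)
    fix D x assume ok: "subst_ok x G D"
    have "D \<turnstile> subst x r \<Colon> Prop" and A: "D \<turnstile> subst x A \<Colon> Univ i"
        and "D \<turnstile> subst x a \<Colon> Exist (subst x A) (subst (up x) p)"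
      using t_exE.IH ok by auto
    moreover have p: "subst x A # D \<turnstile> subst (up x) p \<Colon> Prop"
      using t_exE.IH(3) subst_ok_up[OF ok A] by auto
    moreover have "subst (up x) p # subst x A # D \<turnstile> subst (up (up x)) b \<Colon> subst (up (up x)) (wk (wk r))"
      using t_exE.IH(5) subst_ok_up[OF subst_ok_up[OF ok A] t_prf[OF p]] by blast
    ultimately show "D \<turnstile> subst x (ExE a b) \<Colon> subst x r"
      by (simp add: subst_wk) (rule wf_ctx_typing_equal.t_exE)
  qed
qed (simp_all add: subst_inst subst_wk subst_Iff,
    (intro allI impI, rule typing_rules; blast intro: subst_ok_up subst_ok_up[OF _ t_prf] dest: subst_ok_wf)+)

text \<open>Well-formedness of the context can be recovered from any judgment, so later rules need
  not assume it separately.\<close>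

lemma wf_aux:
  "wf_ctx G \<Longrightarrow> True"
  "G \<turnstile> a \<Colon> A \<Longrightarrow> wf_ctx G"
  "G \<turnstile> a \<approx> b \<Colon> A \<Longrightarrow> wf_ctx G"
  by (induction rule: wf_ctx_typing_equal.inducts) simp_all


section \<open>Derived typing rules\<close>

declare ren_wk [simp] subst_wk [simp]

lemma ren_wk_comm [simp]: "ren (up_ren (up_ren r)) (ren (up_ren Suc) t) = ren (up_ren Suc) (ren (up_ren r) t)"
  by (simp add: ren_ren up_ren_comp up_Suc)

lemma subst_wk_comm [simp]: "subst (up (up s)) (ren (up_ren Suc) t) = ren (up_ren Suc) (subst (up s) t)"
  by (simp add: subst_ren ren_subst up_comp_up_ren ren_comp_up up_Suc)

lemma subst_up_scons [simp]: "subst (up (scons a)) (ren (up_ren Suc) t) = t"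
proof -
  have "scons a \<circ> Suc = Var" by (rule ext) simp
  then show ?thesis by (simp add: subst_ren up_comp_up_ren up_Var)
qed

text \<open>This is the instance met when a weakened abstraction is applied to the fresh variable:
  beta reduction gives back the original body.\<close>

lemma subst_scons_Var [simp]: "subst (scons (Var 0)) (ren (up_ren Suc) t) = t"
proof -
  have "scons (Var 0) \<circ> up_ren Suc = Var"
    by (rule ext) (simp add: scons_def up_ren_def split: nat.split)
  then show ?thesis by (simp add: subst_ren)
qed

lemmas container_defs = Arr_def Prod_def Neg_def Iff_def PCont_def Sh_def Pos_def Hom_def idm_def
  comp_def PProd_def prj1_def prj2_def mpair_def mtimes_def Ex1_def is_exponential_def
  exponentiable_def decidable_def numeral_2_eq_2

text \<open>The notions commute with renaming because their arguments are weakened once for each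
  binder crossed. With these rules and their substitution counterparts the definitions can stay
  folded in most later arguments.\<close>

lemma ren_defs [simp]:
  "ren r (Arr A B) = Arr (ren r A) (ren r B)"
  "ren r (Prod A B) = Prod (ren r A) (ren r B)"
  "ren r (Neg A) = Neg (ren r A)"
  "ren r (Iff A B) = Iff (ren r A) (ren r B)"
  "ren r (PCont i) = PCont i"
  "ren r (Sh X) = Sh (ren r X)"
  "ren r (Pos X a) = Pos (ren r X) (ren r a)"
  "ren r (Hom X Y) = Hom (ren r X) (ren r Y)"
  "ren r idm = idm"
  "ren r (comp g f) = comp (ren r g) (ren r f)"
  "ren r (PProd X Y) = PProd (ren r X) (ren r Y)"
  "ren r prj1 = prj1"
  "ren r prj2 = prj2"
  "ren r (mpair f g) = mpair (ren r f) (ren r g)"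
  "ren r (mtimes f g) = mtimes (ren r f) (ren r g)"
  "ren r (Ex1 A p) = Ex1 (ren r A) (ren (up_ren r) p)"
  "ren r (is_exponential i X Y E ev) = is_exponential i (ren r X) (ren r Y) (ren r E) (ren r ev)"
  "ren r (exponentiable i X) = exponentiable i (ren r X)"
  "ren r (decidable X) = decidable (ren r X)"
  by (simp_all add: container_defs)

lemma subst_defs [simp]:
  "subst s (Arr A B) = Arr (subst s A) (subst s B)"
  "subst s (Prod A B) = Prod (subst s A) (subst s B)"
  "subst s (Neg A) = Neg (subst s A)"
  "subst s (Iff A B) = Iff (subst s A) (subst s B)"
  "subst s (PCont i) = PCont i"
  "subst s (Sh X) = Sh (subst s X)"
  "subst s (Pos X a) = Pos (subst s X) (subst s a)"
  "subst s (Hom X Y) = Hom (subst s X) (subst s Y)"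
  "subst s idm = idm"
  "subst s (comp g f) = comp (subst s g) (subst s f)"
  "subst s (PProd X Y) = PProd (subst s X) (subst s Y)"
  "subst s prj1 = prj1"
  "subst s prj2 = prj2"
  "subst s (mpair f g) = mpair (subst s f) (subst s g)"
  "subst s (mtimes f g) = mtimes (subst s f) (subst s g)"
  "subst s (Ex1 A p) = Ex1 (subst s A) (subst (up s) p)"
  "subst s (is_exponential i X Y E ev) =
    is_exponential i (subst s X) (subst s Y) (subst s E) (subst s ev)"
  "subst s (exponentiable i X) = exponentiable i (subst s X)"
  "subst s (decidable X) = decidable (subst s X)"
  by (simp_all add: container_defs)

section \<open>Contexts, instantiation and conversion\<close>

lemma wf_typing: "G \<turnstile> a \<Colon> A \<Longrightarrow> wf_ctx G"
  by (rule wf_aux)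

lemma wf_prop: "G \<turnstile> p \<Colon> Prop \<Longrightarrow> wf_ctx (p # G)"
  by (blast intro: wf_cons t_prf wf_typing)

lemma wf_type: "G \<turnstile> A \<Colon> Univ i \<Longrightarrow> wf_ctx (A # G)"
  by (blast intro: wf_cons wf_typing)

lemma var0: "wf_ctx (A # G) \<Longrightarrow> A # G \<turnstile> Var 0 \<Colon> wk A"
  using t_var[of "A # G" 0] by simp

lemma var1: "wf_ctx (B # A # G) \<Longrightarrow> B # A # G \<turnstile> Var (Suc 0) \<Colon> wk (wk A)"
  using t_var[of "B # A # G" "Suc 0"] by (simp add: ren_ren o_def)

lemma subst_ok_scons:
  assumes "G \<turnstile> a \<Colon> A"
  shows "subst_ok (scons a) (A # G) G"
proof -
  have wf: "wf_ctx G" using assms by (rule wf_typing)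
  have "G \<turnstile> scons a n \<Colon> subst (scons a) (ren (\<lambda>m. m + Suc n) ((A # G) ! n))"
    if "n < Suc (length G)" for n
  proof (cases n)
    case 0
    then show ?thesis using assms by simp
  next
    case (Suc k)
    have "scons a \<circ> (\<lambda>m. Suc (Suc (m + k))) = Var \<circ> (\<lambda>m. Suc (m + k))" by (rule ext) simp
    then have "subst (scons a) (ren (\<lambda>m. Suc (Suc (m + k))) (G ! k)) =
        subst Var (ren (\<lambda>m. Suc (m + k)) (G ! k))"
      by (simp only: subst_ren)
    then show ?thesis using t_var[OF wf, of k] Suc that by simp
  qed
  then show ?thesis using wf by (simp add: subst_ok_def)
qed

lemma typing_inst: "A # G \<turnstile> b \<Colon> B \<Longrightarrow> G \<turnstile> a \<Colon> A \<Longrightarrow> G \<turnstile> inst b a \<Colon> inst B a"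
  unfolding inst_eq using substitution_aux(2) subst_ok_scons by blast

text \<open>Context conversion is substitution by the identity: variable 0 of type
  \<open>wk B\<close> is converted to type \<open>wk A\<close>, and all other variables keep their
  types.\<close>

lemma subst_ok_ctx_conv:
  assumes "G \<turnstile> A \<approx> B \<Colon> Univ i" "G \<turnstile> B \<Colon> Univ j" "G \<turnstile> A \<Colon> Univ k"
  shows "subst_ok Var (A # G) (B # G)"
proof -
  have wf: "wf_ctx (B # G)" using assms(2) by (rule wf_type)
  have "B # G \<turnstile> Var n \<Colon> ren (\<lambda>m. m + Suc n) ((A # G) ! n)" if "n < Suc (length G)" for n
  proof (cases n)
    case 0
    have "B # G \<turnstile> wk B \<approx> wk A \<Colon> Univ i"
      using equal_wk[OF e_sym[OF assms(1)] wf] by simp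
    then show ?thesis using 0 var0[OF wf] by (auto intro: t_conv)
  next
    case (Suc k)
    then show ?thesis using t_var[OF wf, of n] that by simp
  qed
  then show ?thesis using wf by (simp add: subst_ok_def)
qed

lemma ctx_conv_prop:
  assumes "p # G \<turnstile> a \<Colon> A" "G \<turnstile> p \<approx> q \<Colon> Prop" "G \<turnstile> p \<Colon> Prop" "G \<turnstile> q \<Colon> Prop"
  shows "q # G \<turnstile> a \<Colon> A"
  using substitution_aux(2)[OF assms(1)] subst_ok_ctx_conv[OF e_prf[OF assms(2)] t_prf[OF assms(4)] t_prf[OF assms(3)]]
  by fastforce

lemma prop_univ: "G \<turnstile> p \<Colon> Prop \<Longrightarrow> G \<turnstile> p \<Colon> Univ i"
  by (induction i) (auto intro: t_prf t_cum)

lemma conv_prop: "G \<turnstile> a \<Colon> p \<Longrightarrow> G \<turnstile> p \<approx> q \<Colon> Prop \<Longrightarrow> G \<turnstile> a \<Colon> q"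
  by (blast intro: t_conv e_prf)

section \<open>Function and pair types\<close>

lemma Arr_type: "G \<turnstile> A \<Colon> Univ i \<Longrightarrow> G \<turnstile> B \<Colon> Univ i \<Longrightarrow> G \<turnstile> Arr A B \<Colon> Univ i"
  unfolding Arr_def using typing_wk[of G B "Univ i"] by (auto intro: t_pi wf_type)

lemma Arr_prop: "G \<turnstile> A \<Colon> Univ i \<Longrightarrow> G \<turnstile> q \<Colon> Prop \<Longrightarrow> G \<turnstile> Arr A q \<Colon> Prop"
  unfolding Arr_def using typing_wk[of G q "Prop"] by (auto intro: t_all wf_type)

lemma Prod_type: "G \<turnstile> A \<Colon> Univ i \<Longrightarrow> G \<turnstile> B \<Colon> Univ i \<Longrightarrow> G \<turnstile> Prod A B \<Colon> Univ i"
  unfolding Prod_def using typing_wk[of G B "Univ i"] by (auto intro: t_sig wf_type)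

lemma Prod_prop: "G \<turnstile> p \<Colon> Prop \<Longrightarrow> G \<turnstile> q \<Colon> Prop \<Longrightarrow> G \<turnstile> Prod p q \<Colon> Prop"
  unfolding Prod_def using typing_wk[of G q "Prop"] by (auto intro: t_and wf_prop)

lemma Imp_prop: "G \<turnstile> p \<Colon> Prop \<Longrightarrow> G \<turnstile> q \<Colon> Prop \<Longrightarrow> G \<turnstile> Arr p q \<Colon> Prop"
  by (rule Arr_prop[OF t_prf])

lemma Neg_prop: "G \<turnstile> p \<Colon> Prop \<Longrightarrow> G \<turnstile> Neg p \<Colon> Prop"
  unfolding Neg_def by (blast intro: Imp_prop t_bot wf_typing)

lemma app_Arr: "G \<turnstile> f \<Colon> Arr A B \<Longrightarrow> G \<turnstile> a \<Colon> A \<Longrightarrow> G \<turnstile> App f a \<Colon> B"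
  using t_app[of G f A "wk B" a] by (simp add: Arr_def inst_eq)

lemma app_Arr_cong:
  "G \<turnstile> f \<approx> f' \<Colon> Arr A B \<Longrightarrow> G \<turnstile> a \<approx> a' \<Colon> A \<Longrightarrow> G \<turnstile> App f a \<approx> App f' a' \<Colon> B"
  using e_app[of G f f' A "wk B" a] by (simp add: Arr_def inst_eq)

lemma lam_Arr: "G \<turnstile> A \<Colon> Univ i \<Longrightarrow> A # G \<turnstile> b \<Colon> wk B \<Longrightarrow> G \<turnstile> Lam b \<Colon> Arr A B"
  unfolding Arr_def by (rule t_lam)

lemma beta_Arr:
  "G \<turnstile> A \<Colon> Univ i \<Longrightarrow> A # G \<turnstile> b \<Colon> wk B \<Longrightarrow> G \<turnstile> a \<Colon> A \<Longrightarrow> G \<turnstile> App (Lam b) a \<approx> inst b a \<Colon> B"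
  using e_pi_beta[of G A i b "wk B" a] by (simp add: inst_eq)

text \<open>Function extensionality comes from eta: both functions are expanded to abstractions,
  which are equal by congruence.\<close>

lemma Arr_ext:
  assumes "G \<turnstile> A \<Colon> Univ i" "G \<turnstile> f \<Colon> Arr A B" "G \<turnstile> g \<Colon> Arr A B"
    and "A # G \<turnstile> App (wk f) (Var 0) \<approx> App (wk g) (Var 0) \<Colon> wk B"
  shows "G \<turnstile> f \<approx> g \<Colon> Arr A B"
proof -
  have "G \<turnstile> Lam (App (wk f) (Var 0)) \<approx> Lam (App (wk g) (Var 0)) \<Colon> Arr A B"
    using assms unfolding Arr_def by (blast intro: e_lam)
  then show ?thesis
    using assms(2,3) unfolding Arr_def by (blast intro: e_pi_eta e_trans e_sym)
qed

lemma pair_Prod: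
  assumes "G \<turnstile> A \<Colon> Univ i" "G \<turnstile> B \<Colon> Univ i" "G \<turnstile> a \<Colon> A" "G \<turnstile> b \<Colon> B"
  shows "G \<turnstile> Pair a b \<Colon> Prod A B"
    and "G \<turnstile> Fst (Pair a b) \<approx> a \<Colon> A"
    and "G \<turnstile> Snd (Pair a b) \<approx> b \<Colon> B"
proof -
  have B: "A # G \<turnstile> wk B \<Colon> Univ i" using typing_wk[OF assms(2) wf_type[OF assms(1)]] by simp
  have b: "G \<turnstile> b \<Colon> inst (wk B) a" using assms(4) by (simp add: inst_eq)
  show "G \<turnstile> Pair a b \<Colon> Prod A B"
    unfolding Prod_def using assms B b by (blast intro: t_pair)
  show "G \<turnstile> Fst (Pair a b) \<approx> a \<Colon> A"
    using assms B b by (blast intro: e_fst_beta)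
  show "G \<turnstile> Snd (Pair a b) \<approx> b \<Colon> B"
    using e_snd_beta[OF assms(1) B assms(3) b] by (simp add: inst_eq)
qed

lemma pair_Prod_cong:
  assumes "G \<turnstile> A \<Colon> Univ i" "G \<turnstile> B \<Colon> Univ i" "G \<turnstile> a \<approx> a' \<Colon> A" "G \<turnstile> b \<approx> b' \<Colon> B"
  shows "G \<turnstile> Pair a b \<approx> Pair a' b' \<Colon> Prod A B"
  using e_pair[OF assms(1) _ assms(3), of "wk B" b b'] assms(4)
    typing_wk[OF assms(2) wf_type[OF assms(1)]]
  by (simp add: inst_eq Prod_def)

lemma fst_Prod: "G \<turnstile> w \<Colon> Prod A B \<Longrightarrow> G \<turnstile> Fst w \<Colon> A"
  unfolding Prod_def by (rule t_fst)

lemma snd_Prod: "G \<turnstile> w \<Colon> Prod A B \<Longrightarrow> G \<turnstile> Snd w \<Colon> B"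
  using t_snd[of G w A "wk B"] by (simp add: Prod_def inst_eq)

lemma eta_Prod: "G \<turnstile> w \<Colon> Prod A B \<Longrightarrow> G \<turnstile> w \<approx> Pair (Fst w) (Snd w) \<Colon> Prod A B"
  unfolding Prod_def by (rule e_sig_eta)

section \<open>The type of containers\<close>

lemma PCont_body: "wf_ctx G \<Longrightarrow> Univ i # G \<turnstile> Arr (Var 0) Prop \<Colon> Univ i"
proof -
  assume "wf_ctx G"
  then have wf: "wf_ctx (Univ i # G)" by (blast intro: wf_type t_univ)
  have "Univ i # G \<turnstile> Prop \<Colon> Univ j" for j
    using wf by (induction j) (auto intro: t_prop t_cum)
  then show ?thesis using var0[OF wf] by (auto intro: Arr_type)
qed

lemma PCont_type: "wf_ctx G \<Longrightarrow> G \<turnstile> PCont i \<Colon> Univ (Suc i)"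
  unfolding PCont_def by (blast intro: t_sig t_univ t_cum PCont_body)

lemma cont_intro:
  assumes "G \<turnstile> A \<Colon> Univ i" "G \<turnstile> P \<Colon> Arr A Prop"
  shows "G \<turnstile> A \<triangleleft> P \<Colon> PCont i"
    and "G \<turnstile> Sh (A \<triangleleft> P) \<approx> A \<Colon> Univ i"
    and "G \<turnstile> Snd (A \<triangleleft> P) \<approx> P \<Colon> Arr A Prop"
proof -
  have wf: "wf_ctx G" using assms(1) by (rule wf_typing)
  note B = t_cum[OF PCont_body[OF wf]]
  have P: "G \<turnstile> P \<Colon> inst (Arr (Var 0) Prop) A" using assms(2) by (simp add: inst_eq)
  show "G \<turnstile> A \<triangleleft> P \<Colon> PCont i"
    unfolding PCont_def using t_univ[OF wf] B assms(1) P by (rule t_pair)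
  show "G \<turnstile> Sh (A \<triangleleft> P) \<approx> A \<Colon> Univ i"
    unfolding Sh_def using t_univ[OF wf] B assms(1) P by (rule e_fst_beta)
  show "G \<turnstile> Snd (A \<triangleleft> P) \<approx> P \<Colon> Arr A Prop"
    using e_snd_beta[OF t_univ[OF wf] B assms(1) P] by (simp add: inst_eq)
qed

lemma Sh_type: "G \<turnstile> X \<Colon> PCont i \<Longrightarrow> G \<turnstile> Sh X \<Colon> Univ i"
  unfolding PCont_def Sh_def by (rule t_fst)

lemma snd_PCont: "G \<turnstile> X \<Colon> PCont i \<Longrightarrow> G \<turnstile> Snd X \<Colon> Arr (Sh X) Prop"
  using t_snd[of G X "Univ i" "Arr (Var 0) Prop"] by (simp add: PCont_def inst_eq Sh_def)

lemma Pos_prop: "G \<turnstile> X \<Colon> PCont i \<Longrightarrow> G \<turnstile> a \<Colon> Sh X \<Longrightarrow> G \<turnstile> Pos X a \<Colon> Prop"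
  unfolding Pos_def by (blast intro: app_Arr snd_PCont)

lemma Pos_cong:
  "G \<turnstile> X \<Colon> PCont i \<Longrightarrow> G \<turnstile> a \<approx> b \<Colon> Sh X \<Longrightarrow> G \<turnstile> Pos X a \<approx> Pos X b \<Colon> Prop"
  unfolding Pos_def by (blast intro: app_Arr_cong snd_PCont e_refl)

text \<open>Since \<open>Sh\<close> and \<open>Pos\<close> project from a pair, they compute on a
  concrete container only up to judgmental equality. These are the computation rules behind
  \<open>PProd\<close>, \<open>Target\<close>, \<open>Point\<close> and \<open>Expo\<close>.\<close>

lemma cont_lam:
  assumes "G \<turnstile> A \<Colon> Univ i" "A # G \<turnstile> p \<Colon> Prop"
  shows "G \<turnstile> A \<triangleleft> Lam p \<Colon> PCont i"
    and "G \<turnstile> Sh (A \<triangleleft> Lam p) \<approx> A \<Colon> Univ i"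
    and "G \<turnstile> a \<Colon> A \<Longrightarrow> G \<turnstile> Pos (A \<triangleleft> Lam p) a \<approx> inst p a \<Colon> Prop"
proof -
  have P: "G \<turnstile> Lam p \<Colon> Arr A Prop" using assms by (auto intro: lam_Arr)
  show "G \<turnstile> A \<triangleleft> Lam p \<Colon> PCont i" "G \<turnstile> Sh (A \<triangleleft> Lam p) \<approx> A \<Colon> Univ i"
    using cont_intro[OF assms(1) P] by auto
  assume a: "G \<turnstile> a \<Colon> A"
  have "G \<turnstile> Pos (A \<triangleleft> Lam p) a \<approx> App (Lam p) a \<Colon> Prop"
    unfolding Pos_def using cont_intro(3)[OF assms(1) P] e_refl[OF a] by (rule app_Arr_cong)
  moreover have "G \<turnstile> App (Lam p) a \<approx> inst p a \<Colon> Prop"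
    using beta_Arr[of G A i p Prop a] assms a by simp
  ultimately show "G \<turnstile> Pos (A \<triangleleft> Lam p) a \<approx> inst p a \<Colon> Prop" by (rule e_trans)
qed


section \<open>Morphisms of containers\<close>

lemma wk_PCont: "G \<turnstile> X \<Colon> PCont i \<Longrightarrow> wf_ctx (B # G) \<Longrightarrow> B # G \<turnstile> wk X \<Colon> PCont i"
  using typing_wk[of G X "PCont i"] by simp

lemma wk_Hom: "G \<turnstile> f \<Colon> Hom X Y \<Longrightarrow> wf_ctx (B # G) \<Longrightarrow> B # G \<turnstile> wk f \<Colon> Hom (wk X) (wk Y)"
  using typing_wk[of G f "Hom X Y"] by simp

lemma wk_Sh: "G \<turnstile> a \<Colon> Sh X \<Longrightarrow> wf_ctx (B # G) \<Longrightarrow> B # G \<turnstile> wk a \<Colon> Sh (wk X)"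
  using typing_wk[of G a "Sh X"] by simp

text \<open>The position part of \<open>Hom\<close> with the shape map as a parameter: that it is a
  proposition can then be stated for an arbitrary map, and \<open>Hom\<close> becomes a
  \<open>Sig\<close> whose body is the case of \<open>Var 0\<close>.\<close>

definition HomPos :: "tm \<Rightarrow> tm \<Rightarrow> tm \<Rightarrow> tm" where
  "HomPos X Y f = Pi (Sh X) (Arr (Pos (wk Y) (App (wk f) (Var 0))) (Pos (wk X) (Var 0)))"

lemma Hom_eq: "Hom X Y = Sig (Arr (Sh X) (Sh Y)) (HomPos (wk X) (wk Y) (Var 0))"
  by (simp add: Hom_def HomPos_def)

lemma subst_HomPos [simp]: "subst s (HomPos X Y f) = HomPos (subst s X) (subst s Y) (subst s f)"
  by (simp add: HomPos_def)

lemma HomPos_prop: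
  assumes "G \<turnstile> X \<Colon> PCont i" "G \<turnstile> Y \<Colon> PCont i" "G \<turnstile> f \<Colon> Arr (Sh X) (Sh Y)"
  shows "G \<turnstile> HomPos X Y f \<Colon> Prop"
    and "Sh X # G \<turnstile> Pos (wk Y) (App (wk f) (Var 0)) \<Colon> Prop"
    and "Sh X # G \<turnstile> Pos (wk X) (Var 0) \<Colon> Prop"
proof -
  have S: "G \<turnstile> Sh X \<Colon> Univ i" using assms(1) by (rule Sh_type)
  have wf: "wf_ctx (Sh X # G)" using S by (rule wf_type)
  have v: "Sh X # G \<turnstile> Var 0 \<Colon> Sh (wk X)" using var0[OF wf] by simp
  have f: "Sh X # G \<turnstile> wk f \<Colon> Arr (Sh (wk X)) (Sh (wk Y))" using typing_wk[OF assms(3) wf] by simp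
  show 1: "Sh X # G \<turnstile> Pos (wk Y) (App (wk f) (Var 0)) \<Colon> Prop"
    using wk_PCont[OF assms(2) wf] app_Arr[OF f v] by (rule Pos_prop)
  show 2: "Sh X # G \<turnstile> Pos (wk X) (Var 0) \<Colon> Prop"
    using wk_PCont[OF assms(1) wf] v by (rule Pos_prop)
  show "G \<turnstile> HomPos X Y f \<Colon> Prop"
    unfolding HomPos_def using S 1 2 by (blast intro: t_all Imp_prop)
qed

lemma Hom_parts:
  assumes "G \<turnstile> X \<Colon> PCont i" "G \<turnstile> Y \<Colon> PCont i"
  shows "G \<turnstile> Arr (Sh X) (Sh Y) \<Colon> Univ i"
    and "Arr (Sh X) (Sh Y) # G \<turnstile> HomPos (wk X) (wk Y) (Var 0) \<Colon> Univ i"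
proof -
  show A: "G \<turnstile> Arr (Sh X) (Sh Y) \<Colon> Univ i" using assms by (blast intro: Arr_type Sh_type)
  show "Arr (Sh X) (Sh Y) # G \<turnstile> HomPos (wk X) (wk Y) (Var 0) \<Colon> Univ i"
    using assms var0[OF wf_type[OF A]]
    by (intro prop_univ HomPos_prop(1) wk_PCont wf_type[OF A]) simp_all
qed

lemma Hom_type: "G \<turnstile> X \<Colon> PCont i \<Longrightarrow> G \<turnstile> Y \<Colon> PCont i \<Longrightarrow> G \<turnstile> Hom X Y \<Colon> Univ i"
  unfolding Hom_eq by (blast intro: t_sig Hom_parts)

lemma Hom_fst: "G \<turnstile> f \<Colon> Hom X Y \<Longrightarrow> G \<turnstile> Fst f \<Colon> Arr (Sh X) (Sh Y)"
  unfolding Hom_def by (rule t_fst)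

lemma Hom_fst_cong: "G \<turnstile> f \<approx> g \<Colon> Hom X Y \<Longrightarrow> G \<turnstile> Fst f \<approx> Fst g \<Colon> Arr (Sh X) (Sh Y)"
  unfolding Hom_def by (rule e_fst)

lemma Hom_app: "G \<turnstile> f \<Colon> Hom X Y \<Longrightarrow> G \<turnstile> a \<Colon> Sh X \<Longrightarrow> G \<turnstile> App (Fst f) a \<Colon> Sh Y"
  by (blast intro: app_Arr Hom_fst)

lemma Hom_app_cong:
  "G \<turnstile> f \<Colon> Hom X Y \<Longrightarrow> G \<turnstile> a \<approx> b \<Colon> Sh X \<Longrightarrow> G \<turnstile> App (Fst f) a \<approx> App (Fst f) b \<Colon> Sh Y"
  by (blast intro: app_Arr_cong Hom_fst e_refl)

lemma Hom_snd: "G \<turnstile> f \<Colon> Hom X Y \<Longrightarrow> G \<turnstile> Snd f \<Colon> HomPos X Y (Fst f)"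
  using t_snd[of G f "Arr (Sh X) (Sh Y)" "HomPos (wk X) (wk Y) (Var 0)"]
  by (simp add: Hom_eq inst_eq)

lemma Hom_snd_app:
  assumes "G \<turnstile> f \<Colon> Hom X Y" "G \<turnstile> a \<Colon> Sh X" "G \<turnstile> q \<Colon> Pos Y (App (Fst f) a)"
  shows "G \<turnstile> App (App (Snd f) a) q \<Colon> Pos X a"
proof -
  have "G \<turnstile> App (Snd f) a \<Colon> Arr (Pos Y (App (Fst f) a)) (Pos X a)"
    using t_app[OF Hom_snd[OF assms(1), unfolded HomPos_def] assms(2)] by (simp add: inst_eq)
  then show ?thesis using assms(3) by (rule app_Arr)
qed

lemma Hom_pair:
  assumes "G \<turnstile> X \<Colon> PCont i" "G \<turnstile> Y \<Colon> PCont i" "G \<turnstile> f \<Colon> Arr (Sh X) (Sh Y)"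
    and "G \<turnstile> q \<Colon> HomPos X Y f"
  shows "G \<turnstile> Pair f q \<Colon> Hom X Y" and "G \<turnstile> Fst (Pair f q) \<approx> f \<Colon> Arr (Sh X) (Sh Y)"
proof -
  have q: "G \<turnstile> q \<Colon> inst (HomPos (wk X) (wk Y) (Var 0)) f"
    using assms(4) by (simp add: inst_eq)
  show "G \<turnstile> Pair f q \<Colon> Hom X Y" "G \<turnstile> Fst (Pair f q) \<approx> f \<Colon> Arr (Sh X) (Sh Y)"
    unfolding Hom_eq using Hom_parts[OF assms(1,2)] assms(3) q
    by (blast intro: t_pair e_fst_beta)+
qed

text \<open>The introduction rule for morphisms given by explicit terms. The position proof is typed
  over \<open>Pos (wk Y) b\<close>, while \<open>Hom\<close> asks for the unreduced
  \<open>App (wk (Lam b)) (Var 0)\<close>; beta and context conversion bridge the two.\<close>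

lemma Hom_lam:
  assumes "G \<turnstile> X \<Colon> PCont i" "G \<turnstile> Y \<Colon> PCont i"
    and b: "Sh X # G \<turnstile> b \<Colon> Sh (wk Y)"
    and q: "Pos (wk Y) b # Sh X # G \<turnstile> q \<Colon> Pos (wk (wk X)) (Var (Suc 0))"
  shows "G \<turnstile> Pair (Lam b) (Lam (Lam q)) \<Colon> Hom X Y"
    and "G \<turnstile> a \<Colon> Sh X \<Longrightarrow> G \<turnstile> App (Fst (Pair (Lam b) (Lam (Lam q)))) a \<approx> inst b a \<Colon> Sh Y"
proof -
  have S: "G \<turnstile> Sh X \<Colon> Univ i" using assms(1) by (rule Sh_type)
  have wf: "wf_ctx (Sh X # G)" using S by (rule wf_type)
  have f: "G \<turnstile> Lam b \<Colon> Arr (Sh X) (Sh Y)" using lam_Arr[OF S] b by simp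
  note P = HomPos_prop[OF assms(1,2) f]
  have v: "Sh X # G \<turnstile> Var 0 \<Colon> Sh (wk X)" using var0[OF wf] by simp
  have f': "Sh X # G \<turnstile> wk (Lam b) \<Colon> Arr (Sh (wk X)) (Sh (wk Y))"
    using typing_wk[OF f wf] by simp
  have Y: "Sh X # G \<turnstile> wk Y \<Colon> PCont i" using assms(2) wf by (rule wk_PCont)
  have S': "Sh X # G \<turnstile> Sh (wk X) \<Colon> Univ i" using wk_PCont[OF assms(1) wf] by (rule Sh_type)
  have b': "Sh (wk X) # Sh X # G \<turnstile> ren (up_ren Suc) b \<Colon> Sh (wk (wk Y))"
    using typing_wk_up[OF b S wf] by simp
  have "Sh X # G \<turnstile> App (wk (Lam b)) (Var 0) \<approx> b \<Colon> Sh (wk Y)"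
    using beta_Arr[OF S' _ v, of "ren (up_ren Suc) b" "Sh (wk Y)"] b' by (simp add: inst_eq)
  then have eq: "Sh X # G \<turnstile> Pos (wk Y) b \<approx> Pos (wk Y) (App (wk (Lam b)) (Var 0)) \<Colon> Prop"
    by (rule Pos_cong[OF Y e_sym])
  have "Pos (wk Y) (App (wk (Lam b)) (Var 0)) # Sh X # G \<turnstile> q \<Colon> Pos (wk (wk X)) (Var (Suc 0))"
    using q eq Pos_prop[OF Y b] P(2) by (rule ctx_conv_prop)
  then have "G \<turnstile> Lam (Lam q) \<Colon> HomPos X Y (Lam b)"
    unfolding HomPos_def Arr_def using S t_prf[OF P(2)] by (auto intro!: t_lam)
  note H = Hom_pair[OF assms(1,2) f this]
  show "G \<turnstile> Pair (Lam b) (Lam (Lam q)) \<Colon> Hom X Y" by (rule H)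
  assume a: "G \<turnstile> a \<Colon> Sh X"
  show "G \<turnstile> App (Fst (Pair (Lam b) (Lam (Lam q)))) a \<approx> inst b a \<Colon> Sh Y"
    by (rule e_trans[OF app_Arr_cong[OF H(2) e_refl[OF a]] beta_Arr[OF S _ a]]) (use b in simp)
qed

text \<open>Once the shape maps agree, the position parts inhabit the same proposition up to
  conversion, and irrelevance identifies them.\<close>

lemma Hom_ext:
  assumes "G \<turnstile> X \<Colon> PCont i" "G \<turnstile> Y \<Colon> PCont i" "G \<turnstile> f \<Colon> Hom X Y" "G \<turnstile> g \<Colon> Hom X Y"
    and "Sh X # G \<turnstile> App (Fst (wk f)) (Var 0) \<approx> App (Fst (wk g)) (Var 0) \<Colon> Sh (wk Y)"
  shows "G \<turnstile> f \<approx> g \<Colon> Hom X Y"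
proof -
  note A = Hom_parts[OF assms(1,2)]
  have fst: "G \<turnstile> Fst f \<approx> Fst g \<Colon> Arr (Sh X) (Sh Y)"
    using Arr_ext[OF Sh_type[OF assms(1)] Hom_fst[OF assms(3)] Hom_fst[OF assms(4)]] assms(5) by simp
  have HP: "G \<turnstile> HomPos X Y (Fst f) \<Colon> Prop"
    using assms(1,2) Hom_fst[OF assms(3)] by (rule HomPos_prop)
  have "G \<turnstile> HomPos X Y (Fst g) \<approx> HomPos X Y (Fst f) \<Colon> Univ i"
  proof -
    \<comment> \<open>Writing \<open>HomPos X Y h\<close> as an application to \<open>h\<close> lets
      the equality of the shape maps pass through congruence of \<open>App\<close>.\<close>
    have "G \<turnstile> HomPos X Y h \<approx> App (Lam (HomPos (wk X) (wk Y) (Var 0))) h \<Colon> Univ i"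
      if "G \<turnstile> h \<Colon> Arr (Sh X) (Sh Y)" for h
      using e_sym[OF beta_Arr[OF A(1) _ that, of "HomPos (wk X) (wk Y) (Var 0)" "Univ i"]] A(2)
      by (simp add: inst_eq)
    moreover have "G \<turnstile> Lam (HomPos (wk X) (wk Y) (Var 0)) \<Colon> Arr (Arr (Sh X) (Sh Y)) (Univ i)"
      using A by (auto intro: lam_Arr)
    ultimately show ?thesis
      using app_Arr_cong[OF e_refl e_sym[OF fst]] Hom_fst[OF assms(3)] Hom_fst[OF assms(4)]
      by (blast intro: e_trans e_sym)
  qed
  then have "G \<turnstile> Snd g \<Colon> HomPos X Y (Fst f)" using Hom_snd[OF assms(4)] by (blast intro: t_conv)
  then have "G \<turnstile> Snd f \<approx> Snd g \<Colon> inst (HomPos (wk X) (wk Y) (Var 0)) (Fst f)"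
    using e_irrelevance[OF HP Hom_snd[OF assms(3)]] by (simp add: inst_eq)
  then have "G \<turnstile> Pair (Fst f) (Snd f) \<approx> Pair (Fst g) (Snd g) \<Colon> Hom X Y"
    unfolding Hom_eq using A fst by (blast intro: e_pair)
  then show ?thesis
    using assms(3,4) unfolding Hom_eq by (blast intro: e_sig_eta e_trans e_sym)
qed

section \<open>Products, composition and transposition\<close>

lemma PProd_parts:
  assumes "G \<turnstile> X \<Colon> PCont i" "G \<turnstile> Y \<Colon> PCont i"
  shows "G \<turnstile> Prod (Sh X) (Sh Y) \<Colon> Univ i"
    and "Prod (Sh X) (Sh Y) # G \<turnstile> Disj (Pos (wk X) (Fst (Var 0))) (Pos (wk Y) (Snd (Var 0))) \<Colon> Prop"
proof -
  show P: "G \<turnstile> Prod (Sh X) (Sh Y) \<Colon> Univ i" using assms by (blast intro: Prod_type Sh_type)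
  have v: "Prod (Sh X) (Sh Y) # G \<turnstile> Var 0 \<Colon> Prod (Sh (wk X)) (Sh (wk Y))"
    using var0[OF wf_type[OF P]] by simp
  show "Prod (Sh X) (Sh Y) # G \<turnstile> Disj (Pos (wk X) (Fst (Var 0))) (Pos (wk Y) (Snd (Var 0))) \<Colon> Prop"
    using Pos_prop[OF wk_PCont[OF assms(1) wf_type[OF P]] fst_Prod[OF v]]
      Pos_prop[OF wk_PCont[OF assms(2) wf_type[OF P]] snd_Prod[OF v]] by (rule t_disj)
qed

lemma PProd_type: "G \<turnstile> X \<Colon> PCont i \<Longrightarrow> G \<turnstile> Y \<Colon> PCont i \<Longrightarrow> G \<turnstile> PProd X Y \<Colon> PCont i"
  unfolding PProd_def by (blast intro: cont_lam PProd_parts)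

lemma Sh_PProd:
  "G \<turnstile> X \<Colon> PCont i \<Longrightarrow> G \<turnstile> Y \<Colon> PCont i \<Longrightarrow> G \<turnstile> Sh (PProd X Y) \<approx> Prod (Sh X) (Sh Y) \<Colon> Univ i"
  unfolding PProd_def by (blast intro: cont_lam PProd_parts)

text \<open>The shapes of a product are a pair type only up to conversion; in this form the
  conversion can be done by rewriting.\<close>

lemma Sh_PProd_iff:
  assumes "G \<turnstile> X \<Colon> PCont i" "G \<turnstile> Y \<Colon> PCont i"
  shows "G \<turnstile> w \<Colon> Sh (PProd X Y) \<longleftrightarrow> G \<turnstile> w \<Colon> Prod (Sh X) (Sh Y)"
    and "G \<turnstile> w \<approx> w' \<Colon> Sh (PProd X Y) \<longleftrightarrow> G \<turnstile> w \<approx> w' \<Colon> Prod (Sh X) (Sh Y)"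
  using Sh_PProd[OF assms] by (blast intro: t_conv e_conv e_sym)+

lemma Pos_PProd:
  assumes "G \<turnstile> X \<Colon> PCont i" "G \<turnstile> Y \<Colon> PCont i" "G \<turnstile> w \<Colon> Sh (PProd X Y)"
  shows "G \<turnstile> Pos (PProd X Y) w \<approx> Disj (Pos X (Fst w)) (Pos Y (Snd w)) \<Colon> Prop"
  using cont_lam(3)[OF PProd_parts[OF assms(1,2)], of w] assms
  by (simp add: PProd_def[symmetric] Sh_PProd_iff inst_eq)

lemma pair_PProd:
  assumes "G \<turnstile> X \<Colon> PCont i" "G \<turnstile> Y \<Colon> PCont i" "G \<turnstile> a \<Colon> Sh X" "G \<turnstile> b \<Colon> Sh Y"
  shows "G \<turnstile> Pair a b \<Colon> Sh (PProd X Y)"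
    and "G \<turnstile> Fst (Pair a b) \<approx> a \<Colon> Sh X" "G \<turnstile> Snd (Pair a b) \<approx> b \<Colon> Sh Y"
  using pair_Prod[OF Sh_type[OF assms(1)] Sh_type[OF assms(2)] assms(3,4)]
  by (simp_all add: Sh_PProd_iff[OF assms(1,2)])

lemma pair_PProd_cong:
  assumes "G \<turnstile> X \<Colon> PCont i" "G \<turnstile> Y \<Colon> PCont i" "G \<turnstile> a \<approx> a' \<Colon> Sh X" "G \<turnstile> b \<approx> b' \<Colon> Sh Y"
  shows "G \<turnstile> Pair a b \<approx> Pair a' b' \<Colon> Sh (PProd X Y)"
  using pair_Prod_cong[OF Sh_type[OF assms(1)] Sh_type[OF assms(2)] assms(3,4)]
  by (simp add: Sh_PProd_iff[OF assms(1,2)])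

lemma proj_PProd:
  assumes "G \<turnstile> X \<Colon> PCont i" "G \<turnstile> Y \<Colon> PCont i" "G \<turnstile> w \<Colon> Sh (PProd X Y)"
  shows "G \<turnstile> Fst w \<Colon> Sh X" "G \<turnstile> Snd w \<Colon> Sh Y"
    and "G \<turnstile> w \<approx> Pair (Fst w) (Snd w) \<Colon> Sh (PProd X Y)"
  using assms(3) by (auto simp: Sh_PProd_iff[OF assms(1,2)] intro: fst_Prod snd_Prod eta_Prod)

lemma idm_hom:
  assumes "G \<turnstile> X \<Colon> PCont i"
  shows "G \<turnstile> idm \<Colon> Hom X X" and "G \<turnstile> a \<Colon> Sh X \<Longrightarrow> G \<turnstile> App (Fst idm) a \<approx> a \<Colon> Sh X"
proof -
  have wf: "wf_ctx (Sh X # G)" using Sh_type[OF assms] by (rule wf_type)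
  have b: "Sh X # G \<turnstile> Var 0 \<Colon> Sh (wk X)" using var0[OF wf] by simp
  have "wf_ctx (Pos (wk X) (Var 0) # Sh X # G)"
    using Pos_prop[OF wk_PCont[OF assms wf] b] by (rule wf_prop)
  from var0[OF this]
  have q: "Pos (wk X) (Var 0) # Sh X # G \<turnstile> Var 0 \<Colon> Pos (wk (wk X)) (Var (Suc 0))" by simp
  show "G \<turnstile> idm \<Colon> Hom X X" "G \<turnstile> a \<Colon> Sh X \<Longrightarrow> G \<turnstile> App (Fst idm) a \<approx> a \<Colon> Sh X"
    using Hom_lam[OF assms assms b q] by (simp_all add: idm_def inst_eq)
qed

lemma comp_hom:
  assumes X: "G \<turnstile> X \<Colon> PCont i" and Y: "G \<turnstile> Y \<Colon> PCont i" and Z: "G \<turnstile> Z \<Colon> PCont i"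
    and f: "G \<turnstile> f \<Colon> Hom X Y" and g: "G \<turnstile> g \<Colon> Hom Y Z"
  shows "G \<turnstile> comp g f \<Colon> Hom X Z"
    and "G \<turnstile> a \<Colon> Sh X \<Longrightarrow> G \<turnstile> App (Fst (comp g f)) a \<approx> App (Fst g) (App (Fst f) a) \<Colon> Sh Z"
proof -
  have wf: "wf_ctx (Sh X # G)" using Sh_type[OF X] by (rule wf_type)
  have v: "Sh X # G \<turnstile> Var 0 \<Colon> Sh (wk X)" using var0[OF wf] by simp
  note f1 = wk_Hom[OF f wf] and g1 = wk_Hom[OF g wf]
  let ?b = "App (Fst (wk g)) (App (Fst (wk f)) (Var 0))"
  have b: "Sh X # G \<turnstile> ?b \<Colon> Sh (wk Z)" using Hom_app[OF g1 Hom_app[OF f1 v]] .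
  have wf2: "wf_ctx (Pos (wk Z) ?b # Sh X # G)"
    using Pos_prop[OF wk_PCont[OF Z wf] b] by (rule wf_prop)
  note f2 = wk_Hom[OF f1 wf2] and g2 = wk_Hom[OF g1 wf2]
  have v2: "Pos (wk Z) ?b # Sh X # G \<turnstile> Var (Suc 0) \<Colon> Sh (wk (wk X))"
    using wk_Sh[OF v wf2] by simp
  have q: "Pos (wk Z) ?b # Sh X # G \<turnstile> App (App (Snd (wk (wk f))) (Var (Suc 0)))
        (App (App (Snd (wk (wk g))) (App (Fst (wk (wk f))) (Var (Suc 0)))) (Var 0))
      \<Colon> Pos (wk (wk X)) (Var (Suc 0))"
    using var0[OF wf2] by (intro Hom_snd_app[OF f2 v2] Hom_snd_app[OF g2 Hom_app[OF f2 v2]]) simp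
  show "G \<turnstile> comp g f \<Colon> Hom X Z"
      "G \<turnstile> a \<Colon> Sh X \<Longrightarrow> G \<turnstile> App (Fst (comp g f)) a \<approx> App (Fst g) (App (Fst f) a) \<Colon> Sh Z"
    using Hom_lam[OF X Z b q] by (simp_all add: comp_def inst_eq)
qed

lemma prj1_hom:
  assumes X: "G \<turnstile> X \<Colon> PCont i" and Y: "G \<turnstile> Y \<Colon> PCont i"
  shows "G \<turnstile> prj1 \<Colon> Hom (PProd X Y) X"
    and "G \<turnstile> w \<Colon> Sh (PProd X Y) \<Longrightarrow> G \<turnstile> App (Fst prj1) w \<approx> Fst w \<Colon> Sh X"
proof -
  let ?G1 = "Sh (PProd X Y) # G"
  have wf: "wf_ctx ?G1" using Sh_type[OF PProd_type[OF X Y]] by (rule wf_type)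
  note X1 = wk_PCont[OF X wf] and Y1 = wk_PCont[OF Y wf]
  have v: "?G1 \<turnstile> Var 0 \<Colon> Sh (PProd (wk X) (wk Y))" using var0[OF wf] by simp
  note b = proj_PProd(1)[OF X1 Y1 v]
  let ?G2 = "Pos (wk X) (Fst (Var 0)) # ?G1"
  have wf2: "wf_ctx ?G2" using Pos_prop[OF X1 b] by (rule wf_prop)
  note X2 = wk_PCont[OF X1 wf2] and Y2 = wk_PCont[OF Y1 wf2]
  have v2: "?G2 \<turnstile> Var (Suc 0) \<Colon> Sh (PProd (wk (wk X)) (wk (wk Y)))"
    using typing_wk[OF v wf2] by simp
  note p = proj_PProd[OF X2 Y2 v2]
  have "?G2 \<turnstile> Inl (Var 0) \<Colon> Disj (Pos (wk (wk X)) (Fst (Var (Suc 0)))) (Pos (wk (wk Y)) (Snd (Var (Suc 0))))"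
    using var0[OF wf2] by (intro t_inl Pos_prop[OF X2] Pos_prop[OF Y2] p) simp
  then have q: "?G2 \<turnstile> Inl (Var 0) \<Colon> Pos (wk (wk (PProd X Y))) (Var (Suc 0))"
    using Pos_PProd[OF X2 Y2 v2] by (auto intro: conv_prop e_sym)
  show "G \<turnstile> prj1 \<Colon> Hom (PProd X Y) X"
      "G \<turnstile> w \<Colon> Sh (PProd X Y) \<Longrightarrow> G \<turnstile> App (Fst prj1) w \<approx> Fst w \<Colon> Sh X"
    using Hom_lam[OF PProd_type[OF X Y] X b q] by (simp_all add: prj1_def inst_eq)
qed

lemma prj2_hom:
  assumes X: "G \<turnstile> X \<Colon> PCont i" and Y: "G \<turnstile> Y \<Colon> PCont i"
  shows "G \<turnstile> prj2 \<Colon> Hom (PProd X Y) Y"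
    and "G \<turnstile> w \<Colon> Sh (PProd X Y) \<Longrightarrow> G \<turnstile> App (Fst prj2) w \<approx> Snd w \<Colon> Sh Y"
proof -
  let ?G1 = "Sh (PProd X Y) # G"
  have wf: "wf_ctx ?G1" using Sh_type[OF PProd_type[OF X Y]] by (rule wf_type)
  note X1 = wk_PCont[OF X wf] and Y1 = wk_PCont[OF Y wf]
  have v: "?G1 \<turnstile> Var 0 \<Colon> Sh (PProd (wk X) (wk Y))" using var0[OF wf] by simp
  note b = proj_PProd(2)[OF X1 Y1 v]
  let ?G2 = "Pos (wk Y) (Snd (Var 0)) # ?G1"
  have wf2: "wf_ctx ?G2" using Pos_prop[OF Y1 b] by (rule wf_prop)
  note X2 = wk_PCont[OF X1 wf2] and Y2 = wk_PCont[OF Y1 wf2]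
  have v2: "?G2 \<turnstile> Var (Suc 0) \<Colon> Sh (PProd (wk (wk X)) (wk (wk Y)))"
    using typing_wk[OF v wf2] by simp
  note p = proj_PProd[OF X2 Y2 v2]
  have "?G2 \<turnstile> Inr (Var 0) \<Colon> Disj (Pos (wk (wk X)) (Fst (Var (Suc 0)))) (Pos (wk (wk Y)) (Snd (Var (Suc 0))))"
    using var0[OF wf2] by (intro t_inr Pos_prop[OF X2] Pos_prop[OF Y2] p) simp
  then have q: "?G2 \<turnstile> Inr (Var 0) \<Colon> Pos (wk (wk (PProd X Y))) (Var (Suc 0))"
    using Pos_PProd[OF X2 Y2 v2] by (auto intro: conv_prop e_sym)
  show "G \<turnstile> prj2 \<Colon> Hom (PProd X Y) Y"
      "G \<turnstile> w \<Colon> Sh (PProd X Y) \<Longrightarrow> G \<turnstile> App (Fst prj2) w \<approx> Snd w \<Colon> Sh Y"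
    using Hom_lam[OF PProd_type[OF X Y] Y b q] by (simp_all add: prj2_def inst_eq)
qed

lemma mpair_hom:
  assumes X: "G \<turnstile> X \<Colon> PCont i" and Y: "G \<turnstile> Y \<Colon> PCont i" and Z: "G \<turnstile> Z \<Colon> PCont i"
    and f: "G \<turnstile> f \<Colon> Hom Z X" and g: "G \<turnstile> g \<Colon> Hom Z Y"
  shows "G \<turnstile> mpair f g \<Colon> Hom Z (PProd X Y)"
    and "G \<turnstile> a \<Colon> Sh Z \<Longrightarrow>
      G \<turnstile> App (Fst (mpair f g)) a \<approx> Pair (App (Fst f) a) (App (Fst g) a) \<Colon> Sh (PProd X Y)"
proof -
  let ?G1 = "Sh Z # G"
  have wf: "wf_ctx ?G1" using Sh_type[OF Z] by (rule wf_type)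
  have v: "?G1 \<turnstile> Var 0 \<Colon> Sh (wk Z)" using var0[OF wf] by simp
  note X1 = wk_PCont[OF X wf] and Y1 = wk_PCont[OF Y wf] and Z1 = wk_PCont[OF Z wf]
    and f1 = wk_Hom[OF f wf] and g1 = wk_Hom[OF g wf]
  let ?b = "Pair (App (Fst (wk f)) (Var 0)) (App (Fst (wk g)) (Var 0))"
  have b: "?G1 \<turnstile> ?b \<Colon> Sh (PProd (wk X) (wk Y))"
    by (rule pair_PProd[OF X1 Y1 Hom_app[OF f1 v] Hom_app[OF g1 v]])
  let ?G2 = "Pos (PProd (wk X) (wk Y)) ?b # ?G1"
  have wf2: "wf_ctx ?G2" using Pos_prop[OF PProd_type[OF X1 Y1] b] by (rule wf_prop)
  note X2 = wk_PCont[OF X1 wf2] and Y2 = wk_PCont[OF Y1 wf2] and Z2 = wk_PCont[OF Z1 wf2]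
    and f2 = wk_Hom[OF f1 wf2] and g2 = wk_Hom[OF g1 wf2]
  have v2: "?G2 \<turnstile> Var (Suc 0) \<Colon> Sh (wk (wk Z))" using wk_Sh[OF v wf2] by simp
  note fv2 = Hom_app[OF f2 v2] and gv2 = Hom_app[OF g2 v2]
  let ?p = "Pos (wk (wk X)) (App (Fst (wk (wk f))) (Var (Suc 0)))"
  let ?q = "Pos (wk (wk Y)) (App (Fst (wk (wk g))) (Var (Suc 0)))"
  note P = pair_PProd[OF X2 Y2 fv2 gv2]
  have p: "?G2 \<turnstile> ?p \<Colon> Prop" and q: "?G2 \<turnstile> ?q \<Colon> Prop"
    using Pos_prop[OF X2 fv2] Pos_prop[OF Y2 gv2] .
  \<comment> \<open>The hypothesis is a position at a literal pair; reducing its two projections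
    gives the disjunction on which the case distinction runs.\<close>
  have "?G2 \<turnstile> Pos (PProd (wk (wk X)) (wk (wk Y)))
      (Pair (App (Fst (wk (wk f))) (Var (Suc 0))) (App (Fst (wk (wk g))) (Var (Suc 0)))) \<approx> Disj ?p ?q \<Colon> Prop"
    using Pos_PProd[OF X2 Y2 P(1)] Pos_cong[OF X2 P(2)] Pos_cong[OF Y2 P(3)]
    by (blast intro: e_trans e_disj)
  then have d: "?G2 \<turnstile> Var 0 \<Colon> Disj ?p ?q" using var0[OF wf2] by (auto intro: conv_prop)
  have 1: "?p # ?G2 \<turnstile> App (App (Snd (wk (wk (wk f)))) (Var (Suc (Suc 0)))) (Var 0)
      \<Colon> wk (Pos (wk (wk Z)) (Var (Suc 0)))"
    using Hom_snd_app[OF wk_Hom[OF f2 wf_prop[OF p]] wk_Sh[OF v2 wf_prop[OF p]], of "Var 0"]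
      var0[OF wf_prop[OF p]] by simp
  have 2: "?q # ?G2 \<turnstile> App (App (Snd (wk (wk (wk g)))) (Var (Suc (Suc 0)))) (Var 0)
      \<Colon> wk (Pos (wk (wk Z)) (Var (Suc 0)))"
    using Hom_snd_app[OF wk_Hom[OF g2 wf_prop[OF q]] wk_Sh[OF v2 wf_prop[OF q]], of "Var 0"]
      var0[OF wf_prop[OF q]] by simp
  note r = t_disjE[OF Pos_prop[OF Z2 v2] p q d 1 2]
  show "G \<turnstile> mpair f g \<Colon> Hom Z (PProd X Y)"
      "G \<turnstile> a \<Colon> Sh Z \<Longrightarrow>
        G \<turnstile> App (Fst (mpair f g)) a \<approx> Pair (App (Fst f) a) (App (Fst g) a) \<Colon> Sh (PProd X Y)"
    using Hom_lam[OF Z PProd_type[OF X Y], of ?b, simplified, OF b r]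
    by (simp_all add: mpair_def inst_eq numeral_2_eq_2)
qed

lemma mtimes_hom:
  assumes X: "G \<turnstile> X \<Colon> PCont i" and Y: "G \<turnstile> Y \<Colon> PCont i"
    and X': "G \<turnstile> X' \<Colon> PCont i" and Y': "G \<turnstile> Y' \<Colon> PCont i"
    and f: "G \<turnstile> f \<Colon> Hom X X'" and g: "G \<turnstile> g \<Colon> Hom Y Y'"
  shows "G \<turnstile> mtimes f g \<Colon> Hom (PProd X Y) (PProd X' Y')"
    and "G \<turnstile> w \<Colon> Sh (PProd X Y) \<Longrightarrow>
      G \<turnstile> App (Fst (mtimes f g)) w \<approx> Pair (App (Fst f) (Fst w)) (App (Fst g) (Snd w)) \<Colon> Sh (PProd X' Y')"
proof -
  note P = PProd_type[OF X Y]
  note c1 = comp_hom[OF P X X' prj1_hom(1)[OF X Y] f]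
    and c2 = comp_hom[OF P Y Y' prj2_hom(1)[OF X Y] g]
  show "G \<turnstile> mtimes f g \<Colon> Hom (PProd X Y) (PProd X' Y')"
    unfolding mtimes_def using X' Y' P c1(1) c2(1) by (rule mpair_hom)
  assume w: "G \<turnstile> w \<Colon> Sh (PProd X Y)"
  have "G \<turnstile> App (Fst (comp f prj1)) w \<approx> App (Fst f) (Fst w) \<Colon> Sh X'"
    using c1(2)[OF w] Hom_app_cong[OF f prj1_hom(2)[OF X Y w]] by (rule e_trans)
  moreover have "G \<turnstile> App (Fst (comp g prj2)) w \<approx> App (Fst g) (Snd w) \<Colon> Sh Y'"
    using c2(2)[OF w] Hom_app_cong[OF g prj2_hom(2)[OF X Y w]] by (rule e_trans)
  ultimately show "G \<turnstile> App (Fst (mtimes f g)) w \<approx>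
      Pair (App (Fst f) (Fst w)) (App (Fst g) (Snd w)) \<Colon> Sh (PProd X' Y')"
    unfolding mtimes_def
    using mpair_hom(2)[OF X' Y' P c1(1) c2(1) w] pair_PProd_cong[OF X' Y'] by (blast intro: e_trans)
qed

text \<open>With \<open>Hom_ext\<close>, an equation about the composite in the universal property
  becomes an equation between shapes; the second claim is what evaluates the composite
  there.\<close>

lemma transpose_hom:
  assumes X: "G \<turnstile> X \<Colon> PCont i" and Y: "G \<turnstile> Y \<Colon> PCont i" and Z: "G \<turnstile> Z \<Colon> PCont i"
    and E: "G \<turnstile> E \<Colon> PCont i" and ev: "G \<turnstile> ev \<Colon> Hom (PProd E X) Y" and h: "G \<turnstile> h \<Colon> Hom Z E"
  shows "G \<turnstile> comp ev (mtimes h idm) \<Colon> Hom (PProd Z X) Y"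
    and "G \<turnstile> w \<Colon> Sh (PProd Z X) \<Longrightarrow> G \<turnstile> App (Fst (comp ev (mtimes h idm))) w \<approx>
      App (Fst ev) (Pair (App (Fst h) (Fst w)) (Snd w)) \<Colon> Sh Y"
proof -
  note m = mtimes_hom[OF Z X E X h idm_hom(1)[OF X]]
  note c = comp_hom[OF PProd_type[OF Z X] PProd_type[OF E X] Y m(1) ev]
  show "G \<turnstile> comp ev (mtimes h idm) \<Colon> Hom (PProd Z X) Y" by (rule c)
  assume w: "G \<turnstile> w \<Colon> Sh (PProd Z X)"
  note p = proj_PProd[OF Z X w]
  have "G \<turnstile> App (Fst (mtimes h idm)) w \<approx> Pair (App (Fst h) (Fst w)) (Snd w) \<Colon> Sh (PProd E X)"
    using m(2)[OF w] pair_PProd_cong[OF E X e_refl[OF Hom_app[OF h p(1)]] idm_hom(2)[OF X p(2)]]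
    by (rule e_trans)
  then show "G \<turnstile> App (Fst (comp ev (mtimes h idm))) w \<approx>
      App (Fst ev) (Pair (App (Fst h) (Fst w)) (Snd w)) \<Colon> Sh Y"
    using c(2)[OF w] Hom_app_cong[OF ev] by (blast intro: e_trans)
qed


section \<open>Provability and exponentials\<close>

text \<open>Proofs of a proposition are interchangeable by irrelevance, so tracking only the
  existence of a proof term suffices. The typing rules thereby become natural deduction rules
  without explicit terms.\<close>

definition holds :: "tm list \<Rightarrow> tm \<Rightarrow> bool" where
  "holds G p \<longleftrightarrow> (\<exists>t. G \<turnstile> t \<Colon> p)"

lemma holdsI: "G \<turnstile> t \<Colon> p \<Longrightarrow> holds G p"
  by (auto simp: holds_def)

lemma holds_conv: "holds G p \<Longrightarrow> G \<turnstile> p \<approx> q \<Colon> Prop \<Longrightarrow> holds G q"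
  by (auto simp: holds_def intro: conv_prop)

lemma holds_wk: "holds G p \<Longrightarrow> wf_ctx (B # G) \<Longrightarrow> holds (B # G) (wk p)"
  by (auto simp: holds_def intro: typing_wk)

lemma holds_all_I: "G \<turnstile> A \<Colon> Univ i \<Longrightarrow> holds (A # G) p \<Longrightarrow> holds G (Pi A p)"
  by (auto simp: holds_def intro: t_lam)

lemma holds_all_D: "holds G (Pi A p) \<Longrightarrow> G \<turnstile> a \<Colon> A \<Longrightarrow> holds G (inst p a)"
  by (auto simp: holds_def intro: t_app)

lemma holds_imp_I: "G \<turnstile> p \<Colon> Prop \<Longrightarrow> holds (p # G) (wk q) \<Longrightarrow> holds G (Arr p q)"
  unfolding Arr_def by (rule holds_all_I[OF t_prf])

lemma holds_imp_D: "holds G (Arr p q) \<Longrightarrow> holds G p \<Longrightarrow> holds G q"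
  by (auto simp: holds_def intro: app_Arr)

lemma holds_and_I: "G \<turnstile> p \<Colon> Prop \<Longrightarrow> G \<turnstile> q \<Colon> Prop \<Longrightarrow> holds G p \<Longrightarrow> holds G q \<Longrightarrow> holds G (Prod p q)"
  by (auto simp: holds_def intro: pair_Prod t_prf)

lemma holds_and_D: "holds G (Prod p q) \<Longrightarrow> holds G p" "holds G (Prod p q) \<Longrightarrow> holds G q"
  by (auto simp: holds_def intro: fst_Prod snd_Prod)

lemma holds_or_I:
  assumes "G \<turnstile> p \<Colon> Prop" "G \<turnstile> q \<Colon> Prop"
  shows "holds G p \<Longrightarrow> holds G (Disj p q)" and "holds G q \<Longrightarrow> holds G (Disj p q)"
  using assms by (auto simp: holds_def intro: t_inl t_inr)

text \<open>\<open>r\<close> has to be a proposition, as in \<open>holds_ex_E\<close>: neither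
  disjunctions nor existentials eliminate into arbitrary types.\<close>

lemma holds_or_E:
  assumes "holds G (Disj p q)" "G \<turnstile> p \<Colon> Prop" "G \<turnstile> q \<Colon> Prop" "G \<turnstile> r \<Colon> Prop"
    and "holds (p # G) (wk r)" "holds (q # G) (wk r)"
  shows "holds G r"
  using assms by (auto simp: holds_def intro: t_disjE)

lemma holds_ex_I:
  assumes "G \<turnstile> A \<Colon> Univ i" "A # G \<turnstile> p \<Colon> Prop" "G \<turnstile> a \<Colon> A" "holds G (inst p a)"
  shows "holds G (Exist A p)"
  using assms by (auto simp: holds_def intro: t_exI)

lemma holds_ex_E:
  assumes "holds G (Exist A p)" "G \<turnstile> A \<Colon> Univ i" "A # G \<turnstile> p \<Colon> Prop" "G \<turnstile> r \<Colon> Prop"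
    and "holds (p # A # G) (wk (wk r))"
  shows "holds G r"
  using assms by (auto simp: holds_def intro: t_exE)

lemma holds_bot_E: "holds G Bot \<Longrightarrow> G \<turnstile> r \<Colon> Prop \<Longrightarrow> holds G r"
  by (auto simp: holds_def intro: t_abort)

lemma holds_assumption: "wf_ctx (p # G) \<Longrightarrow> holds (p # G) (wk p)"
  by (blast intro: holdsI var0)

text \<open>Equality reflection; with the converse \<open>Ident_holds\<close>, equations pass freely
  between provability and judgmental equality.\<close>

lemma holds_Ident: "holds G (Ident A a b) \<Longrightarrow> G \<turnstile> a \<approx> b \<Colon> A"
  by (auto simp: holds_def intro: e_reflection)

lemma Ident_holds:
  assumes "G \<turnstile> a \<approx> b \<Colon> A" "G \<turnstile> A \<Colon> Univ i" "G \<turnstile> a \<Colon> A"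
  shows "G \<turnstile> Refl \<Colon> Ident A a b"
  using t_refl[OF assms(3)] e_ident[OF e_refl[OF assms(2)] e_refl[OF assms(3)] assms(1)]
  by (rule conv_prop)

section \<open>Unique existence and the universal property\<close>

definition Uniq :: "tm \<Rightarrow> tm \<Rightarrow> tm \<Rightarrow> tm" where
  "Uniq A p g = Pi A (Arr p (Ident (wk A) (Var 0) (wk g)))"

lemma Uniq_simps [simp]:
  "ren r (Uniq A p g) = Uniq (ren r A) (ren (up_ren r) p) (ren r g)"
  "subst s (Uniq A p g) = Uniq (subst s A) (subst (up s) p) (subst s g)"
  by (simp_all add: Uniq_def)

lemma Ex1_eq: "Ex1 A p = Exist A (Prod p (Uniq (wk A) (ren (up_ren Suc) p) (Var 0)))"
  by (simp add: Ex1_def Uniq_def)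

lemma Uniq_prop:
  assumes "G \<turnstile> A \<Colon> Univ i" "A # G \<turnstile> p \<Colon> Prop" "G \<turnstile> g \<Colon> A"
  shows "G \<turnstile> Uniq A p g \<Colon> Prop"
proof -
  have wf: "wf_ctx (A # G)" using assms(1) by (rule wf_type)
  have "A # G \<turnstile> wk A \<Colon> Univ i" using typing_wk[OF assms(1) wf] by simp
  then have "A # G \<turnstile> Ident (wk A) (Var 0) (wk g) \<Colon> Prop"
    using var0[OF wf] typing_wk[OF assms(3) wf] by (rule t_ident)
  then show ?thesis unfolding Uniq_def using assms(1,2) by (blast intro: t_all Imp_prop)
qed

lemma Uniq_D:
  assumes "holds G (Uniq A p g)" "G \<turnstile> y \<Colon> A" "holds G (inst p y)"
  shows "G \<turnstile> y \<approx> g \<Colon> A"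
  using holds_imp_D[of G "inst p y" "Ident A y g"] holds_all_D[OF assms(1)[unfolded Uniq_def] assms(2)] assms(3)
  by (auto simp: inst_eq intro: holds_Ident)

text \<open>In the third premise \<open>Var (Suc 0)\<close> is the competitor and
  \<open>Var 0\<close> the proof that it satisfies \<open>p\<close>; the judgmental equality becomes
  the identity proof \<open>Refl\<close>.\<close>

lemma Uniq_I:
  assumes "G \<turnstile> A \<Colon> Univ i" "A # G \<turnstile> p \<Colon> Prop"
    and "p # A # G \<turnstile> Var (Suc 0) \<approx> wk (wk g) \<Colon> wk (wk A)"
  shows "holds G (Uniq A p g)"
proof -
  have wf: "wf_ctx (p # A # G)" using assms(2) by (rule wf_prop)
  have "p # A # G \<turnstile> wk (wk A) \<Colon> Univ i"
    using typing_wk[OF typing_wk[OF assms(1) wf_type[OF assms(1)]] wf] by simp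
  then have "p # A # G \<turnstile> Refl \<Colon> wk (Ident (wk A) (Var 0) (wk g))"
    using Ident_holds[OF assms(3)] var1[OF wf] by simp
  then show ?thesis
    unfolding Uniq_def using assms(1,2) by (blast intro: holds_all_I holds_imp_I holdsI)
qed

lemma Ex1_body:
  assumes "G \<turnstile> A \<Colon> Univ i" "A # G \<turnstile> p \<Colon> Prop"
  shows "A # G \<turnstile> Prod p (Uniq (wk A) (ren (up_ren Suc) p) (Var 0)) \<Colon> Prop"
proof -
  have wf: "wf_ctx (A # G)" using assms(1) by (rule wf_type)
  have "A # G \<turnstile> wk A \<Colon> Univ i" using typing_wk[OF assms(1) wf] by simp
  then show ?thesis
    using typing_wk_up[OF assms(2,1) wf] var0[OF wf] assms(2) by (auto intro!: Prod_prop Uniq_prop)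
qed

lemma Ex1_prop: "G \<turnstile> A \<Colon> Univ i \<Longrightarrow> A # G \<turnstile> p \<Colon> Prop \<Longrightarrow> G \<turnstile> Ex1 A p \<Colon> Prop"
  unfolding Ex1_eq by (blast intro: t_exist Ex1_body)

lemma Ex1_I:
  assumes "G \<turnstile> A \<Colon> Univ i" "A # G \<turnstile> p \<Colon> Prop" "G \<turnstile> g \<Colon> A"
    and "holds G (inst p g)" "holds G (Uniq A p g)"
  shows "holds G (Ex1 A p)"
proof -
  have "G \<turnstile> inst p g \<Colon> Prop" using typing_inst[OF assms(2,3)] by (simp add: inst_eq)
  then have "holds G (Prod (inst p g) (Uniq A p g))"
    using Uniq_prop[OF assms(1-3)] assms(4,5) by (rule holds_and_I)
  then show ?thesis
    unfolding Ex1_eq using assms(1,3) Ex1_body[OF assms(1,2)]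
    by (auto simp: inst_eq intro: holds_ex_I)
qed

text \<open>The equation of the universal property as a predicate of the factorisation, which is
  \<open>Var 0\<close>; the parameters live in the outer context.\<close>

definition Transp :: "tm \<Rightarrow> tm \<Rightarrow> tm \<Rightarrow> tm \<Rightarrow> tm \<Rightarrow> tm" where
  "Transp Z X Y ev f = Ident (Hom (PProd (wk Z) (wk X)) (wk Y)) (comp (wk ev) (mtimes (Var 0) idm)) (wk f)"

lemma Transp_simps [simp]:
  "ren (up_ren r) (Transp Z X Y ev f) = Transp (ren r Z) (ren r X) (ren r Y) (ren r ev) (ren r f)"
  "subst (up s) (Transp Z X Y ev f) = Transp (subst s Z) (subst s X) (subst s Y) (subst s ev) (subst s f)"
  by (simp_all add: Transp_def)

lemma inst_Transp:
  "inst (Transp Z X Y ev f) g = Ident (Hom (PProd Z X) Y) (comp ev (mtimes g idm)) f"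
  by (simp add: Transp_def inst_eq)

lemma is_exponential_eq:
  "is_exponential i X Y E ev = Pi (PCont i) (Pi (Hom (PProd (Var 0) (wk X)) (wk Y))
     (Ex1 (Hom (Var 1) (wk (wk E)))
       (Transp (Var 1) (wk (wk X)) (wk (wk Y)) (wk (wk ev)) (Var 0))))"
  by (simp add: is_exponential_def Transp_def numeral_2_eq_2)

lemma Transp_prop:
  assumes X: "G \<turnstile> X \<Colon> PCont i" and Y: "G \<turnstile> Y \<Colon> PCont i" and Z: "G \<turnstile> Z \<Colon> PCont i"
    and E: "G \<turnstile> E \<Colon> PCont i" and ev: "G \<turnstile> ev \<Colon> Hom (PProd E X) Y" and f: "G \<turnstile> f \<Colon> Hom (PProd Z X) Y"
  shows "Hom Z E # G \<turnstile> Transp Z X Y ev f \<Colon> Prop"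
proof -
  have wf: "wf_ctx (Hom Z E # G)" using Hom_type[OF Z E] by (rule wf_type)
  note X1 = wk_PCont[OF X wf] and Y1 = wk_PCont[OF Y wf] and Z1 = wk_PCont[OF Z wf] and E1 = wk_PCont[OF E wf]
  have ev1: "Hom Z E # G \<turnstile> wk ev \<Colon> Hom (PProd (wk E) (wk X)) (wk Y)"
    using wk_Hom[OF ev wf] by simp
  have f1: "Hom Z E # G \<turnstile> wk f \<Colon> Hom (PProd (wk Z) (wk X)) (wk Y)"
    using wk_Hom[OF f wf] by simp
  have g: "Hom Z E # G \<turnstile> Var 0 \<Colon> Hom (wk Z) (wk E)" using var0[OF wf] by simp
  show ?thesis
    unfolding Transp_def
    using Hom_type[OF PProd_type[OF Z1 X1] Y1] transpose_hom(1)[OF X1 Y1 Z1 E1 ev1 g] f1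
    by (rule t_ident)
qed

lemma universal_I:
  assumes X: "G \<turnstile> X \<Colon> PCont i" and Y: "G \<turnstile> Y \<Colon> PCont i" and Z: "G \<turnstile> Z \<Colon> PCont i"
    and E: "G \<turnstile> E \<Colon> PCont i" and ev: "G \<turnstile> ev \<Colon> Hom (PProd E X) Y" and f: "G \<turnstile> f \<Colon> Hom (PProd Z X) Y"
    and g: "G \<turnstile> g \<Colon> Hom Z E"
    and eq: "G \<turnstile> comp ev (mtimes g idm) \<approx> f \<Colon> Hom (PProd Z X) Y"
    and uniq: "Transp Z X Y ev f # Hom Z E # G \<turnstile> Var (Suc 0) \<approx> wk (wk g) \<Colon> Hom (wk (wk Z)) (wk (wk E))"
  shows "holds G (Ex1 (Hom Z E) (Transp Z X Y ev f))"
proof -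
  note A = Hom_type[OF Z E] and T = Transp_prop[OF X Y Z E ev f]
  have "holds G (inst (Transp Z X Y ev f) g)"
    unfolding inst_Transp
    using Ident_holds[OF eq Hom_type[OF PProd_type[OF Z X] Y] transpose_hom(1)[OF X Y Z E ev g]]
    by (rule holdsI)
  moreover have "holds G (Uniq (Hom Z E) (Transp Z X Y ev f) g)"
    by (rule Uniq_I[OF A T]) (use uniq in simp)
  ultimately show ?thesis by (rule Ex1_I[OF A T g])
qed

text \<open>Unique existence is opened here towards a proposition \<open>r\<close>. In the last
  premise \<open>Var (Suc 0)\<close> is the factorisation, and \<open>B\<close>, the type of
  \<open>Var 0\<close>, carries its properties; callers see \<open>B\<close> only through these
  consequences.\<close>

lemma universal_E:
  assumes X: "G \<turnstile> X \<Colon> PCont i" and Y: "G \<turnstile> Y \<Colon> PCont i" and Z: "G \<turnstile> Z \<Colon> PCont i"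
    and E: "G \<turnstile> E \<Colon> PCont i" and ev: "G \<turnstile> ev \<Colon> Hom (PProd E X) Y" and f: "G \<turnstile> f \<Colon> Hom (PProd Z X) Y"
    and ex: "holds G (Ex1 (Hom Z E) (Transp Z X Y ev f))" and r: "G \<turnstile> r \<Colon> Prop"
    and step: "\<And>B. \<lbrakk>wf_ctx (Hom Z E # G); wf_ctx (B # Hom Z E # G);
      B # Hom Z E # G \<turnstile> Var (Suc 0) \<Colon> Hom (wk (wk Z)) (wk (wk E));
      B # Hom Z E # G \<turnstile> comp (wk (wk ev)) (mtimes (Var (Suc 0)) idm) \<approx> wk (wk f)
        \<Colon> Hom (PProd (wk (wk Z)) (wk (wk X))) (wk (wk Y));
      holds (B # Hom Z E # G) (Uniq (Hom (wk (wk Z)) (wk (wk E)))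
        (Transp (wk (wk Z)) (wk (wk X)) (wk (wk Y)) (wk (wk ev)) (wk (wk f))) (Var (Suc 0)))\<rbrakk>
      \<Longrightarrow> holds (B # Hom Z E # G) (wk (wk r))"
  shows "holds G r"
proof -
  note A = Hom_type[OF Z E] and T = Transp_prop[OF X Y Z E ev f]
  let ?B = "Prod (Transp Z X Y ev f) (Uniq (wk (Hom Z E)) (ren (up_ren Suc) (Transp Z X Y ev f)) (Var 0))"
  have wf2: "wf_ctx (?B # Hom Z E # G)" using Ex1_body[OF A T] by (rule wf_prop)
  note h = holds_and_D[OF holds_assumption[OF wf2, simplified]]
  have "holds (?B # Hom Z E # G) (wk (wk r))"
  proof (rule step)
    show "wf_ctx (Hom Z E # G)" using A by (rule wf_type)
    show "wf_ctx (?B # Hom Z E # G)" by (rule wf2)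
    show "?B # Hom Z E # G \<turnstile> Var (Suc 0) \<Colon> Hom (wk (wk Z)) (wk (wk E))"
      using var1[OF wf2] by simp
    \<comment> \<open>Weakening past the proof turns the bound morphism into
      \<open>Var (Suc 0)\<close>; hence this is the predicate, moved to the larger context, taken at
      that variable.\<close>
    have "wk (Transp Z X Y ev f) = inst (Transp (wk (wk Z)) (wk (wk X)) (wk (wk Y)) (wk (wk ev)) (wk (wk f))) (Var (Suc 0))"
      by (simp add: inst_Transp) (simp add: Transp_def)
    then show "?B # Hom Z E # G \<turnstile> comp (wk (wk ev)) (mtimes (Var (Suc 0)) idm) \<approx> wk (wk f)
        \<Colon> Hom (PProd (wk (wk Z)) (wk (wk X))) (wk (wk Y))"
      using h(1) by (auto simp: inst_Transp intro: holds_Ident)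
    show "holds (?B # Hom Z E # G) (Uniq (Hom (wk (wk Z)) (wk (wk E)))
        (Transp (wk (wk Z)) (wk (wk X)) (wk (wk Y)) (wk (wk ev)) (wk (wk f))) (Var (Suc 0)))"
      using h(2) by simp
  qed
  then show ?thesis using holds_ex_E[OF ex[unfolded Ex1_eq] A Ex1_body[OF A T] r] by simp
qed

lemma is_exponential_body:
  assumes X: "G \<turnstile> X \<Colon> PCont i" and Y: "G \<turnstile> Y \<Colon> PCont i"
    and E: "G \<turnstile> E \<Colon> PCont i" and ev: "G \<turnstile> ev \<Colon> Hom (PProd E X) Y"
  defines "H \<equiv> Hom (PProd (Var 0) (wk X)) (wk Y)"
  shows "wf_ctx (PCont i # G)" "PCont i # G \<turnstile> H \<Colon> Univ i" "wf_ctx (H # PCont i # G)"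
    and "H # PCont i # G \<turnstile> wk (wk X) \<Colon> PCont i"
    and "H # PCont i # G \<turnstile> wk (wk Y) \<Colon> PCont i"
    and "H # PCont i # G \<turnstile> Var 1 \<Colon> PCont i"
    and "H # PCont i # G \<turnstile> wk (wk E) \<Colon> PCont i"
    and "H # PCont i # G \<turnstile> wk (wk ev) \<Colon> Hom (PProd (wk (wk E)) (wk (wk X))) (wk (wk Y))"
    and "H # PCont i # G \<turnstile> Var 0 \<Colon> Hom (PProd (Var 1) (wk (wk X))) (wk (wk Y))"
proof -
  show wf1: "wf_ctx (PCont i # G)" by (rule wf_type[OF PCont_type[OF wf_typing[OF X]]])
  note X1 = wk_PCont[OF X wf1] and Y1 = wk_PCont[OF Y wf1]
  have Z1: "PCont i # G \<turnstile> Var 0 \<Colon> PCont i" using var0[OF wf1] by simp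
  show H: "PCont i # G \<turnstile> H \<Colon> Univ i" unfolding H_def using PProd_type[OF Z1 X1] Y1 by (rule Hom_type)
  show wf2: "wf_ctx (H # PCont i # G)" using H by (rule wf_type)
  show "H # PCont i # G \<turnstile> wk (wk X) \<Colon> PCont i" using X1 wf2 by (rule wk_PCont)
  show "H # PCont i # G \<turnstile> wk (wk Y) \<Colon> PCont i" using Y1 wf2 by (rule wk_PCont)
  show "H # PCont i # G \<turnstile> wk (wk E) \<Colon> PCont i" by (rule wk_PCont[OF wk_PCont[OF E wf1] wf2])
  show "H # PCont i # G \<turnstile> Var 1 \<Colon> PCont i" using wk_PCont[OF Z1 wf2] by simp
  show "H # PCont i # G \<turnstile> wk (wk ev) \<Colon> Hom (PProd (wk (wk E)) (wk (wk X))) (wk (wk Y))"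
    using wk_Hom[OF wk_Hom[OF ev wf1] wf2] by simp
  show "H # PCont i # G \<turnstile> Var 0 \<Colon> Hom (PProd (Var 1) (wk (wk X))) (wk (wk Y))"
    using var0[OF wf2] by (simp add: H_def)
qed

lemma is_exponential_prop:
  assumes "G \<turnstile> X \<Colon> PCont i" "G \<turnstile> Y \<Colon> PCont i" "G \<turnstile> E \<Colon> PCont i" "G \<turnstile> ev \<Colon> Hom (PProd E X) Y"
  shows "G \<turnstile> is_exponential i X Y E ev \<Colon> Prop"
proof -
  note b = is_exponential_body[OF assms]
  show ?thesis
    unfolding is_exponential_eq using Ex1_prop[OF Hom_type[OF b(6,7)] Transp_prop[OF b(4,5,6,7,8,9)]]
      b(2) PCont_type[OF wf_typing[OF assms(1)]]
    by (blast intro: t_all)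
qed

lemma is_exponential_D:
  assumes "holds G (is_exponential i X Y E ev)" "G \<turnstile> Z \<Colon> PCont i" "G \<turnstile> f \<Colon> Hom (PProd Z X) Y"
  shows "holds G (Ex1 (Hom Z E) (Transp Z X Y ev f))"
proof -
  have "holds G (Pi (Hom (PProd Z X) Y) (Ex1 (Hom (wk Z) (wk E)) (Transp (wk Z) (wk X) (wk Y) (wk ev) (Var 0))))"
    using holds_all_D[OF assms(1)[unfolded is_exponential_eq] assms(2)] by (simp add: inst_eq)
  from holds_all_D[OF this assms(3)] show ?thesis by (simp add: inst_eq)
qed

text \<open>The part of \<open>exponentiable\<close> for one fixed second container, so that it can
  be introduced and used at a container depending on the context.\<close>

definition HasExp :: "nat \<Rightarrow> tm \<Rightarrow> tm \<Rightarrow> tm" where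
  "HasExp i X Y = Exist (PCont i) (Exist (Hom (PProd (Var 0) (wk X)) (wk Y))
     (is_exponential i (wk (wk X)) (wk (wk Y)) (Var 1) (Var 0)))"

lemma HasExp_simps [simp]:
  "ren r (HasExp i X Y) = HasExp i (ren r X) (ren r Y)"
  "subst s (HasExp i X Y) = HasExp i (subst s X) (subst s Y)"
  by (simp_all add: HasExp_def)

lemma exponentiable_eq: "exponentiable i X = Pi (PCont i) (HasExp i (wk X) (Var 0))"
  by (simp add: exponentiable_def HasExp_def numeral_2_eq_2)

lemma eval_ex_prop:
  assumes X: "G \<turnstile> X \<Colon> PCont i" and Y: "G \<turnstile> Y \<Colon> PCont i" and E: "G \<turnstile> E \<Colon> PCont i"
  shows "Hom (PProd E X) Y # G \<turnstile> is_exponential i (wk X) (wk Y) (wk E) (Var 0) \<Colon> Prop"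
    and "G \<turnstile> Exist (Hom (PProd E X) Y) (is_exponential i (wk X) (wk Y) (wk E) (Var 0)) \<Colon> Prop"
proof -
  have H: "G \<turnstile> Hom (PProd E X) Y \<Colon> Univ i" using PProd_type[OF E X] Y by (rule Hom_type)
  note wf = wf_type[OF H]
  show "Hom (PProd E X) Y # G \<turnstile> is_exponential i (wk X) (wk Y) (wk E) (Var 0) \<Colon> Prop"
    using is_exponential_prop[OF wk_PCont[OF X wf] wk_PCont[OF Y wf] wk_PCont[OF E wf]] var0[OF wf] by simp
  with H show "G \<turnstile> Exist (Hom (PProd E X) Y) (is_exponential i (wk X) (wk Y) (wk E) (Var 0)) \<Colon> Prop"
    by (rule t_exist)
qed

lemma HasExp_body:
  assumes X: "G \<turnstile> X \<Colon> PCont i" and Y: "G \<turnstile> Y \<Colon> PCont i"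
  shows "PCont i # G \<turnstile> Exist (Hom (PProd (Var 0) (wk X)) (wk Y))
     (is_exponential i (wk (wk X)) (wk (wk Y)) (Var 1) (Var 0)) \<Colon> Prop"
proof -
  have wf: "wf_ctx (PCont i # G)" by (rule wf_type[OF PCont_type[OF wf_typing[OF X]]])
  have "PCont i # G \<turnstile> Var 0 \<Colon> PCont i" using var0[OF wf] by simp
  from eval_ex_prop(2)[OF wk_PCont[OF X wf] wk_PCont[OF Y wf] this] show ?thesis by simp
qed

lemma HasExp_prop: "G \<turnstile> X \<Colon> PCont i \<Longrightarrow> G \<turnstile> Y \<Colon> PCont i \<Longrightarrow> G \<turnstile> HasExp i X Y \<Colon> Prop"
  unfolding HasExp_def by (blast intro: t_exist HasExp_body PCont_type wf_typing)

lemma HasExp_I: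
  assumes X: "G \<turnstile> X \<Colon> PCont i" and Y: "G \<turnstile> Y \<Colon> PCont i" and E: "G \<turnstile> E \<Colon> PCont i"
    and ev: "G \<turnstile> ev \<Colon> Hom (PProd E X) Y" and "holds G (is_exponential i X Y E ev)"
  shows "holds G (HasExp i X Y)"
proof -
  have "holds G (Exist (Hom (PProd E X) Y) (is_exponential i (wk X) (wk Y) (wk E) (Var 0)))"
    using holds_ex_I[OF Hom_type[OF PProd_type[OF E X] Y] eval_ex_prop(1)[OF X Y E] ev] assms(5)
    by (simp add: inst_eq)
  then show ?thesis
    unfolding HasExp_def
    using holds_ex_I[OF PCont_type[OF wf_typing[OF X]] HasExp_body[OF X Y] E] by (simp add: inst_eq)
qed

lemma exponentiable_prop:
  assumes "G \<turnstile> X \<Colon> PCont i"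
  shows "G \<turnstile> exponentiable i X \<Colon> Prop"
proof -
  have P: "G \<turnstile> PCont i \<Colon> Univ (Suc i)" by (rule PCont_type[OF wf_typing[OF assms]])
  note wf = wf_type[OF P]
  show ?thesis
    unfolding exponentiable_eq
    using t_all[OF P HasExp_prop[OF wk_PCont[OF assms wf], of "Var 0"]] var0[OF wf] by simp
qed

lemma decidable_body:
  assumes "G \<turnstile> X \<Colon> PCont i" "G \<turnstile> a \<Colon> Sh X"
  shows "G \<turnstile> Disj (Pos X a) (Neg (Pos X a)) \<Colon> Prop"
  using Pos_prop[OF assms] by (blast intro: t_disj Neg_prop)

lemma decidable_prop:
  assumes "G \<turnstile> X \<Colon> PCont i"
  shows "G \<turnstile> decidable X \<Colon> Prop"
proof -
  note wf = wf_type[OF Sh_type[OF assms]]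
  show ?thesis
    unfolding decidable_def
    using t_all[OF Sh_type[OF assms] decidable_body[OF wk_PCont[OF assms wf]]] var0[OF wf] by simp
qed

lemma decidable_D:
  "holds G (decidable X) \<Longrightarrow> G \<turnstile> a \<Colon> Sh X \<Longrightarrow> holds G (Disj (Pos X a) (Neg (Pos X a)))"
  unfolding decidable_def using holds_all_D[of G "Sh X" _ a] by (fastforce simp: inst_eq)


section \<open>Exponentiable containers are decidable\<close>

text \<open>\<open>Target X a\<close> is \<open>Sh X \<triangleleft> (\<lambda>b. b = a)\<close> and \<open>Point p\<close> is \<open>1 \<triangleleft> (\<lambda>_. p)\<close>.  The second projection is a
  morphism from \<open>Point p \<times> X\<close> to \<open>Target X a\<close> iff \<open>p \<or> Pos X a\<close>; the morphism \<open>probe u\<close> is the one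
  whose proof part is \<open>u\<close>.\<close>

definition Target :: "tm \<Rightarrow> tm \<Rightarrow> tm" where
  "Target X a = Sh X \<triangleleft> Lam (Ident (Sh (wk X)) (Var 0) (wk a))"

definition Point :: "tm \<Rightarrow> tm" where
  "Point p = Unit \<triangleleft> Lam (wk p)"

definition probe :: "tm \<Rightarrow> tm" where
  "probe u = Pair (Lam (Snd (Var 0))) (Lam (Lam (wk (wk u))))"

text \<open>Both points have the shapes \<open>Unit\<close>, so the shape map of \<open>g\<close>
  can be kept. The position part has to prove the true proposition, and \<open>Star\<close> does so
  whatever \<open>g\<close> does on positions.\<close>

definition lift :: "tm \<Rightarrow> tm" where
  "lift g = Pair (Lam (App (Fst (wk g)) (Var 0))) (Lam (Lam Star))"

lemma probe_simps [simp]: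
  "ren r (Target X a) = Target (ren r X) (ren r a)"
  "subst s (Target X a) = Target (subst s X) (subst s a)"
  "ren r (Point p) = Point (ren r p)"
  "subst s (Point p) = Point (subst s p)"
  "ren r (probe u) = probe (ren r u)"
  "subst s (probe u) = probe (subst s u)"
  "ren r (lift g) = lift (ren r g)"
  "subst s (lift g) = lift (subst s g)"
  by (simp_all add: Target_def Point_def probe_def lift_def)

lemma Target_cont:
  assumes X: "G \<turnstile> X \<Colon> PCont i" and a: "G \<turnstile> a \<Colon> Sh X"
  shows "G \<turnstile> Target X a \<Colon> PCont i"
    and "G \<turnstile> b \<Colon> Sh (Target X a) \<longleftrightarrow> G \<turnstile> b \<Colon> Sh X"
    and "G \<turnstile> b \<approx> b' \<Colon> Sh (Target X a) \<longleftrightarrow> G \<turnstile> b \<approx> b' \<Colon> Sh X"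
    and "G \<turnstile> b \<Colon> Sh X \<Longrightarrow> G \<turnstile> Pos (Target X a) b \<approx> Ident (Sh X) b a \<Colon> Prop"
proof -
  have S: "G \<turnstile> Sh X \<Colon> Univ i" using X by (rule Sh_type)
  note wf = wf_type[OF S]
  have v: "Sh X # G \<turnstile> Var 0 \<Colon> Sh (wk X)" using var0[OF wf] by simp
  have "Sh X # G \<turnstile> Ident (Sh (wk X)) (Var 0) (wk a) \<Colon> Prop"
    using Sh_type[OF wk_PCont[OF X wf]] v wk_Sh[OF a wf] by (rule t_ident)
  note c = cont_lam[OF S this, folded Target_def]
  show "G \<turnstile> Target X a \<Colon> PCont i" by (rule c)
  show "G \<turnstile> b \<Colon> Sh (Target X a) \<longleftrightarrow> G \<turnstile> b \<Colon> Sh X"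
    "G \<turnstile> b \<approx> b' \<Colon> Sh (Target X a) \<longleftrightarrow> G \<turnstile> b \<approx> b' \<Colon> Sh X"
    using c(2) by (blast intro: t_conv e_conv e_sym)+
  show "G \<turnstile> b \<Colon> Sh X \<Longrightarrow> G \<turnstile> Pos (Target X a) b \<approx> Ident (Sh X) b a \<Colon> Prop"
    using c(3) by (simp add: inst_eq)
qed

lemma Point_cont:
  assumes p: "G \<turnstile> p \<Colon> Prop"
  shows "G \<turnstile> Point p \<Colon> PCont i"
    and "G \<turnstile> z \<Colon> Sh (Point p) \<longleftrightarrow> G \<turnstile> z \<Colon> Unit"
    and "G \<turnstile> z \<Colon> Unit \<Longrightarrow> G \<turnstile> Pos (Point p) z \<approx> p \<Colon> Prop"
proof -
  have U: "G \<turnstile> Unit \<Colon> Univ j" for j using t_unit[OF wf_typing[OF p]] by (rule prop_univ)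
  have P: "Unit # G \<turnstile> wk p \<Colon> Prop" using typing_wk[OF p wf_type[OF U]] by simp
  note c = cont_lam[OF U P, folded Point_def]
  show "G \<turnstile> Point p \<Colon> PCont i" by (rule c)
  show "G \<turnstile> z \<Colon> Sh (Point p) \<longleftrightarrow> G \<turnstile> z \<Colon> Unit"
    using c(2) by (blast intro: t_conv e_sym)
  show "G \<turnstile> z \<Colon> Unit \<Longrightarrow> G \<turnstile> Pos (Point p) z \<approx> p \<Colon> Prop"
    using c(3)[of z] by (simp add: inst_eq)
qed

lemma probe_hom:
  assumes X: "G \<turnstile> X \<Colon> PCont i" and a: "G \<turnstile> a \<Colon> Sh X" and p: "G \<turnstile> p \<Colon> Prop"
    and u: "G \<turnstile> u \<Colon> Disj p (Pos X a)"
  shows "G \<turnstile> probe u \<Colon> Hom (PProd (Point p) X) (Target X a)"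
    and "G \<turnstile> w \<Colon> Sh (PProd (Point p) X) \<Longrightarrow> G \<turnstile> App (Fst (probe u)) w \<approx> Snd w \<Colon> Sh (Target X a)"
proof -
  let ?Z = "Point p" and ?Y = "Target X a"
  note Z = Point_cont(1)[OF p, of i] and Y = Target_cont(1)[OF X a]
  let ?G1 = "Sh (PProd ?Z X) # G"
  note PZ = PProd_type[OF Z X]
  have wf: "wf_ctx ?G1" using Sh_type[OF PZ] by (rule wf_type)
  note X1 = wk_PCont[OF X wf] and a1 = wk_Sh[OF a wf]
  have p1: "?G1 \<turnstile> wk p \<Colon> Prop" using typing_wk[OF p wf] by simp
  have v: "?G1 \<turnstile> Var 0 \<Colon> Sh (PProd (Point (wk p)) (wk X))" using var0[OF wf] by simp
  note b1 = proj_PProd(2)[OF Point_cont(1)[OF p1] X1 v]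
  have b: "?G1 \<turnstile> Snd (Var 0) \<Colon> Sh (wk ?Y)" using b1 Target_cont(2)[OF X1 a1] by simp
  let ?G2 = "Pos (wk ?Y) (Snd (Var 0)) # ?G1"
  have wf2: "wf_ctx ?G2" using Pos_prop[OF wk_PCont[OF Y wf] b] by (rule wf_prop)
  note X2 = wk_PCont[OF X1 wf2] and a2 = wk_Sh[OF a1 wf2]
  have p2: "?G2 \<turnstile> wk (wk p) \<Colon> Prop" using typing_wk[OF p1 wf2] by simp
  note Z2 = Point_cont(1)[OF p2, of i]
  have v2: "?G2 \<turnstile> Var (Suc 0) \<Colon> Sh (PProd (Point (wk (wk p))) (wk (wk X)))"
    using typing_wk[OF v wf2] by simp
  note s2 = proj_PProd[OF Z2 X2 v2]
  have "?G2 \<turnstile> Var 0 \<Colon> Ident (Sh (wk (wk X))) (Snd (Var (Suc 0))) (wk (wk a))"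
    using var0[OF wf2] by (intro conv_prop[OF _ Target_cont(4)[OF X2 a2 s2(2)]]) simp
  \<comment> \<open>The given position says that the second component equals \<open>a\<close>.
    Reflection makes this a judgmental equality, and \<open>u\<close>, a statement about
    \<open>a\<close>, becomes a position of the product at the given shape.\<close>
  then have eq: "?G2 \<turnstile> wk (wk a) \<approx> Snd (Var (Suc 0)) \<Colon> Sh (wk (wk X))"
    by (blast intro: e_reflection e_sym)
  have u2: "?G2 \<turnstile> wk (wk u) \<Colon> Disj (wk (wk p)) (Pos (wk (wk X)) (wk (wk a)))"
    using typing_wk[OF typing_wk[OF u wf] wf2] by simp
  have "?G2 \<turnstile> Disj (wk (wk p)) (Pos (wk (wk X)) (wk (wk a))) \<approx>
      Disj (Pos (Point (wk (wk p))) (Fst (Var (Suc 0)))) (Pos (wk (wk X)) (Snd (Var (Suc 0)))) \<Colon> Prop"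
    using Point_cont(2,3)[OF p2] s2(1) by (intro e_disj e_sym[OF Point_cont(3)[OF p2]] Pos_cong[OF X2 eq]) simp
  from conv_prop[OF conv_prop[OF u2 this] e_sym[OF Pos_PProd[OF Z2 X2 v2]]]
  have q: "?G2 \<turnstile> wk (wk u) \<Colon> Pos (wk (wk (PProd ?Z X))) (Var (Suc 0))" by simp
  show "G \<turnstile> probe u \<Colon> Hom (PProd ?Z X) ?Y"
    "G \<turnstile> w \<Colon> Sh (PProd ?Z X) \<Longrightarrow> G \<turnstile> App (Fst (probe u)) w \<approx> Snd w \<Colon> Sh ?Y"
    using Hom_lam[OF PZ Y b q] by (simp_all add: probe_def inst_eq)
qed

lemma lift_hom:
  assumes E: "G \<turnstile> E \<Colon> PCont i" and g: "G \<turnstile> g \<Colon> Hom (Point Bot) E"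
  shows "G \<turnstile> lift g \<Colon> Hom (Point Unit) E"
    and "G \<turnstile> z \<Colon> Sh (Point Unit) \<Longrightarrow> G \<turnstile> App (Fst (lift g)) z \<approx> App (Fst g) z \<Colon> Sh E"
proof -
  have unit: "H \<turnstile> Unit \<Colon> Prop" and bot: "H \<turnstile> Bot \<Colon> Prop" if "wf_ctx H" for H
    using that by (auto intro: t_unit t_bot)
  note Z = Point_cont(1)[OF unit[OF wf_typing[OF E]], of i]
  let ?G1 = "Sh (Point Unit) # G"
  have wf: "wf_ctx ?G1" using Sh_type[OF Z] by (rule wf_type)
  have g1: "?G1 \<turnstile> wk g \<Colon> Hom (Point Bot) (wk E)" using wk_Hom[OF g wf] by simp
  have v: "?G1 \<turnstile> Var 0 \<Colon> Sh (Point Unit)" using var0[OF wf] by simp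
  then have "?G1 \<turnstile> Var 0 \<Colon> Sh (Point Bot)"
    by (simp add: Point_cont(2)[OF unit[OF wf]] Point_cont(2)[OF bot[OF wf]])
  with g1 have b: "?G1 \<turnstile> App (Fst (wk g)) (Var 0) \<Colon> Sh (wk E)" by (rule Hom_app)
  let ?G2 = "Pos (wk E) (App (Fst (wk g)) (Var 0)) # ?G1"
  have wf2: "wf_ctx ?G2" using Pos_prop[OF wk_PCont[OF E wf] b] by (rule wf_prop)
  have "?G2 \<turnstile> Var (Suc 0) \<Colon> Sh (Point Unit)" using typing_wk[OF v wf2] by simp
  then have "?G2 \<turnstile> Unit \<approx> Pos (Point Unit) (Var (Suc 0)) \<Colon> Prop"
    by (simp add: e_sym[OF Point_cont(3)[OF unit[OF wf2]]] Point_cont(2)[OF unit[OF wf2]])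
  then have q: "?G2 \<turnstile> Star \<Colon> Pos (wk (wk (Point Unit))) (Var (Suc 0))"
    using conv_prop[OF t_star[OF wf2]] by simp
  show "G \<turnstile> lift g \<Colon> Hom (Point Unit) E"
    "G \<turnstile> z \<Colon> Sh (Point Unit) \<Longrightarrow> G \<turnstile> App (Fst (lift g)) z \<approx> App (Fst g) z \<Colon> Sh E"
    using Hom_lam[OF Z E b q] by (simp_all add: lift_def inst_eq)
qed

section \<open>Comparing factorisations over the two points\<close>

lemma probe_yes:
  assumes X: "G \<turnstile> X \<Colon> PCont i" and a: "G \<turnstile> a \<Colon> Sh X"
  shows "G \<turnstile> Inl Star \<Colon> Disj Unit (Pos X a)"
  using assms wf_typing[OF X] by (blast intro: t_inl t_unit t_star Pos_prop)

lemma probe_no: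
  assumes X: "G \<turnstile> X \<Colon> PCont i" and a: "G \<turnstile> a \<Colon> Sh X" and v: "G \<turnstile> v \<Colon> Pos X a"
  shows "G \<turnstile> Inr v \<Colon> Disj Bot (Pos X a)"
  using assms wf_typing[OF X] by (blast intro: t_inr t_bot Pos_prop)

text \<open>\<open>lift\<close> leaves the shape map unchanged, and both probes act on shapes as the
  second projection; thus the equation for \<open>g\<close> over \<open>Point Bot\<close> yields the
  one for \<open>lift g\<close> over \<open>Point Unit\<close>.\<close>

lemma lift_transpose_at:
  assumes X: "G \<turnstile> X \<Colon> PCont i" and E: "G \<turnstile> E \<Colon> PCont i" and a: "G \<turnstile> a \<Colon> Sh X"
    and ev: "G \<turnstile> ev \<Colon> Hom (PProd E X) (Target X a)" and v: "G \<turnstile> v \<Colon> Pos X a"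
    and g: "G \<turnstile> g \<Colon> Hom (Point Bot) E"
    and eq: "G \<turnstile> comp ev (mtimes g idm) \<approx> probe (Inr v) \<Colon> Hom (PProd (Point Bot) X) (Target X a)"
    and w: "G \<turnstile> w \<Colon> Sh (PProd (Point Unit) X)"
  shows "G \<turnstile> App (Fst (comp ev (mtimes (lift g) idm))) w \<approx> App (Fst (probe (Inl Star))) w \<Colon> Sh (Target X a)"
proof -
  note wf = wf_typing[OF X]
  note Z0 = Point_cont(1)[OF t_bot[OF wf], of i] and Z1 = Point_cont(1)[OF t_unit[OF wf], of i]
  note Y = Target_cont(1)[OF X a] and l = lift_hom[OF E g]
  note w1 = proj_PProd[OF Z1 X w]
  have z: "G \<turnstile> Fst w \<Colon> Sh (Point Bot)"
    using w1(1) by (simp add: Point_cont(2)[OF t_unit[OF wf]] Point_cont(2)[OF t_bot[OF wf]])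
  \<comment> \<open>The same point seen over \<open>Point Bot\<close>: re-pairing retypes the
    components and avoids comparing the two product types.\<close>
  define w0 where "w0 = Pair (Fst w) (Snd w)"
  note P = pair_PProd[OF Z0 X z w1(2), folded w0_def]
  have 1: "G \<turnstile> App (Fst (comp ev (mtimes (lift g) idm))) w \<approx>
      App (Fst ev) (Pair (App (Fst (lift g)) (Fst w)) (Snd w)) \<Colon> Sh (Target X a)"
    by (rule transpose_hom(2)[OF X Y Z1 E ev l(1) w])
  have 2: "G \<turnstile> Pair (App (Fst (lift g)) (Fst w)) (Snd w) \<approx> Pair (App (Fst g) (Fst w0)) (Snd w0) \<Colon> Sh (PProd E X)"
    using l(2)[OF w1(1)] Hom_app_cong[OF g e_sym[OF P(2)]] e_sym[OF P(3)]
    by (intro pair_PProd_cong[OF E X]) (rule e_trans)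
  have 3: "G \<turnstile> App (Fst (comp ev (mtimes g idm))) w0 \<approx>
      App (Fst ev) (Pair (App (Fst g) (Fst w0)) (Snd w0)) \<Colon> Sh (Target X a)"
    by (rule transpose_hom(2)[OF X Y Z0 E ev g P(1)])
  have 4: "G \<turnstile> App (Fst (comp ev (mtimes g idm))) w0 \<approx> App (Fst (probe (Inr v))) w0 \<Colon> Sh (Target X a)"
    using Hom_fst_cong[OF eq] e_refl[OF P(1)] by (rule app_Arr_cong)
  have 5: "G \<turnstile> App (Fst (probe (Inr v))) w0 \<approx> Snd w0 \<Colon> Sh (Target X a)"
    using X a t_bot[OF wf] probe_no[OF X a v] P(1) by (rule probe_hom(2))
  have 6: "G \<turnstile> App (Fst (probe (Inl Star))) w \<approx> Snd w \<Colon> Sh (Target X a)"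
    using X a t_unit[OF wf] probe_yes[OF X a] w by (rule probe_hom(2))
  have 7: "G \<turnstile> Snd w0 \<approx> Snd w \<Colon> Sh (Target X a)"
    using P(3) Target_cont(3)[OF X a] by simp
  show ?thesis
    by (rule e_trans[OF e_trans[OF e_trans[OF 1 Hom_app_cong[OF ev 2]] e_sym[OF 3]]
        e_trans[OF e_trans[OF 4 5] e_trans[OF 7 e_sym[OF 6]]]])
qed

lemma lift_transpose:
  assumes X: "G \<turnstile> X \<Colon> PCont i" and E: "G \<turnstile> E \<Colon> PCont i" and a: "G \<turnstile> a \<Colon> Sh X"
    and ev: "G \<turnstile> ev \<Colon> Hom (PProd E X) (Target X a)" and v: "G \<turnstile> v \<Colon> Pos X a"
    and g: "G \<turnstile> g \<Colon> Hom (Point Bot) E"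
    and eq: "G \<turnstile> comp ev (mtimes g idm) \<approx> probe (Inr v) \<Colon> Hom (PProd (Point Bot) X) (Target X a)"
  shows "G \<turnstile> comp ev (mtimes (lift g) idm) \<approx> probe (Inl Star) \<Colon> Hom (PProd (Point Unit) X) (Target X a)"
proof -
  note wf = wf_typing[OF X]
  note Z1 = Point_cont(1)[OF t_unit[OF wf], of i] and Y = Target_cont(1)[OF X a]
  note P = PProd_type[OF Z1 X]
  have wf1: "wf_ctx (Sh (PProd (Point Unit) X) # G)" using Sh_type[OF P] by (rule wf_type)
  have w: "Sh (PProd (Point Unit) X) # G \<turnstile> Var 0 \<Colon> Sh (PProd (Point Unit) (wk X))"
    using var0[OF wf1] by simp
  note at = lift_transpose_at[OF wk_PCont[OF X wf1] wk_PCont[OF E wf1] wk_Sh[OF a wf1]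
      wk_Hom[OF ev wf1, simplified] typing_wk[OF v wf1, simplified] wk_Hom[OF g wf1, simplified]
      equal_wk[OF eq wf1, simplified] w]
  show ?thesis
    using P Y transpose_hom(1)[OF X Y Z1 E ev lift_hom(1)[OF E g]]
      probe_hom(1)[OF X a t_unit[OF wf] probe_yes[OF X a]]
    by (rule Hom_ext) (use at in simp)
qed

text \<open>The unique factorisation over \<^term>\<open>Point Unit\<close> must agree with the one over
  \<^term>\<open>Point Bot\<close>, which exists as soon as \<open>Pos X a\<close> holds.\<close>

lemma no_position_at:
  assumes X: "G \<turnstile> X \<Colon> PCont i" and E: "G \<turnstile> E \<Colon> PCont i" and a: "G \<turnstile> a \<Colon> Sh X"
    and ev: "G \<turnstile> ev \<Colon> Hom (PProd E X) (Target X a)" and v: "G \<turnstile> v \<Colon> Pos X a"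
    and uniq: "holds G (Uniq (Hom (Point Unit) E)
      (Transp (Point Unit) X (Target X a) ev (probe (Inl Star))) g1)"
    and z: "G \<turnstile> z \<Colon> Unit" and s: "G \<turnstile> s \<Colon> Pos E (App (Fst g1) z)"
    and g: "G \<turnstile> g \<Colon> Hom (Point Bot) E"
    and eq: "G \<turnstile> comp ev (mtimes g idm) \<approx> probe (Inr v) \<Colon> Hom (PProd (Point Bot) X) (Target X a)"
  shows "holds G Bot"
proof -
  note wf = wf_typing[OF X]
  note l = lift_hom[OF E g]
  have z0: "G \<turnstile> z \<Colon> Sh (Point Bot)" and z1: "G \<turnstile> z \<Colon> Sh (Point Unit)"
    using z by (simp_all add: Point_cont(2)[OF t_unit[OF wf]] Point_cont(2)[OF t_bot[OF wf]])
  note t = lift_transpose[OF X E a ev v g eq]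
  \<comment> \<open>\<open>lift g\<close> meets the defining equation of the unique factorisation
    over \<open>Point Unit\<close>, so it must coincide with \<open>g1\<close>.\<close>
  have "holds G (inst (Transp (Point Unit) X (Target X a) ev (probe (Inl Star))) (lift g))"
    unfolding inst_Transp
    using Ident_holds[OF t Hom_type[OF PProd_type[OF Point_cont(1)[OF t_unit[OF wf]] X] Target_cont(1)[OF X a]]]
      transpose_hom(1)[OF X Target_cont(1)[OF X a] Point_cont(1)[OF t_unit[OF wf]] E ev l(1)]
    by (blast intro: holdsI)
  from Hom_fst_cong[OF Uniq_D[OF uniq l(1) this]]
  have "G \<turnstile> App (Fst (lift g)) z \<approx> App (Fst g1) z \<Colon> Sh E"
    using e_refl[OF z1] by (rule app_Arr_cong)
  then have "G \<turnstile> App (Fst g1) z \<approx> App (Fst g) z \<Colon> Sh E"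
    using l(2)[OF z1] by (blast intro: e_trans e_sym)
  \<comment> \<open>The position \<open>s\<close> at the shape chosen by \<open>g1\<close> is now
    one at the shape chosen by \<open>g\<close>, and \<open>g\<close> sends it back to a position of
    \<open>Point Bot\<close>, that is, to a proof of \<open>Bot\<close>.\<close>
  then have "G \<turnstile> s \<Colon> Pos E (App (Fst g) z)"
    using s Pos_cong[OF E] by (blast intro: conv_prop)
  from Hom_snd_app[OF g z0 this] show ?thesis
    using Point_cont(3)[OF t_bot[OF wf] z] by (blast intro: holdsI conv_prop)
qed

text \<open>Supplies the factorisation over \<open>Point Bot\<close> that
  \<open>no_position_at\<close> assumes: \<open>v\<close> makes the corresponding probe a morphism,
  and the existence of its factorisation may be opened because \<open>Bot\<close> is a
  proposition.\<close>

lemma no_position: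
  assumes X: "G \<turnstile> X \<Colon> PCont i" and E: "G \<turnstile> E \<Colon> PCont i" and a: "G \<turnstile> a \<Colon> Sh X"
    and ev: "G \<turnstile> ev \<Colon> Hom (PProd E X) (Target X a)" and v: "G \<turnstile> v \<Colon> Pos X a"
    and exp: "holds G (is_exponential i X (Target X a) E ev)"
    and uniq: "holds G (Uniq (Hom (Point Unit) E)
      (Transp (Point Unit) X (Target X a) ev (probe (Inl Star))) g1)"
    and z: "G \<turnstile> z \<Colon> Unit" and s: "G \<turnstile> s \<Colon> Pos E (App (Fst g1) z)"
  shows "holds G Bot"
proof -
  note wf = wf_typing[OF X]
  note Z0 = Point_cont(1)[OF t_bot[OF wf], of i]
  note f = probe_hom(1)[OF X a t_bot[OF wf] probe_no[OF X a v]]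
  show ?thesis
  proof (rule universal_E[OF X Target_cont(1)[OF X a] Z0 E ev f is_exponential_D[OF exp Z0 f] t_bot[OF wf]])
    fix B
    assume wf1: "wf_ctx (Hom (Point Bot) E # G)" and wf2: "wf_ctx (B # Hom (Point Bot) E # G)"
      and g: "B # Hom (Point Bot) E # G \<turnstile> Var (Suc 0) \<Colon> Hom (wk (wk (Point Bot))) (wk (wk E))"
      and eq: "B # Hom (Point Bot) E # G \<turnstile> comp (wk (wk ev)) (mtimes (Var (Suc 0)) idm) \<approx>
        wk (wk (probe (Inr v))) \<Colon> Hom (PProd (wk (wk (Point Bot))) (wk (wk X))) (wk (wk (Target X a)))"
    have "holds (B # Hom (Point Bot) E # G) Bot"
      by (rule no_position_at[OF wk_PCont[OF wk_PCont[OF X wf1] wf2] wk_PCont[OF wk_PCont[OF E wf1] wf2]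
          wk_Sh[OF wk_Sh[OF a wf1] wf2] wk_Hom[OF wk_Hom[OF ev wf1] wf2, simplified]
          typing_wk[OF typing_wk[OF v wf1] wf2, simplified] holds_wk[OF holds_wk[OF uniq wf1] wf2, simplified]
          typing_wk[OF typing_wk[OF z wf1] wf2, simplified] typing_wk[OF typing_wk[OF s wf1] wf2, simplified]
          g[simplified] eq[simplified]])
    then show "holds (B # Hom (Point Bot) E # G) (wk (wk Bot))" by simp
  qed
qed

lemma decide_at:
  assumes X: "G \<turnstile> X \<Colon> PCont i" and E: "G \<turnstile> E \<Colon> PCont i" and a: "G \<turnstile> a \<Colon> Sh X"
    and ev: "G \<turnstile> ev \<Colon> Hom (PProd E X) (Target X a)"
    and exp: "holds G (is_exponential i X (Target X a) E ev)"
    and g: "G \<turnstile> g \<Colon> Hom (Point Unit) E"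
    and eq: "G \<turnstile> comp ev (mtimes g idm) \<approx> probe (Inl Star) \<Colon> Hom (PProd (Point Unit) X) (Target X a)"
    and uniq: "holds G (Uniq (Hom (Point Unit) E)
      (Transp (Point Unit) X (Target X a) ev (probe (Inl Star))) g)"
  shows "holds G (Disj (Pos X a) (Neg (Pos X a)))"
proof -
  note wf = wf_typing[OF X]
  note Z1 = Point_cont(1)[OF t_unit[OF wf], of i] and Y = Target_cont(1)[OF X a]
  have star: "G \<turnstile> Star \<Colon> Sh (Point Unit)"
    using t_star[OF wf] by (simp add: Point_cont(2)[OF t_unit[OF wf]])
  define w where "w = Pair Star a"
  note W = pair_PProd[OF Z1 X star a, folded w_def]
  note w1 = proj_PProd[OF Z1 X W(1)]
  have z: "G \<turnstile> Fst w \<Colon> Unit" using w1(1) by (simp add: Point_cont(2)[OF t_unit[OF wf]])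
  \<comment> \<open>With \<open>Fst w\<close> instead of \<open>Star\<close>, \<open>c\<close> is
    literally the term in the shape formula of \<open>transpose_hom\<close>; the same holds for
    \<open>Snd w\<close> in \<open>y\<close>.\<close>
  define c where "c = App (Fst g) (Fst w)"
  have c: "G \<turnstile> c \<Colon> Sh E" unfolding c_def using g w1(1) by (rule Hom_app)
  define y where "y = Pair c (Snd w)"
  note y = pair_PProd[OF E X c w1(2), folded y_def]
  have "G \<turnstile> App (Fst (comp ev (mtimes g idm))) w \<approx> App (Fst ev) y \<Colon> Sh (Target X a)"
    unfolding y_def c_def by (rule transpose_hom(2)[OF X Y Z1 E ev g W(1)])
  moreover have "G \<turnstile> App (Fst (comp ev (mtimes g idm))) w \<approx> App (Fst (probe (Inl Star))) w \<Colon> Sh (Target X a)"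
    using Hom_fst_cong[OF eq] e_refl[OF W(1)] by (rule app_Arr_cong)
  moreover have "G \<turnstile> App (Fst (probe (Inl Star))) w \<approx> Snd w \<Colon> Sh (Target X a)"
    using X a t_unit[OF wf] probe_yes[OF X a] W(1) by (rule probe_hom(2))
  ultimately have "G \<turnstile> App (Fst ev) y \<approx> Snd w \<Colon> Sh (Target X a)" by (blast intro: e_trans e_sym)
  then have eva: "G \<turnstile> App (Fst ev) y \<approx> a \<Colon> Sh X"
    using W(3) Target_cont(3)[OF X a] by (blast intro: e_trans)
  have evy: "G \<turnstile> App (Fst ev) y \<Colon> Sh X"
    using Hom_app[OF ev y(1)] by (simp add: Target_cont(2)[OF X a])
  \<comment> \<open>Evaluation at \<open>y\<close> returns \<open>a\<close>, so \<open>Refl\<close>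
    is a position of the target there; the position part of \<open>ev\<close> turns it into the
    disjunction that is split below.\<close>
  have "G \<turnstile> Refl \<Colon> Pos (Target X a) (App (Fst ev) y)"
    using Ident_holds[OF eva Sh_type[OF X] evy] e_sym[OF Target_cont(4)[OF X a evy]] by (rule conv_prop)
  from Hom_snd_app[OF ev y(1) this] Pos_PProd[OF E X y(1)]
  have "holds G (Disj (Pos E (Fst y)) (Pos X (Snd y)))" by (blast intro: holdsI conv_prop)
  moreover have "G \<turnstile> Snd y \<approx> a \<Colon> Sh X" using y(3) W(3) by (rule e_trans)
  ultimately have d: "holds G (Disj (Pos E c) (Pos X a))"
    using y(2) Pos_cong[OF E] Pos_cong[OF X] by (blast intro: holds_conv e_disj)
  have pE: "G \<turnstile> Pos E c \<Colon> Prop" and pX: "G \<turnstile> Pos X a \<Colon> Prop"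
    using Pos_prop[OF E c] Pos_prop[OF X a] .
  note nX = Neg_prop[OF pX]
  show ?thesis
  proof (rule holds_or_E[OF d pE pX decidable_body[OF X a]])
    note wf1 = wf_prop[OF pX]
    have "Pos X a # G \<turnstile> Inl (Var 0) \<Colon> Disj (wk (Pos X a)) (wk (Neg (Pos X a)))"
      using var0[OF wf1] typing_wk[OF pX wf1] typing_wk[OF nX wf1] by (auto intro: t_inl)
    then show "holds (Pos X a # G) (wk (Disj (Pos X a) (Neg (Pos X a))))"
      by (auto intro: holdsI)
  next
    let ?D = "Pos E c # G"
    note wf1 = wf_prop[OF pE]
    have pX1: "?D \<turnstile> Pos (wk X) (wk a) \<Colon> Prop" using typing_wk[OF pX wf1] by simp
    note wf2 = wf_prop[OF pX1]
    \<comment> \<open>Here \<open>Var 0\<close> is the assumed position of \<open>X\<close> at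
      \<open>a\<close>, and \<open>Var (Suc 0)\<close> the position of the exponential at
      \<open>c\<close>.\<close>
    have s: "Pos (wk X) (wk a) # ?D \<turnstile> Var (Suc 0) \<Colon> Pos (wk (wk E)) (App (Fst (wk (wk g))) (Fst (wk (wk w))))"
      using var1[OF wf2] by (simp add: c_def)
    have "holds (Pos (wk X) (wk a) # ?D) Bot"
      by (rule no_position[OF wk_PCont[OF wk_PCont[OF X wf1] wf2] wk_PCont[OF wk_PCont[OF E wf1] wf2]
          wk_Sh[OF wk_Sh[OF a wf1] wf2] wk_Hom[OF wk_Hom[OF ev wf1] wf2, simplified]
          var0[OF wf2, simplified] holds_wk[OF holds_wk[OF exp wf1] wf2, simplified]
          holds_wk[OF holds_wk[OF uniq wf1] wf2, simplified]
          typing_wk[OF typing_wk[OF z wf1] wf2, simplified]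
          s])
    then have "holds ?D (Neg (Pos (wk X) (wk a)))"
      unfolding Neg_def by (intro holds_imp_I[OF pX1]) simp
    then have "holds ?D (Disj (Pos (wk X) (wk a)) (Neg (Pos (wk X) (wk a))))"
      using pX1 Neg_prop[OF pX1] by (auto simp: holds_def intro: t_inr)
    then show "holds ?D (wk (Disj (Pos X a) (Neg (Pos X a))))" by simp
  qed
qed

lemma decide_of_exponential:
  assumes X: "G \<turnstile> X \<Colon> PCont i" and E: "G \<turnstile> E \<Colon> PCont i" and a: "G \<turnstile> a \<Colon> Sh X"
    and ev: "G \<turnstile> ev \<Colon> Hom (PProd E X) (Target X a)"
    and exp: "holds G (is_exponential i X (Target X a) E ev)"
  shows "holds G (Disj (Pos X a) (Neg (Pos X a)))"
proof -
  note wf = wf_typing[OF X]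
  note Z1 = Point_cont(1)[OF t_unit[OF wf], of i]
  note f = probe_hom(1)[OF X a t_unit[OF wf] probe_yes[OF X a]]
  show ?thesis
  proof (rule universal_E[OF X Target_cont(1)[OF X a] Z1 E ev f is_exponential_D[OF exp Z1 f] decidable_body[OF X a]])
    fix B
    let ?D = "B # Hom (Point Unit) E # G"
    assume wf1: "wf_ctx (Hom (Point Unit) E # G)" and wf2: "wf_ctx ?D"
      and g: "?D \<turnstile> Var (Suc 0) \<Colon> Hom (wk (wk (Point Unit))) (wk (wk E))"
      and eq: "?D \<turnstile> comp (wk (wk ev)) (mtimes (Var (Suc 0)) idm) \<approx>
        wk (wk (probe (Inl Star))) \<Colon> Hom (PProd (wk (wk (Point Unit))) (wk (wk X))) (wk (wk (Target X a)))"
      and uniq: "holds ?D (Uniq (Hom (wk (wk (Point Unit))) (wk (wk E)))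
        (Transp (wk (wk (Point Unit))) (wk (wk X)) (wk (wk (Target X a))) (wk (wk ev))
          (wk (wk (probe (Inl Star))))) (Var (Suc 0)))"
    have "holds ?D (Disj (Pos (wk (wk X)) (wk (wk a))) (Neg (Pos (wk (wk X)) (wk (wk a)))))"
      by (rule decide_at[OF wk_PCont[OF wk_PCont[OF X wf1] wf2] wk_PCont[OF wk_PCont[OF E wf1] wf2]
          wk_Sh[OF wk_Sh[OF a wf1] wf2] wk_Hom[OF wk_Hom[OF ev wf1] wf2, simplified]
          holds_wk[OF holds_wk[OF exp wf1] wf2, simplified]
          g[simplified] eq[simplified] uniq[simplified]])
    then show "holds ?D (wk (wk (Disj (Pos X a) (Neg (Pos X a)))))" by simp
  qed
qed

lemma decide_of_HasExp:
  assumes X: "G \<turnstile> X \<Colon> PCont i" and a: "G \<turnstile> a \<Colon> Sh X"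
    and exp: "holds G (HasExp i X (Target X a))"
  shows "holds G (Disj (Pos X a) (Neg (Pos X a)))"
proof -
  \<comment> \<open>Stated for arbitrary contexts, because it is needed after the outer existential
    has extended the context by an exponential object and a proof about it.\<close>
  have inner: "holds D (Disj (Pos X' a') (Neg (Pos X' a')))"
    if X': "D \<turnstile> X' \<Colon> PCont i" and a': "D \<turnstile> a' \<Colon> Sh X'" and E: "D \<turnstile> E \<Colon> PCont i"
      and h: "holds D (Exist (Hom (PProd E X') (Target X' a'))
        (is_exponential i (wk X') (wk (Target X' a')) (wk E) (Var 0)))" for D X' a' E
  proof -
    note Y = Target_cont(1)[OF X' a']
    note H = Hom_type[OF PProd_type[OF E X'] Y] and P = eval_ex_prop(1)[OF X' Y E]
    note wf1 = wf_type[OF H] and wf2 = wf_prop[OF P]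
    show ?thesis
    proof (rule holds_ex_E[OF h H P decidable_body[OF X' a']])
      show "holds (is_exponential i (wk X') (wk (Target X' a')) (wk E) (Var 0) #
          Hom (PProd E X') (Target X' a') # D) (wk (wk (Disj (Pos X' a') (Neg (Pos X' a')))))"
        using decide_of_exponential[OF wk_PCont[OF wk_PCont[OF X' wf1] wf2]
            wk_PCont[OF wk_PCont[OF E wf1] wf2] wk_Sh[OF wk_Sh[OF a' wf1] wf2], of "Var (Suc 0)"]
          var1[OF wf2] holds_assumption[OF wf2]
        by simp
    qed
  qed
  note Y = Target_cont(1)[OF X a]
  have PC: "G \<turnstile> PCont i \<Colon> Univ (Suc i)" by (rule PCont_type[OF wf_typing[OF X]])
  note P = HasExp_body[OF X Y]
  note wf1 = wf_type[OF PC] and wf2 = wf_prop[OF P]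
  show ?thesis
    using inner[OF wk_PCont[OF wk_PCont[OF X wf1] wf2] wk_Sh[OF wk_Sh[OF a wf1] wf2], of "Var (Suc 0)"]
      var1[OF wf2] holds_assumption[OF wf2]
    by (intro holds_ex_E[OF exp[unfolded HasExp_def] PC P decidable_body[OF X a]]) simp
qed

text \<open>The target container mentions the variable \<open>a\<close>. It is available because
  exponentiability quantifies over the second container inside the type theory and can be
  instantiated in the extended context.\<close>

lemma exponentiable_imp_decidable:
  assumes X: "G \<turnstile> X \<Colon> PCont i" and exp: "holds G (exponentiable i X)"
  shows "holds G (decidable X)"
proof -
  note S = Sh_type[OF X]
  note wf = wf_type[OF S]
  note X1 = wk_PCont[OF X wf]
  have a: "Sh X # G \<turnstile> Var 0 \<Colon> Sh (wk X)" using var0[OF wf] by simp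
  have "holds (Sh X # G) (exponentiable i (wk X))" using holds_wk[OF exp wf] by simp
  from holds_all_D[OF this[unfolded exponentiable_eq] Target_cont(1)[OF X1 a]]
  have "holds (Sh X # G) (HasExp i (wk X) (Target (wk X) (Var 0)))" by (simp add: inst_eq)
  from decide_of_HasExp[OF X1 a this] show ?thesis
    unfolding decidable_def using S by (auto intro: holds_all_I)
qed


section \<open>Decidable containers are exponentiable\<close>

text \<open>Provability of the position part is enough, so the morphism is obtained with an
  unspecified proof; its shape map is still fixed up to judgmental equality.\<close>

lemma Hom_I:
  assumes X: "G \<turnstile> X \<Colon> PCont i" and Y: "G \<turnstile> Y \<Colon> PCont i" and f: "G \<turnstile> f \<Colon> Arr (Sh X) (Sh Y)"
    and q: "holds (Pos (wk Y) (App (wk f) (Var 0)) # Sh X # G) (Pos (wk (wk X)) (Var (Suc 0)))"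
  obtains h where "G \<turnstile> h \<Colon> Hom X Y" "G \<turnstile> Fst h \<approx> f \<Colon> Arr (Sh X) (Sh Y)"
proof -
  have "holds (Sh X # G) (Arr (Pos (wk Y) (App (wk f) (Var 0))) (Pos (wk X) (Var 0)))"
    using HomPos_prop(2)[OF X Y f] q by (auto intro: holds_imp_I)
  then have "holds G (HomPos X Y f)"
    unfolding HomPos_def by (rule holds_all_I[OF Sh_type[OF X]])
  then show thesis
    using Hom_pair[OF X Y f] that by (auto simp: holds_def)
qed

text \<open>\<open>Expo X Y\<close> is \<open>(Sh X \<rightarrow> Sh Y) \<triangleleft> (\<lambda>f. \<exists>a. \<not> Pos X a \<and> Pos Y (f a))\<close>.\<close>

definition ex_body :: "tm \<Rightarrow> tm \<Rightarrow> tm \<Rightarrow> tm" where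
  "ex_body X Y f = Prod (Neg (Pos (wk X) (Var 0))) (Pos (wk Y) (App (wk f) (Var 0)))"

definition Expo :: "tm \<Rightarrow> tm \<Rightarrow> tm" where
  "Expo X Y = Arr (Sh X) (Sh Y) \<triangleleft> Lam (Exist (Sh (wk X)) (ex_body (wk X) (wk Y) (Var 0)))"

text \<open>Evaluation and currying are written down on shapes only; their position parts come from
  \<open>Hom_I\<close>.\<close>

definition evalfun :: tm where
  "evalfun = Lam (App (Fst (Var 0)) (Snd (Var 0)))"

definition row :: "tm \<Rightarrow> tm \<Rightarrow> tm" where
  "row f z = Lam (App (Fst (wk f)) (Pair (wk z) (Var 0)))"

definition curfun :: "tm \<Rightarrow> tm" where
  "curfun f = Lam (row (wk f) (Var 0))"

lemma Expo_simps [simp]: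
  "ren (up_ren r) (ex_body X Y f) = ex_body (ren r X) (ren r Y) (ren r f)"
  "subst (up s) (ex_body X Y f) = ex_body (subst s X) (subst s Y) (subst s f)"
  "ren r (Expo X Y) = Expo (ren r X) (ren r Y)"
  "subst s (Expo X Y) = Expo (subst s X) (subst s Y)"
  "ren r evalfun = evalfun"
  "ren r (row f z) = row (ren r f) (ren r z)"
  "subst s (row f z) = row (subst s f) (subst s z)"
  "ren r (curfun f) = curfun (ren r f)"
  by (simp_all add: ex_body_def Expo_def evalfun_def row_def curfun_def)

lemma ex_body_prop:
  assumes X: "G \<turnstile> X \<Colon> PCont i" and Y: "G \<turnstile> Y \<Colon> PCont i" and f: "G \<turnstile> f \<Colon> Arr (Sh X) (Sh Y)"
  shows "Sh X # G \<turnstile> ex_body X Y f \<Colon> Prop"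
  unfolding ex_body_def using HomPos_prop[OF X Y f] by (blast intro: Prod_prop Neg_prop)

lemma Expo_cont:
  assumes X: "G \<turnstile> X \<Colon> PCont i" and Y: "G \<turnstile> Y \<Colon> PCont i"
  shows "G \<turnstile> Expo X Y \<Colon> PCont i"
    and "G \<turnstile> f \<Colon> Sh (Expo X Y) \<longleftrightarrow> G \<turnstile> f \<Colon> Arr (Sh X) (Sh Y)"
    and "G \<turnstile> f \<approx> g \<Colon> Sh (Expo X Y) \<longleftrightarrow> G \<turnstile> f \<approx> g \<Colon> Arr (Sh X) (Sh Y)"
    and "G \<turnstile> f \<Colon> Arr (Sh X) (Sh Y) \<Longrightarrow>
      G \<turnstile> Pos (Expo X Y) f \<approx> Exist (Sh X) (ex_body X Y f) \<Colon> Prop"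
proof -
  note A = Hom_parts(1)[OF X Y]
  note wf = wf_type[OF A]
  note X1 = wk_PCont[OF X wf] and Y1 = wk_PCont[OF Y wf]
  have "Arr (Sh X) (Sh Y) # G \<turnstile> Var 0 \<Colon> Arr (Sh (wk X)) (Sh (wk Y))" using var0[OF wf] by simp
  note c = cont_lam[OF A t_exist[OF Sh_type[OF X1] ex_body_prop[OF X1 Y1 this]], folded Expo_def]
  show "G \<turnstile> Expo X Y \<Colon> PCont i" by (rule c)
  show "G \<turnstile> f \<Colon> Sh (Expo X Y) \<longleftrightarrow> G \<turnstile> f \<Colon> Arr (Sh X) (Sh Y)"
    "G \<turnstile> f \<approx> g \<Colon> Sh (Expo X Y) \<longleftrightarrow> G \<turnstile> f \<approx> g \<Colon> Arr (Sh X) (Sh Y)"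
    using c(2) by (blast intro: t_conv e_conv e_sym)+
  show "G \<turnstile> f \<Colon> Arr (Sh X) (Sh Y) \<Longrightarrow>
      G \<turnstile> Pos (Expo X Y) f \<approx> Exist (Sh X) (ex_body X Y f) \<Colon> Prop"
    using c(3)[of f] by (simp add: inst_eq)
qed

lemma ex_body_I:
  assumes X: "G \<turnstile> X \<Colon> PCont i" and Y: "G \<turnstile> Y \<Colon> PCont i" and f: "G \<turnstile> f \<Colon> Arr (Sh X) (Sh Y)"
    and a: "G \<turnstile> a \<Colon> Sh X" and "holds G (Neg (Pos X a))" "holds G (Pos Y (App f a))"
  shows "holds G (Exist (Sh X) (ex_body X Y f))"
proof -
  have "holds G (Prod (Neg (Pos X a)) (Pos Y (App f a)))"
    using Neg_prop[OF Pos_prop[OF X a]] Pos_prop[OF Y app_Arr[OF f a]] assms(5,6) by (rule holds_and_I)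
  then show ?thesis
    using holds_ex_I[OF Sh_type[OF X] ex_body_prop[OF X Y f] a] by (simp add: ex_body_def inst_eq)
qed

section \<open>Evaluation\<close>

lemma evalfun_app:
  assumes X: "G \<turnstile> X \<Colon> PCont i" and Y: "G \<turnstile> Y \<Colon> PCont i"
  shows "G \<turnstile> evalfun \<Colon> Arr (Sh (PProd (Expo X Y) X)) (Sh Y)"
    and "G \<turnstile> w \<Colon> Sh (PProd (Expo X Y) X) \<Longrightarrow> G \<turnstile> App evalfun w \<approx> App (Fst w) (Snd w) \<Colon> Sh Y"
proof -
  note S = Sh_type[OF PProd_type[OF Expo_cont(1)[OF X Y] X]]
  note wf = wf_type[OF S]
  note X1 = wk_PCont[OF X wf] and Y1 = wk_PCont[OF Y wf]
  have v: "Sh (PProd (Expo X Y) X) # G \<turnstile> Var 0 \<Colon> Sh (PProd (Expo (wk X) (wk Y)) (wk X))"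
    using var0[OF wf] by simp
  note p = proj_PProd[OF Expo_cont(1)[OF X1 Y1] X1 v]
  have b: "Sh (PProd (Expo X Y) X) # G \<turnstile> App (Fst (Var 0)) (Snd (Var 0)) \<Colon> wk (Sh Y)"
    using app_Arr[OF _ p(2)] p(1) Expo_cont(2)[OF X1 Y1] by simp
  show "G \<turnstile> evalfun \<Colon> Arr (Sh (PProd (Expo X Y) X)) (Sh Y)"
    "G \<turnstile> w \<Colon> Sh (PProd (Expo X Y) X) \<Longrightarrow> G \<turnstile> App evalfun w \<approx> App (Fst w) (Snd w) \<Colon> Sh Y"
    unfolding evalfun_def using lam_Arr[OF S b] beta_Arr[OF S b, of w] by (simp_all add: inst_eq)
qed

text \<open>Here decidability enters. If \<open>Pos X\<close> holds at the argument, this is the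
  right-hand disjunct; if it is refuted, the argument itself witnesses the existential in the
  positions of \<open>Expo\<close>.\<close>

lemma evalfun_pos:
  assumes X: "G \<turnstile> X \<Colon> PCont i" and Y: "G \<turnstile> Y \<Colon> PCont i" and dec: "holds G (decidable X)"
    and w: "G \<turnstile> w \<Colon> Sh (PProd (Expo X Y) X)" and y: "holds G (Pos Y (App evalfun w))"
  shows "holds G (Pos (PProd (Expo X Y) X) w)"
proof -
  note E = Expo_cont(1)[OF X Y]
  note p = proj_PProd[OF E X w]
  have f: "G \<turnstile> Fst w \<Colon> Arr (Sh X) (Sh Y)" using p(1) by (simp add: Expo_cont(2)[OF X Y])
  have y': "holds G (Pos Y (App (Fst w) (Snd w)))"
    using y Pos_cong[OF Y evalfun_app(2)[OF X Y w]] by (rule holds_conv)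
  have pE: "G \<turnstile> Pos (Expo X Y) (Fst w) \<Colon> Prop" and pX: "G \<turnstile> Pos X (Snd w) \<Colon> Prop"
    using Pos_prop[OF E p(1)] Pos_prop[OF X p(2)] .
  note nX = Neg_prop[OF pX]
  have "holds G (Disj (Pos (Expo X Y) (Fst w)) (Pos X (Snd w)))"
  proof (rule holds_or_E[OF decidable_D[OF dec p(2)] pX nX t_disj[OF pE pX]])
    note wf = wf_prop[OF pX]
    show "holds (Pos X (Snd w) # G) (wk (Disj (Pos (Expo X Y) (Fst w)) (Pos X (Snd w))))"
      using holds_or_I(2)[OF typing_wk[OF pE wf, simplified] typing_wk[OF pX wf, simplified]]
        holds_assumption[OF wf] by simp
  next
    note wf = wf_prop[OF nX]
    note X1 = wk_PCont[OF X wf] and Y1 = wk_PCont[OF Y wf]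
    have f1: "Neg (Pos X (Snd w)) # G \<turnstile> wk (Fst w) \<Colon> Arr (Sh (wk X)) (Sh (wk Y))"
      using typing_wk[OF f wf] by simp
    have "holds (Neg (Pos X (Snd w)) # G) (Exist (Sh (wk X)) (ex_body (wk X) (wk Y) (wk (Fst w))))"
      using ex_body_I[OF X1 Y1 f1 wk_Sh[OF p(2) wf]] holds_assumption[OF wf] holds_wk[OF y' wf] by simp
    then have "holds (Neg (Pos X (Snd w)) # G) (Pos (Expo (wk X) (wk Y)) (wk (Fst w)))"
      using e_sym[OF Expo_cont(4)[OF X1 Y1 f1]] by (rule holds_conv)
    then show "holds (Neg (Pos X (Snd w)) # G) (wk (Disj (Pos (Expo X Y) (Fst w)) (Pos X (Snd w))))"
      using holds_or_I(1)[OF typing_wk[OF pE wf, simplified] typing_wk[OF pX wf, simplified]] by simp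
  qed
  then show ?thesis using e_sym[OF Pos_PProd[OF E X w]] by (rule holds_conv)
qed

lemma eval_hom:
  assumes X: "G \<turnstile> X \<Colon> PCont i" and Y: "G \<turnstile> Y \<Colon> PCont i" and dec: "holds G (decidable X)"
  obtains ev where "G \<turnstile> ev \<Colon> Hom (PProd (Expo X Y) X) Y"
    "G \<turnstile> Fst ev \<approx> evalfun \<Colon> Arr (Sh (PProd (Expo X Y) X)) (Sh Y)"
proof -
  note P = PProd_type[OF Expo_cont(1)[OF X Y] X] and f = evalfun_app(1)[OF X Y]
  note p = HomPos_prop(2)[OF P Y f]
  let ?D = "Pos (wk Y) (App (wk evalfun) (Var 0)) # Sh (PProd (Expo X Y) X) # G"
  note wf1 = wf_type[OF Sh_type[OF P]] and wf2 = wf_prop[OF p]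
  have v: "?D \<turnstile> Var (Suc 0) \<Colon> Sh (PProd (Expo (wk (wk X)) (wk (wk Y))) (wk (wk X)))"
    using var1[OF wf2] by simp
  have "holds ?D (Pos (wk (wk (PProd (Expo X Y) X))) (Var (Suc 0)))"
    using evalfun_pos[OF wk_PCont[OF wk_PCont[OF X wf1] wf2] wk_PCont[OF wk_PCont[OF Y wf1] wf2] _ v]
      holds_wk[OF holds_wk[OF dec wf1] wf2] holds_assumption[OF wf2] by simp
  then show thesis using Hom_I[OF P Y f] that by blast
qed

section \<open>Currying\<close>

lemma row_app:
  assumes X: "G \<turnstile> X \<Colon> PCont i" and Y: "G \<turnstile> Y \<Colon> PCont i" and Z: "G \<turnstile> Z \<Colon> PCont i"
    and f: "G \<turnstile> f \<Colon> Hom (PProd Z X) Y" and z: "G \<turnstile> z \<Colon> Sh Z"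
  shows "G \<turnstile> row f z \<Colon> Arr (Sh X) (Sh Y)"
    and "G \<turnstile> a \<Colon> Sh X \<Longrightarrow> G \<turnstile> App (row f z) a \<approx> App (Fst f) (Pair z a) \<Colon> Sh Y"
proof -
  note S = Sh_type[OF X]
  note wf = wf_type[OF S]
  have v: "Sh X # G \<turnstile> Var 0 \<Colon> Sh (wk X)" using var0[OF wf] by simp
  have f1: "Sh X # G \<turnstile> wk f \<Colon> Hom (PProd (wk Z) (wk X)) (wk Y)" using wk_Hom[OF f wf] by simp
  have b: "Sh X # G \<turnstile> App (Fst (wk f)) (Pair (wk z) (Var 0)) \<Colon> wk (Sh Y)"
    using Hom_app[OF f1 pair_PProd(1)[OF wk_PCont[OF Z wf] wk_PCont[OF X wf] wk_Sh[OF z wf] v]] by simp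
  show "G \<turnstile> row f z \<Colon> Arr (Sh X) (Sh Y)"
    "G \<turnstile> a \<Colon> Sh X \<Longrightarrow> G \<turnstile> App (row f z) a \<approx> App (Fst f) (Pair z a) \<Colon> Sh Y"
    unfolding row_def using lam_Arr[OF S b] beta_Arr[OF S b, of a] by (simp_all add: inst_eq)
qed

lemma curfun_app:
  assumes X: "G \<turnstile> X \<Colon> PCont i" and Y: "G \<turnstile> Y \<Colon> PCont i" and Z: "G \<turnstile> Z \<Colon> PCont i"
    and f: "G \<turnstile> f \<Colon> Hom (PProd Z X) Y"
  shows "G \<turnstile> curfun f \<Colon> Arr (Sh Z) (Sh (Expo X Y))"
    and "G \<turnstile> z \<Colon> Sh Z \<Longrightarrow> G \<turnstile> a \<Colon> Sh X \<Longrightarrow>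
      G \<turnstile> App (App (curfun f) z) a \<approx> App (Fst f) (Pair z a) \<Colon> Sh Y"
proof -
  note S = Sh_type[OF Z]
  note wf = wf_type[OF S]
  note X1 = wk_PCont[OF X wf] and Y1 = wk_PCont[OF Y wf]
  have v: "Sh Z # G \<turnstile> Var 0 \<Colon> Sh (wk Z)" using var0[OF wf] by simp
  have f1: "Sh Z # G \<turnstile> wk f \<Colon> Hom (PProd (wk Z) (wk X)) (wk Y)" using wk_Hom[OF f wf] by simp
  have b: "Sh Z # G \<turnstile> row (wk f) (Var 0) \<Colon> wk (Sh (Expo X Y))"
    using row_app(1)[OF X1 Y1 wk_PCont[OF Z wf] f1 v] Expo_cont(2)[OF X1 Y1] by simp
  show "G \<turnstile> curfun f \<Colon> Arr (Sh Z) (Sh (Expo X Y))"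
    unfolding curfun_def using S b by (rule lam_Arr)
  assume z: "G \<turnstile> z \<Colon> Sh Z" and a: "G \<turnstile> a \<Colon> Sh X"
  have "G \<turnstile> App (curfun f) z \<approx> row f z \<Colon> Arr (Sh X) (Sh Y)"
    using beta_Arr[OF S b z] by (simp add: curfun_def inst_eq Expo_cont(3)[OF X Y])
  from app_Arr_cong[OF this e_refl[OF a]] row_app(2)[OF X Y Z f z a]
  show "G \<turnstile> App (App (curfun f) z) a \<approx> App (Fst f) (Pair z a) \<Colon> Sh Y" by (rule e_trans)
qed

text \<open>The position part of \<open>f\<close> gives \<open>Pos Z z\<close> or
  \<open>Pos X a\<close>, and \<open>n\<close> excludes the latter. This is why the negation appears
  in the positions of \<open>Expo\<close>.\<close>

lemma curfun_pos_at:
  assumes X: "G \<turnstile> X \<Colon> PCont i" and Y: "G \<turnstile> Y \<Colon> PCont i" and Z: "G \<turnstile> Z \<Colon> PCont i"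
    and f: "G \<turnstile> f \<Colon> Hom (PProd Z X) Y" and z: "G \<turnstile> z \<Colon> Sh Z" and a: "G \<turnstile> a \<Colon> Sh X"
    and n: "holds G (Neg (Pos X a))" and y: "holds G (Pos Y (App (App (curfun f) z) a))"
  shows "holds G (Pos Z z)"
proof -
  note P = pair_PProd[OF Z X z a]
  have "holds G (Pos Y (App (Fst f) (Pair z a)))"
    using y Pos_cong[OF Y curfun_app(2)[OF X Y Z f z a]] by (rule holds_conv)
  then have "holds G (Pos (PProd Z X) (Pair z a))"
    using Hom_snd_app[OF f P(1)] by (auto simp: holds_def)
  then have "holds G (Disj (Pos Z (Fst (Pair z a))) (Pos X (Snd (Pair z a))))"
    using Pos_PProd[OF Z X P(1)] by (rule holds_conv)
  then have d: "holds G (Disj (Pos Z z) (Pos X a))"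
    using e_disj[OF Pos_cong[OF Z P(2)] Pos_cong[OF X P(3)]] by (rule holds_conv)
  have pZ: "G \<turnstile> Pos Z z \<Colon> Prop" and pX: "G \<turnstile> Pos X a \<Colon> Prop"
    using Pos_prop[OF Z z] Pos_prop[OF X a] .
  show ?thesis
  proof (rule holds_or_E[OF d pZ pX pZ])
    show "holds (Pos Z z # G) (wk (Pos Z z))" using wf_prop[OF pZ] by (rule holds_assumption)
    note wf = wf_prop[OF pX]
    have "holds (Pos X a # G) (Arr (wk (Pos X a)) Bot)" using holds_wk[OF n wf] by (simp add: Neg_def)
    from holds_imp_D[OF this holds_assumption[OF wf]]
    show "holds (Pos X a # G) (wk (Pos Z z))" using typing_wk[OF pZ wf] by (auto intro: holds_bot_E)
  qed
qed

lemma curfun_pos: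
  assumes X: "G \<turnstile> X \<Colon> PCont i" and Y: "G \<turnstile> Y \<Colon> PCont i" and Z: "G \<turnstile> Z \<Colon> PCont i"
    and f: "G \<turnstile> f \<Colon> Hom (PProd Z X) Y" and z: "G \<turnstile> z \<Colon> Sh Z"
    and e: "holds G (Pos (Expo X Y) (App (curfun f) z))"
  shows "holds G (Pos Z z)"
proof -
  have c: "G \<turnstile> App (curfun f) z \<Colon> Arr (Sh X) (Sh Y)"
    using app_Arr[OF curfun_app(1)[OF X Y Z f] z] by (simp add: Expo_cont(2)[OF X Y])
  note S = Sh_type[OF X] and b = ex_body_prop[OF X Y c]
  note wf1 = wf_type[OF S] and wf2 = wf_prop[OF b]
  let ?D = "ex_body X Y (App (curfun f) z) # Sh X # G"
  \<comment> \<open>\<open>Var (Suc 0)\<close> is the argument witnessing the position of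
    \<open>Expo\<close>; it may be used because the goal \<open>Pos Z z\<close> is a
    proposition.\<close>
  have a: "?D \<turnstile> Var (Suc 0) \<Colon> Sh (wk (wk X))" using var1[OF wf2] by simp
  have "holds ?D (wk (ex_body X Y (App (curfun f) z)))" using wf2 by (rule holds_assumption)
  then have h: "holds ?D (Prod (Neg (Pos (wk (wk X)) (Var (Suc 0))))
      (Pos (wk (wk Y)) (App (App (curfun (wk (wk f))) (wk (wk z))) (Var (Suc 0)))))"
    unfolding ex_body_def by simp
  have "holds ?D (Pos (wk (wk Z)) (wk (wk z)))"
    by (rule curfun_pos_at[OF wk_PCont[OF wk_PCont[OF X wf1] wf2] wk_PCont[OF wk_PCont[OF Y wf1] wf2]
        wk_PCont[OF wk_PCont[OF Z wf1] wf2] wk_Hom[OF wk_Hom[OF f wf1] wf2, simplified]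
        wk_Sh[OF wk_Sh[OF z wf1] wf2] a holds_and_D[OF h]])
  then show ?thesis
    using holds_ex_E[OF holds_conv[OF e Expo_cont(4)[OF X Y c]] S b Pos_prop[OF Z z]] by simp
qed

lemma cur_hom:
  assumes X: "G \<turnstile> X \<Colon> PCont i" and Y: "G \<turnstile> Y \<Colon> PCont i" and Z: "G \<turnstile> Z \<Colon> PCont i"
    and f: "G \<turnstile> f \<Colon> Hom (PProd Z X) Y"
  obtains g where "G \<turnstile> g \<Colon> Hom Z (Expo X Y)" "G \<turnstile> Fst g \<approx> curfun f \<Colon> Arr (Sh Z) (Sh (Expo X Y))"
proof -
  note E = Expo_cont(1)[OF X Y] and c = curfun_app(1)[OF X Y Z f]
  note p = HomPos_prop(2)[OF Z E c]
  let ?D = "Pos (wk (Expo X Y)) (App (wk (curfun f)) (Var 0)) # Sh Z # G"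
  note wf1 = wf_type[OF Sh_type[OF Z]] and wf2 = wf_prop[OF p]
  have z: "?D \<turnstile> Var (Suc 0) \<Colon> Sh (wk (wk Z))" using var1[OF wf2] by simp
  have f2: "?D \<turnstile> wk (wk f) \<Colon> Hom (PProd (wk (wk Z)) (wk (wk X))) (wk (wk Y))"
    using wk_Hom[OF wk_Hom[OF f wf1] wf2] by simp
  have "holds ?D (Pos (wk (wk Z)) (Var (Suc 0)))"
    using curfun_pos[OF wk_PCont[OF wk_PCont[OF X wf1] wf2] wk_PCont[OF wk_PCont[OF Y wf1] wf2]
        wk_PCont[OF wk_PCont[OF Z wf1] wf2] f2 z]
      holds_assumption[OF wf2] by simp
  then show thesis using Hom_I[OF Z E c] that by blast
qed

section \<open>Universal property of the exponential\<close>

lemma eval_transpose: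
  assumes X: "G \<turnstile> X \<Colon> PCont i" and Y: "G \<turnstile> Y \<Colon> PCont i" and Z: "G \<turnstile> Z \<Colon> PCont i"
    and ev: "G \<turnstile> ev \<Colon> Hom (PProd (Expo X Y) X) Y"
    and ev': "G \<turnstile> Fst ev \<approx> evalfun \<Colon> Arr (Sh (PProd (Expo X Y) X)) (Sh Y)"
    and h: "G \<turnstile> h \<Colon> Hom Z (Expo X Y)" and w: "G \<turnstile> w \<Colon> Sh (PProd Z X)"
  shows "G \<turnstile> App (Fst (comp ev (mtimes h idm))) w \<approx> App (App (Fst h) (Fst w)) (Snd w) \<Colon> Sh Y"
proof -
  note E = Expo_cont(1)[OF X Y]
  note w1 = proj_PProd[OF Z X w]
  note P = pair_PProd[OF E X Hom_app[OF h w1(1)] w1(2)]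
  note 1 = transpose_hom(2)[OF X Y Z E ev h w]
  note 2 = app_Arr_cong[OF ev' e_refl[OF P(1)]]
  note 3 = evalfun_app(2)[OF X Y P(1)]
  note 4 = app_Arr_cong[OF P(2)[unfolded Expo_cont(3)[OF X Y]] P(3)]
  show ?thesis by (rule e_trans[OF e_trans[OF 1 2] e_trans[OF 3 4]])
qed

lemma cur_transpose:
  assumes X: "G \<turnstile> X \<Colon> PCont i" and Y: "G \<turnstile> Y \<Colon> PCont i" and Z: "G \<turnstile> Z \<Colon> PCont i"
    and ev: "G \<turnstile> ev \<Colon> Hom (PProd (Expo X Y) X) Y"
    and ev': "G \<turnstile> Fst ev \<approx> evalfun \<Colon> Arr (Sh (PProd (Expo X Y) X)) (Sh Y)"
    and f: "G \<turnstile> f \<Colon> Hom (PProd Z X) Y"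
    and g: "G \<turnstile> g \<Colon> Hom Z (Expo X Y)"
    and g': "G \<turnstile> Fst g \<approx> curfun f \<Colon> Arr (Sh Z) (Sh (Expo X Y))"
  shows "G \<turnstile> comp ev (mtimes g idm) \<approx> f \<Colon> Hom (PProd Z X) Y"
proof -
  \<comment> \<open>A pointwise version over an arbitrary context, to be applied at the generic
    shape \<open>Var 0\<close> of the product.\<close>
  have at: "D \<turnstile> App (Fst (comp ev (mtimes g idm))) w \<approx> App (Fst f) w \<Colon> Sh Y"
    if X: "D \<turnstile> X \<Colon> PCont i" and Y: "D \<turnstile> Y \<Colon> PCont i" and Z: "D \<turnstile> Z \<Colon> PCont i"
      and ev: "D \<turnstile> ev \<Colon> Hom (PProd (Expo X Y) X) Y"
      and ev': "D \<turnstile> Fst ev \<approx> evalfun \<Colon> Arr (Sh (PProd (Expo X Y) X)) (Sh Y)"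
      and f: "D \<turnstile> f \<Colon> Hom (PProd Z X) Y"
      and g: "D \<turnstile> g \<Colon> Hom Z (Expo X Y)"
      and g': "D \<turnstile> Fst g \<approx> curfun f \<Colon> Arr (Sh Z) (Sh (Expo X Y))"
      and w: "D \<turnstile> w \<Colon> Sh (PProd Z X)" for D X Y Z ev f g w
  proof -
    note w1 = proj_PProd[OF Z X w]
    note 1 = eval_transpose[OF X Y Z ev ev' g w]
    note 2 = app_Arr_cong[OF app_Arr_cong[OF g' e_refl[OF w1(1)], unfolded Expo_cont(3)[OF X Y]] e_refl[OF w1(2)]]
    note 3 = curfun_app(2)[OF X Y Z f w1(1,2)]
    note 4 = Hom_app_cong[OF f e_sym[OF w1(3)]]
    show ?thesis by (rule e_trans[OF e_trans[OF 1 2] e_trans[OF 3 4]])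
  qed
  note P = PProd_type[OF Z X]
  note wf = wf_type[OF Sh_type[OF P]]
  have w: "Sh (PProd Z X) # G \<turnstile> Var 0 \<Colon> Sh (PProd (wk Z) (wk X))" using var0[OF wf] by simp
  note at1 = at[OF wk_PCont[OF X wf] wk_PCont[OF Y wf] wk_PCont[OF Z wf] wk_Hom[OF ev wf, simplified]
      equal_wk[OF ev' wf, simplified] wk_Hom[OF f wf, simplified] wk_Hom[OF g wf, simplified]
      equal_wk[OF g' wf, simplified] w]
  show ?thesis
    using P Y transpose_hom(1)[OF X Y Z Expo_cont(1)[OF X Y] ev g] f by (rule Hom_ext) (use at1 in simp)
qed

text \<open>Evaluation undoes transposition pointwise: at the pair of \<open>z\<close> and
  \<open>a\<close> the composite returns the curried map at \<open>z\<close> and \<open>a\<close>.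
  Extensionality of functions in \<open>a\<close> and of morphisms in \<open>z\<close> then yields
  \<open>eval_cancel\<close>.\<close>

lemma eval_cancel_at:
  assumes X: "G \<turnstile> X \<Colon> PCont i" and Y: "G \<turnstile> Y \<Colon> PCont i" and Z: "G \<turnstile> Z \<Colon> PCont i"
    and ev: "G \<turnstile> ev \<Colon> Hom (PProd (Expo X Y) X) Y"
    and ev': "G \<turnstile> Fst ev \<approx> evalfun \<Colon> Arr (Sh (PProd (Expo X Y) X)) (Sh Y)"
    and g: "G \<turnstile> g \<Colon> Hom Z (Expo X Y)" and h: "G \<turnstile> h \<Colon> Hom Z (Expo X Y)"
    and eq: "G \<turnstile> comp ev (mtimes g idm) \<approx> comp ev (mtimes h idm) \<Colon> Hom (PProd Z X) Y"
    and z: "G \<turnstile> z \<Colon> Sh Z" and a: "G \<turnstile> a \<Colon> Sh X"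
  shows "G \<turnstile> App (App (Fst g) z) a \<approx> App (App (Fst h) z) a \<Colon> Sh Y"
proof -
  note P = pair_PProd[OF Z X z a]
  have at: "G \<turnstile> App (Fst (comp ev (mtimes k idm))) (Pair z a) \<approx> App (App (Fst k) z) a \<Colon> Sh Y"
    if k: "G \<turnstile> k \<Colon> Hom Z (Expo X Y)" for k
    using eval_transpose[OF X Y Z ev ev' k P(1)]
      app_Arr_cong[OF Hom_app_cong[OF k P(2), unfolded Expo_cont(3)[OF X Y]] P(3)]
    by (rule e_trans)
  show ?thesis
    by (rule e_trans[OF e_sym[OF at[OF g]] e_trans[OF app_Arr_cong[OF Hom_fst_cong[OF eq] e_refl[OF P(1)]] at[OF h]]])
qed

lemma eval_cancel_app:
  assumes X: "G \<turnstile> X \<Colon> PCont i" and Y: "G \<turnstile> Y \<Colon> PCont i" and Z: "G \<turnstile> Z \<Colon> PCont i"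
    and ev: "G \<turnstile> ev \<Colon> Hom (PProd (Expo X Y) X) Y"
    and ev': "G \<turnstile> Fst ev \<approx> evalfun \<Colon> Arr (Sh (PProd (Expo X Y) X)) (Sh Y)"
    and g: "G \<turnstile> g \<Colon> Hom Z (Expo X Y)" and h: "G \<turnstile> h \<Colon> Hom Z (Expo X Y)"
    and eq: "G \<turnstile> comp ev (mtimes g idm) \<approx> comp ev (mtimes h idm) \<Colon> Hom (PProd Z X) Y"
    and z: "G \<turnstile> z \<Colon> Sh Z"
  shows "G \<turnstile> App (Fst g) z \<approx> App (Fst h) z \<Colon> Sh (Expo X Y)"
proof -
  note wf = wf_type[OF Sh_type[OF X]]
  have a: "Sh X # G \<turnstile> Var 0 \<Colon> Sh (wk X)" using var0[OF wf] by simp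
  note at = eval_cancel_at[OF wk_PCont[OF X wf] wk_PCont[OF Y wf] wk_PCont[OF Z wf]
      wk_Hom[OF ev wf, simplified] equal_wk[OF ev' wf, simplified] wk_Hom[OF g wf, simplified]
      wk_Hom[OF h wf, simplified] equal_wk[OF eq wf, simplified] wk_Sh[OF z wf] a]
  have "G \<turnstile> App (Fst g) z \<Colon> Arr (Sh X) (Sh Y)" "G \<turnstile> App (Fst h) z \<Colon> Arr (Sh X) (Sh Y)"
    using Hom_app[OF g z] Hom_app[OF h z] by (simp_all add: Expo_cont(2)[OF X Y])
  then show ?thesis
    unfolding Expo_cont(3)[OF X Y] by (rule Arr_ext[OF Sh_type[OF X]]) (use at in simp)
qed

lemma eval_cancel:
  assumes X: "G \<turnstile> X \<Colon> PCont i" and Y: "G \<turnstile> Y \<Colon> PCont i" and Z: "G \<turnstile> Z \<Colon> PCont i"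
    and ev: "G \<turnstile> ev \<Colon> Hom (PProd (Expo X Y) X) Y"
    and ev': "G \<turnstile> Fst ev \<approx> evalfun \<Colon> Arr (Sh (PProd (Expo X Y) X)) (Sh Y)"
    and g: "G \<turnstile> g \<Colon> Hom Z (Expo X Y)" and h: "G \<turnstile> h \<Colon> Hom Z (Expo X Y)"
    and eq: "G \<turnstile> comp ev (mtimes g idm) \<approx> comp ev (mtimes h idm) \<Colon> Hom (PProd Z X) Y"
  shows "G \<turnstile> g \<approx> h \<Colon> Hom Z (Expo X Y)"
proof -
  note wf = wf_type[OF Sh_type[OF Z]]
  have z: "Sh Z # G \<turnstile> Var 0 \<Colon> Sh (wk Z)" using var0[OF wf] by simp
  note at = eval_cancel_app[OF wk_PCont[OF X wf] wk_PCont[OF Y wf] wk_PCont[OF Z wf]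
      wk_Hom[OF ev wf, simplified] equal_wk[OF ev' wf, simplified] wk_Hom[OF g wf, simplified]
      wk_Hom[OF h wf, simplified] equal_wk[OF eq wf, simplified] z]
  show ?thesis
    using Z Expo_cont(1)[OF X Y] g h by (rule Hom_ext) (use at in simp)
qed

lemma eval_universal:
  assumes X: "G \<turnstile> X \<Colon> PCont i" and Y: "G \<turnstile> Y \<Colon> PCont i" and Z: "G \<turnstile> Z \<Colon> PCont i"
    and ev: "G \<turnstile> ev \<Colon> Hom (PProd (Expo X Y) X) Y"
    and ev': "G \<turnstile> Fst ev \<approx> evalfun \<Colon> Arr (Sh (PProd (Expo X Y) X)) (Sh Y)"
    and f: "G \<turnstile> f \<Colon> Hom (PProd Z X) Y"
  shows "holds G (Ex1 (Hom Z (Expo X Y)) (Transp Z X Y ev f))"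
proof -
  note E = Expo_cont(1)[OF X Y]
  obtain g where g: "G \<turnstile> g \<Colon> Hom Z (Expo X Y)"
    and g': "G \<turnstile> Fst g \<approx> curfun f \<Colon> Arr (Sh Z) (Sh (Expo X Y))"
    using cur_hom[OF X Y Z f] by blast
  note eq = cur_transpose[OF X Y Z ev ev' f g g']
  show ?thesis
  proof (rule universal_I[OF X Y Z E ev f g eq])
    let ?D = "Transp Z X Y ev f # Hom Z (Expo X Y) # G"
    note wf1 = wf_type[OF Hom_type[OF Z E]] and wf2 = wf_prop[OF Transp_prop[OF X Y Z E ev f]]
    have h: "?D \<turnstile> Var (Suc 0) \<Colon> Hom (wk (wk Z)) (Expo (wk (wk X)) (wk (wk Y)))"
      using var1[OF wf2] by simp
    have "holds ?D (wk (Transp Z X Y ev f))" using wf2 by (rule holds_assumption)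
    then have "?D \<turnstile> comp (wk (wk ev)) (mtimes (Var (Suc 0)) idm) \<approx> wk (wk f)
        \<Colon> Hom (PProd (wk (wk Z)) (wk (wk X))) (wk (wk Y))"
      unfolding Transp_def by (intro holds_Ident) simp
    \<comment> \<open>The competing factorisation and \<open>g\<close> have the same transpose
      \<open>f\<close>, so cancellation applies.\<close>
    from e_trans[OF this e_sym[OF equal_wk[OF equal_wk[OF eq wf1] wf2, simplified]]]
    have "?D \<turnstile> comp (wk (wk ev)) (mtimes (Var (Suc 0)) idm) \<approx> comp (wk (wk ev)) (mtimes (wk (wk g)) idm)
        \<Colon> Hom (PProd (wk (wk Z)) (wk (wk X))) (wk (wk Y))" .
    from eval_cancel[OF wk_PCont[OF wk_PCont[OF X wf1] wf2] wk_PCont[OF wk_PCont[OF Y wf1] wf2]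
        wk_PCont[OF wk_PCont[OF Z wf1] wf2] wk_Hom[OF wk_Hom[OF ev wf1] wf2, simplified]
        equal_wk[OF equal_wk[OF ev' wf1] wf2, simplified] h wk_Hom[OF wk_Hom[OF g wf1] wf2, simplified] this]
    show "?D \<turnstile> Var (Suc 0) \<approx> wk (wk g) \<Colon> Hom (wk (wk Z)) (wk (wk (Expo X Y)))" by simp
  qed
qed

lemma Expo_is_exponential:
  assumes X: "G \<turnstile> X \<Colon> PCont i" and Y: "G \<turnstile> Y \<Colon> PCont i"
    and ev: "G \<turnstile> ev \<Colon> Hom (PProd (Expo X Y) X) Y"
    and ev': "G \<turnstile> Fst ev \<approx> evalfun \<Colon> Arr (Sh (PProd (Expo X Y) X)) (Sh Y)"
  shows "holds G (is_exponential i X Y (Expo X Y) ev)"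
proof -
  note b = is_exponential_body[OF X Y Expo_cont(1)[OF X Y] ev]
  note u = eval_universal[OF b(4,5,6) b(8)[simplified] equal_wk[OF equal_wk[OF ev' b(1)] b(3), simplified] b(9)]
  show ?thesis
    unfolding is_exponential_eq
    by (rule holds_all_I[OF PCont_type[OF wf_typing[OF X]] holds_all_I[OF b(2)]]) (use u in simp)
qed

lemma decidable_imp_exponentiable:
  assumes X: "G \<turnstile> X \<Colon> PCont i" and dec: "holds G (decidable X)"
  shows "holds G (exponentiable i X)"
proof -
  have P: "G \<turnstile> PCont i \<Colon> Univ (Suc i)" by (rule PCont_type[OF wf_typing[OF X]])
  note wf = wf_type[OF P]
  note X1 = wk_PCont[OF X wf]
  have Y: "PCont i # G \<turnstile> Var 0 \<Colon> PCont i" using var0[OF wf] by simp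
  have "holds (PCont i # G) (decidable (wk X))" using holds_wk[OF dec wf] by simp
  then obtain ev where ev: "PCont i # G \<turnstile> ev \<Colon> Hom (PProd (Expo (wk X) (Var 0)) (wk X)) (Var 0)"
    and ev': "PCont i # G \<turnstile> Fst ev \<approx> evalfun \<Colon> Arr (Sh (PProd (Expo (wk X) (Var 0)) (wk X))) (Sh (Var 0))"
    using eval_hom[OF X1 Y] by blast
  have "holds (PCont i # G) (HasExp i (wk X) (Var 0))"
    using HasExp_I[OF X1 Y Expo_cont(1)[OF X1 Y] ev Expo_is_exponential[OF X1 Y ev ev']] .
  then show ?thesis unfolding exponentiable_eq by (rule holds_all_I[OF P])
qed

theorem theorem14:
  fixes i :: nat
  shows "\<exists>t. [] \<turnstile> t \<Colon>
    Pi (Univ i) (Pi (Arr (Var 0) Prop)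
      (Iff (exponentiable i (Var 1 \<triangleleft> Var 0)) (decidable (Var 1 \<triangleleft> Var 0))))"
proof -
  let ?G = "[Arr (Var 0) Prop, Univ i]"
  note B = PCont_body[OF wf_nil, of i]
  note wf = wf_type[OF B]
  have X: "?G \<turnstile> Var 1 \<triangleleft> Var 0 \<Colon> PCont i"
    using cont_intro(1)[of ?G "Var 1" i "Var 0"] var0[OF wf] var1[OF wf] by simp
  note e = exponentiable_prop[OF X] and d = decidable_prop[OF X]
  have "holds ?G (Arr (exponentiable i (Var 1 \<triangleleft> Var 0)) (decidable (Var 1 \<triangleleft> Var 0)))"
    using exponentiable_imp_decidable[OF wk_PCont[OF X wf_prop[OF e]]] holds_assumption[OF wf_prop[OF e]]
    by (intro holds_imp_I[OF e]) simp
  moreover have "holds ?G (Arr (decidable (Var 1 \<triangleleft> Var 0)) (exponentiable i (Var 1 \<triangleleft> Var 0)))"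
    using decidable_imp_exponentiable[OF wk_PCont[OF X wf_prop[OF d]]] holds_assumption[OF wf_prop[OF d]]
    by (intro holds_imp_I[OF d]) simp
  ultimately have "holds ?G (Iff (exponentiable i (Var 1 \<triangleleft> Var 0)) (decidable (Var 1 \<triangleleft> Var 0)))"
    unfolding Iff_def using Imp_prop[OF e d] Imp_prop[OF d e] by (blast intro: holds_and_I)
  from holds_all_I[OF t_univ[OF wf_nil] holds_all_I[OF B this]] show ?thesis
    unfolding holds_def .
qed

end
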